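(* Let $n\geq 6$ be an even integer and let $Q(x)=(n-1)!+\varphi(x)$, where $\varphi$ is a polynomial on $\mathbb{R}^n$ with $\varphi(x)\leq 0$ for all $x\in\mathbb{R}^n$. Let $u$ be a normal solution on $\mathbb{R}^n$ with Q-curvature $Q$. If $4\leq\deg\varphi\leq n-2$, assume additionally that, up to a rotation or a translation of the coordinates (i.e. after replacing $\varphi$ by $\varphi(Ax+b)$ for some rotation $A$ of $\mathbb{R}^n$ and some $b\in\mathbb{R}^n$), $$x\cdot\nabla\varphi(x)\geq(\deg\varphi)\,\varphi(x)\qquad\text{for all }x\in\mathbb{R}^n.$$ Then $$\int_{\mathbb{R}^n}e^{nu}\,dx\geq|\mathbb{S}^n|,$$ with equality if and only if $\varphi\equiv 0$.
   Context: $|\mathbb{S}^n|$ denotes the volume of the standard unit $n$-sphere. For $n$ even and $Q\in C^\infty(\mathbb{R}^n)$, a normal solution with Q-curvature $Q$ is a function $u\in C^\infty(\mathbb{R}^n)$ with $Qe^{nu}\in L^1(\mathbb{R}^n)$ such that, for some constant $C\in\mathbb{R}$ and all $x\in\mathbb{R}^n$, $$u(x)=\frac{2}{(n-1)!\,|\mathbb{S}^n|}\int_{\mathbb{R}^n}\log\frac{|y|}{|x-y|}\,Q(y)e^{nu(y)}\,dy+C.$$ The integral $\int_{\mathbb{R}^n}e^{nu}dx$ is allowed to be $+\infty$. *)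

theory Defs
  imports "HOL-Analysis.Analysis" "HOL-Library.Poly_Mapping"
begin

text \<open>
  Real polynomials in the coordinates \<open>x $ i\<close>, \<open>i :: 'n\<close>: finitely supported maps from exponent
  vectors \<open>'n \<Rightarrow>\<^sub>0 nat\<close> to coefficients.
\<close>

type_synonym 'n real_mpoly = "('n \<Rightarrow>\<^sub>0 nat) \<Rightarrow>\<^sub>0 real"

definition mpoly_fun :: "'n::finite real_mpoly \<Rightarrow> real ^ 'n \<Rightarrow> real" where
  "mpoly_fun p x = (\<Sum>m\<in>Poly_Mapping.keys p. Poly_Mapping.lookup p m * (\<Prod>i\<in>UNIV. (x $ i) ^ Poly_Mapping.lookup m i))"

text \<open>The zero polynomial gets degree 0.\<close>

definition mpoly_degree :: "'n::finite real_mpoly \<Rightarrow> nat" where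
  "mpoly_degree p = Max (insert 0 ((\<lambda>m. \<Sum>i\<in>UNIV. Poly_Mapping.lookup m i) ` Poly_Mapping.keys p))"

definition partial_deriv :: "(real ^ 'n \<Rightarrow> real) \<Rightarrow> 'n::finite \<Rightarrow> real ^ 'n \<Rightarrow> real" where
  "partial_deriv f i x = frechet_derivative f (at x) (axis i 1)"

definition gradient :: "(real ^ 'n \<Rightarrow> real) \<Rightarrow> real ^ 'n \<Rightarrow> real ^ 'n::finite" where
  "gradient f x = (\<chi> i. partial_deriv f i x)"

primrec C_k :: "nat \<Rightarrow> (real ^ 'n::finite \<Rightarrow> real) \<Rightarrow> bool" where
  "C_k 0 f \<longleftrightarrow> continuous_on UNIV f"
| "C_k (Suc k) f \<longleftrightarrow> (\<forall>x. f differentiable (at x)) \<and> (\<forall>i. C_k k (partial_deriv f i))"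

definition C_infinity :: "(real ^ 'n::finite \<Rightarrow> real) \<Rightarrow> bool" where
  "C_infinity f \<longleftrightarrow> (\<forall>k. C_k k f)"

text \<open>
  The volume of the standard unit \<open>n\<close>-sphere in \<open>\<real>\<^bsup>n+1\<^esup>\<close>. As for
  \<^const>\<open>unit_ball_vol\<close>, the definition is the closed form. The lemma below relates it to Lebesgue
  measure: it is the rate of growth of the volume of the balls in dimension \<open>n + 1\<close> at radius 1.
\<close>

definition unit_sphere_vol :: "nat \<Rightarrow> real" where
  "unit_sphere_vol n = 2 * pi powr ((real n + 1) / 2) / Gamma ((real n + 1) / 2)"

lemma unit_sphere_vol_eq: "unit_sphere_vol n = (real n + 1) * unit_ball_vol (real n + 1)"
proof -
  define a where "a = (real n + 1) / 2"
  have a: "a > 0" "real n + 1 = 2 * a"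
    by (simp_all add: a_def)
  then have "Gamma (a + 1) = a * Gamma a"
    by (intro Gamma_plus1) (auto elim!: nonpos_Ints_cases)
  with a show ?thesis
    by (simp add: unit_sphere_vol_def unit_ball_vol_def)
qed

lemma unit_sphere_vol_deriv_ball_vol:
  assumes "DIM('a::euclidean_space) = n + 1"
  shows "((\<lambda>r. measure lborel (ball (0::'a) r)) has_real_derivative unit_sphere_vol n) (at 1)"
proof -
  have "((\<lambda>r. unit_ball_vol (real n + 1) * r ^ (n + 1)) has_real_derivative unit_sphere_vol n) (at 1)"
    by (auto intro!: derivative_eq_intros simp: unit_sphere_vol_eq)
  then show ?thesis
  proof (rule DERIV_cong_ev[THEN iffD1, rotated -1])
    show "\<forall>\<^sub>F r in nhds 1. unit_ball_vol (real n + 1) * r ^ (n + 1) = measure lborel (ball (0::'a) r)"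
      using eventually_nhds_in_open[of "{0<..}" "1::real"]
      by (rule eventually_mono[rotated 2]) (auto simp: content_ball assms add_ac)
  qed auto
qed

text \<open>
  The logarithmic kernel is evaluated with \<open>ln 0 = 0\<close> at \<open>y = 0\<close> and \<open>a / 0 = 0\<close> at \<open>y = x\<close>;
  these points form a null set. For integrable \<open>Q e\<^bsup>nu\<^esup>\<close> with \<open>Q\<close>, \<open>u\<close> continuous, the
  integral converges absolutely for every \<open>x\<close>.
\<close>

definition normal_solution :: "(real ^ 'n \<Rightarrow> real) \<Rightarrow> (real ^ 'n::finite \<Rightarrow> real) \<Rightarrow> bool" where
  "normal_solution Q u \<longleftrightarrow>
     C_infinity u \<and>
     integrable lborel (\<lambda>y. Q y * exp (real CARD('n) * u y)) \<and>
     (\<exists>C. \<forall>x. u x =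
        2 / (fact (CARD('n) - 1) * unit_sphere_vol CARD('n)) *
        (LINT y|lborel. ln (norm y / norm (x - y)) * Q y * exp (real CARD('n) * u y)) + C)"

end

theory Submission
  imports Defs "HOL-Computational_Algebra.Polynomial"
begin

text \<open>
  Write \<open>n\<close> for the dimension, \<open>c = 2 / ((n - 1)! |S\<^sup>n|)\<close>, \<open>f = Q e\<^bsup>nu\<^esup>\<close>, \<open>\<alpha> = c \<integral>f\<close> and
  \<open>F = - c \<integral>\<phi> e\<^bsup>nu\<^esup> \<ge> 0\<close>. If the volume \<open>V = \<integral>e\<^bsup>nu\<^esup>\<close> is finite, then \<open>2 V / |S\<^sup>n| = \<alpha> + F\<close>, so the
  claim is \<open>\<alpha> + F \<ge> 2\<close>, with \<open>F = 0\<close> in the case of equality. Let \<open>d\<close> be the degree of \<open>\<phi>\<close>.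

  On the balls \<open>t B\<close> the average of \<open>u\<close> is \<open>- (\<alpha> + o(1)) ln t\<close>. Where \<open>|\<phi>|\<close> is at least \<open>\<kappa> t\<^sup>d\<close>, Jensen's
  inequality bounds \<open>\<integral>|\<phi>| e\<^bsup>nu\<^esup>\<close> from below by a multiple of \<open>t\<close> to the power \<open>n + d - n \<alpha> - o(1)\<close>; hence
  \<open>\<alpha> \<ge> 1 + d / n\<close>. This settles \<open>d \<ge> n\<close>.

  If \<open>d \<le> n - 2\<close>, there is a center \<open>b\<close> with \<open>(x - b) \<cdot> \<nabla>\<phi>(x) \<ge> d \<phi>(x)\<close>: by assumption when \<open>d \<ge> 4\<close>, and a
  maximum point of \<open>\<phi>\<close> when \<open>d = 2\<close>. The Pohozaev identity
  \<open>\<alpha> (\<alpha> - 2) = (2 c / n) lim \<integral>\<eta>\<^sub>k (x - b) \<cdot> \<nabla>\<phi> e\<^bsup>nu\<^esup>\<close> then gives \<open>\<alpha> (\<alpha> - 2) \<ge> - (2 d / n) F\<close>, which together with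
  \<open>\<alpha> \<ge> 1 + d / n > 2 d / n\<close> yields the claim. No decay of \<open>u\<close> is needed for the identity: for the
  logarithmic cutoffs \<open>\<eta>\<^sub>k\<close> the fields \<open>\<eta>\<^sub>k x\<close> are Lipschitz uniformly in \<open>k\<close>, so that after symmetrization the
  double integral has a bounded kernel converging to 1, and \<open>x \<cdot> \<nabla>\<eta>\<^sub>k\<close> tends to 0 uniformly.
\<close>

section \<open>The kernel 1/|x|\<close>

declare borel_open[OF open_ball, measurable]

section \<open>Affine changes of variables for Lebesgue integrals\<close>

lemma lborel_scale_nn_integral:
  fixes h :: "'a::euclidean_space \<Rightarrow> ennreal"
  assumes [measurable]: "h \<in> borel_measurable borel" and t: "t \<noteq> 0"
  shows "(\<integral>\<^sup>+x. h x \<partial>lborel) = ennreal (\<bar>t\<bar> ^ DIM('a)) * (\<integral>\<^sup>+x. h (a + t *\<^sub>R x) \<partial>lborel)"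
  by (subst lborel_affine[OF t, of a])
     (simp add: nn_integral_density nn_integral_distr nn_integral_cmult)

lemma lborel_scale_integrable:
  fixes h :: "'a::euclidean_space \<Rightarrow> real"
  assumes h: "integrable lborel h" and t: "t \<noteq> 0"
  shows "integrable lborel (\<lambda>x. h (a + t *\<^sub>R x))"
proof -
  have [measurable]: "h \<in> borel_measurable borel" using h by simp
  have "(\<integral>\<^sup>+x. norm (h x) \<partial>lborel) < \<infinity>" using h by (simp add: integrable_iff_bounded)
  then have "ennreal (\<bar>t\<bar> ^ DIM('a)) * (\<integral>\<^sup>+x. norm (h (a + t *\<^sub>R x)) \<partial>lborel) < \<infinity>"
    using lborel_scale_nn_integral[of "\<lambda>x. ennreal (norm (h x))" t a] t by simp
  then have "(\<integral>\<^sup>+x. norm (h (a + t *\<^sub>R x)) \<partial>lborel) < \<infinity>"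
    using t by (auto simp: ennreal_mult_less_top)
  then show ?thesis by (simp add: integrable_iff_bounded)
qed

lemma lborel_scale_integral:
  fixes h :: "'a::euclidean_space \<Rightarrow> real"
  assumes [measurable]: "h \<in> borel_measurable borel" and t: "t \<noteq> 0"
  shows "(LINT x|lborel. h x) = \<bar>t\<bar> ^ DIM('a) * (LINT x|lborel. h (a + t *\<^sub>R x))"
  by (subst lborel_affine[OF t, of a])
     (simp add: integral_density integral_distr)

lemma lborel_reflect_integrable_iff:
  fixes h :: "'a::euclidean_space \<Rightarrow> real"
  shows "integrable lborel (\<lambda>y. h (x - y)) \<longleftrightarrow> integrable lborel h"
  using lborel_scale_integrable[of h "-1" x] lborel_scale_integrable[of "\<lambda>y. h (x - y)" "-1" x] by auto

lemma lborel_reflect_integral: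
  fixes h :: "'a::euclidean_space \<Rightarrow> real"
  assumes [measurable]: "h \<in> borel_measurable borel"
  shows "(LINT y|lborel. h (x - y)) = (LINT y|lborel. h y)"
  using lborel_scale_integral[of h "-1" x] by simp

lemma AE_lborel_neq: "AE y in lborel. y \<noteq> (a::'a::euclidean_space)"
  using AE_lborel_singleton by auto

text \<open>If \<open>(1/2)^(k+1) \<le> r < (1/2)^k\<close>, the single term of index
  \<open>k\<close> is already at least \<open>1 / r\<close>. For \<open>r = norm x\<close> the
  series consists of indicators of balls, so integrating it needs ball volumes only and no polar
  coordinates.\<close>

lemma inverse_le_dyadic_sum:
  fixes r :: real
  assumes "0 < r" "r < 1"
  shows "ennreal (1 / r) \<le> suminf (\<lambda>k. ennreal (2 ^ Suc k * indicator {..<(1/2) ^ k} r))"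
proof -
  obtain k where k: "(1/2) ^ k < r" using real_arch_pow_inv[of r "1/2"] assms by auto
  \<comment> \<open>From here on \<open>k\<close> is the least exponent with
    \<open>(1/2)^k \<le> r\<close>; it is positive because \<open>r < 1\<close>, and minimality
    gives \<open>r < (1/2)^j\<close> for its predecessor \<open>j\<close>.\<close>
  define k where "k = (LEAST k. (1/2) ^ k \<le> r)"
  have k1: "(1/2) ^ k \<le> r" unfolding k_def by (rule LeastI_ex) (use k in \<open>auto intro: less_imp_le\<close>)
  have "k \<noteq> 0" using k1 assms by (intro notI) auto
  then obtain j where j: "k = Suc j" by (cases k) auto
  have "\<not> (1/2) ^ j \<le> r" using not_less_Least[of j "\<lambda>k. (1/2) ^ k \<le> r"] j unfolding k_def by auto
  then have k2: "r < (1/2) ^ j" by simp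
  have "1 / r \<le> 2 ^ Suc j" using k1 assms unfolding j by (simp add: field_simps power_one_over)
  then have "ennreal (1 / r) \<le> ennreal (2 ^ Suc j * indicator {..<(1/2) ^ j} r)"
    using k2 by (intro ennreal_leI) simp
  also have "\<dots> \<le> suminf (\<lambda>k. ennreal (2 ^ Suc k * indicator {..<(1/2) ^ k} r))"
  proof -
    have "g j \<le> suminf g" for g :: "nat \<Rightarrow> ennreal"
      using sum_le_suminf[of g "{j}"] by simp
    then show ?thesis .
  qed
  finally show ?thesis .
qed

text \<open>The ball of radius \<open>(1/2)^k\<close> contributes
  \<open>2^(k+1) V (1/2)^(k n)\<close> in dimension \<open>n\<close>, with \<open>V\<close> the
  volume of the unit ball; for \<open>n \<ge> 2\<close> this is dominated by a geometric
  series.\<close>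

lemma integrable_inverse_norm_unit_ball:
  assumes dim: "DIM('a::euclidean_space) \<ge> 2"
  shows "integrable lborel (\<lambda>x::'a. indicator (ball 0 1) x / norm x)"
proof (rule integrableI_bounded)
  let ?V = "unit_ball_vol (real DIM('a))"
  have "(\<integral>\<^sup>+x. ennreal (norm (indicator (ball 0 1) x / norm (x::'a))) \<partial>lborel)
      \<le> (\<integral>\<^sup>+x. suminf (\<lambda>k. ennreal (2 ^ Suc k * indicator {..<(1/2) ^ k} (norm (x::'a)))) \<partial>lborel)"
  proof (rule nn_integral_mono_AE)
    show "AE x in lborel. ennreal (norm (indicator (ball 0 1) x / norm (x::'a)))
      \<le> suminf (\<lambda>k. ennreal (2 ^ Suc k * indicator {..<(1/2) ^ k} (norm (x::'a))))"
      using AE_lborel_neq[of 0]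
    proof eventually_elim
      case (elim x)
      show ?case
      proof (cases "norm x < 1")
        case True
        then have "norm (indicator (ball 0 1) x / norm x) = 1 / norm x" by simp
        then show ?thesis using inverse_le_dyadic_sum[of "norm x"] elim True
          by (simp only: zero_less_norm_iff not_False_eq_True)
      qed simp
    qed
  qed
  also have "\<dots> = suminf (\<lambda>k. \<integral>\<^sup>+x. ennreal (2 ^ Suc k * indicator {..<(1/2) ^ k} (norm (x::'a))) \<partial>lborel)"
    by (rule nn_integral_suminf) simp
  also have "\<dots> \<le> suminf (\<lambda>k. ennreal (2 * ?V * (1/2) ^ k))"
  proof (rule suminf_le)
    fix k
    have "(\<integral>\<^sup>+x. ennreal (2 ^ Suc k * indicator {..<(1/2) ^ k} (norm (x::'a))) \<partial>lborel)
      = (\<integral>\<^sup>+x. ennreal (2 ^ Suc k) * indicator (ball 0 ((1/2) ^ k)) (x::'a) \<partial>lborel)"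
      by (intro nn_integral_cong) (auto simp: indicator_def ennreal_power)
    also have "\<dots> = ennreal (2 ^ Suc k) * emeasure lborel (ball 0 ((1/2) ^ k) :: 'a set)"
      by (rule nn_integral_cmult_indicator) simp
    also have "\<dots> = ennreal (2 ^ Suc k * (?V * ((1/2) ^ k) ^ DIM('a)))"
      by (simp add: emeasure_ball ennreal_mult)
    also have "\<dots> \<le> ennreal (2 * ?V * (1/2) ^ k)"
    proof (rule ennreal_leI)
      have "((1/2) ^ k) ^ DIM('a) \<le> ((1/2::real) ^ k) ^ 2"
        using dim by (intro power_decreasing) (auto simp: power_le_one)
      then have "2 ^ Suc k * (?V * ((1/2) ^ k) ^ DIM('a)) \<le> 2 ^ Suc k * (?V * ((1/2) ^ k) ^ 2)"
        by (intro mult_left_mono) auto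
      also have "\<dots> = 2 * ?V * (1/2) ^ k"
        by (simp add: power2_eq_square power_one_over field_simps)
      finally show "2 ^ Suc k * (?V * ((1/2) ^ k) ^ DIM('a)) \<le> 2 * ?V * (1/2) ^ k" .
    qed
    finally show "(\<integral>\<^sup>+x. ennreal (2 ^ Suc k * indicator {..<(1/2) ^ k} (norm (x::'a))) \<partial>lborel)
      \<le> ennreal (2 * ?V * (1/2) ^ k)" .
  qed auto
  also have "\<dots> < \<infinity>"
    by (subst suminf_ennreal2) (auto intro!: summable_mult)
  finally show "(\<integral>\<^sup>+x. ennreal (norm (indicator (ball 0 1) x / norm (x::'a))) \<partial>lborel) < \<infinity>" .
qed (intro borel_measurable_divide borel_measurable_indicator; simp)

definition inv_mass :: "'a::euclidean_space itself \<Rightarrow> real" where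
  "inv_mass _ = (LINT x::'a|lborel. indicator (ball 0 1) x / norm x)"

text \<open>The integral is split at distance 1 from \<open>x\<close>: inside, \<open>f\<close> is
  bounded by \<open>M\<close> and the kernel has mass \<open>inv_mass\<close>; outside, the kernel
  is at most 1 and \<open>f\<close> is integrable.\<close>

lemma inverse_dist_integrable:
  fixes f :: "'a::euclidean_space \<Rightarrow> real" and x :: 'a
  assumes dim: "DIM('a) \<ge> 2" and f: "integrable lborel f"
    and M: "\<And>y. norm (x - y) < 1 \<Longrightarrow> \<bar>f y\<bar> \<le> M"
  shows "integrable lborel (\<lambda>y. f y / norm (x - y))"
    and "(LINT y|lborel. \<bar>f y\<bar> / norm (x - y)) \<le> M * inv_mass TYPE('a) + (LINT y|lborel. \<bar>f y\<bar>)"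
proof -
  have [measurable]: "f \<in> borel_measurable borel" using f by simp
  let ?k = "\<lambda>y::'a. indicator (ball 0 1) y / norm y"
  have k: "integrable lborel (\<lambda>y. ?k (x - y))"
    by (subst lborel_reflect_integrable_iff) (rule integrable_inverse_norm_unit_ball[OF dim])
  have b: "integrable lborel (\<lambda>y. M * ?k (x - y) + \<bar>f y\<bar>)"
    using k f by (intro Bochner_Integration.integrable_add integrable_mult_right) auto
  have M0: "M \<ge> 0" using M[of x] by auto
  have le: "\<bar>f y\<bar> / norm (x - y) \<le> M * ?k (x - y) + \<bar>f y\<bar>" for y
  proof (cases "norm (x - y) < 1")
    case True
    then have "\<bar>f y\<bar> / norm (x - y) \<le> M / norm (x - y)" using M by (intro divide_right_mono) auto
    then show ?thesis using True by (simp add: field_simps)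
  next
    case False
    then have "\<bar>f y\<bar> * 1 \<le> \<bar>f y\<bar> * norm (x - y)" by (intro mult_left_mono) auto
    then have "\<bar>f y\<bar> / norm (x - y) \<le> \<bar>f y\<bar>" using False by (subst pos_divide_le_eq) auto
    then show ?thesis using False by simp
  qed
  show i: "integrable lborel (\<lambda>y. f y / norm (x - y))"
    by (rule Bochner_Integration.integrable_bound[OF b]) (use le M0 in \<open>auto intro!: AE_I2 order_trans[OF _ abs_ge_self]\<close>)
  have "(LINT y|lborel. \<bar>f y\<bar> / norm (x - y)) \<le> (LINT y|lborel. M * ?k (x - y) + \<bar>f y\<bar>)"
    using i[THEN integrable_abs] b le by (intro integral_mono) (auto simp: abs_divide)
  also have "\<dots> = M * (LINT y|lborel. ?k (x - y)) + (LINT y|lborel. \<bar>f y\<bar>)"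
    by (subst Bochner_Integration.integral_add[OF integrable_mult_right[OF k] integrable_abs[OF f]])
      (simp only: integral_mult_right_zero)
  also have "(LINT y|lborel. ?k (x - y)) = inv_mass TYPE('a)"
    unfolding inv_mass_def
    using integrable_inverse_norm_unit_ball[OF dim, THEN borel_measurable_integrable]
    by (intro lborel_reflect_integral) simp
  finally show "(LINT y|lborel. \<bar>f y\<bar> / norm (x - y)) \<le> M * inv_mass TYPE('a) + (LINT y|lborel. \<bar>f y\<bar>)" .
qed

lemma continuous_bounded_on_cball:
  fixes f :: "'a::euclidean_space \<Rightarrow> real"
  assumes "continuous_on UNIV f"
  obtains M where "M \<ge> 0" "\<And>y. norm y \<le> R \<Longrightarrow> \<bar>f y\<bar> \<le> M"
proof -
  have "compact (f ` cball 0 R)"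
    using assms by (intro compact_continuous_image continuous_on_subset[OF assms]) auto
  then have "bounded (f ` cball 0 R)" by (rule compact_imp_bounded)
  then obtain M where "\<forall>x\<in>cball 0 R. norm (f x) \<le> M" unfolding bounded_iff by auto
  then have "\<bar>f y\<bar> \<le> \<bar>M\<bar>" if "norm y \<le> R" for y using that by force
  then show ?thesis by (intro that[of "\<bar>M\<bar>"]) auto
qed

text \<open>For \<open>norm x \<le> R\<close> the unit balls around \<open>x\<close> stay in the
  ball of radius \<open>R + 1\<close>, where the continuous \<open>f\<close> is bounded by one
  constant. The applications of Fubini's theorem below rest on this locally uniform bound.\<close>

lemma inverse_dist_bounded:
  fixes f :: "'a::euclidean_space \<Rightarrow> real"
  assumes dim: "DIM('a) \<ge> 2" and f: "integrable lborel f" and c: "continuous_on UNIV f"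
  shows "integrable lborel (\<lambda>y. f y / norm (x - y))"
    and "\<exists>M. \<forall>x. norm x \<le> R \<longrightarrow> (LINT y|lborel. \<bar>f y\<bar> / norm (x - y)) \<le> M"
proof -
  obtain M where M: "\<And>y. norm y \<le> norm x + 1 \<Longrightarrow> \<bar>f y\<bar> \<le> M"
    using continuous_bounded_on_cball[OF c] by blast
  have "norm y \<le> norm x + 1" if "norm (x - y) < 1" for y
    using norm_triangle_sub[of y x] that by (simp add: norm_minus_commute)
  then show "integrable lborel (\<lambda>y. f y / norm (x - y))"
    using inverse_dist_integrable(1)[OF dim f, of x M] M by blast
next
  obtain M where M: "\<And>y. norm y \<le> R + 1 \<Longrightarrow> \<bar>f y\<bar> \<le> M"
    using continuous_bounded_on_cball[OF c] by blast
  have "norm y \<le> R + 1" if "norm (x - y) < 1" "norm x \<le> R" for x y :: 'a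
    using norm_triangle_sub[of y x] that by (simp add: norm_minus_commute)
  then have "(LINT y|lborel. \<bar>f y\<bar> / norm (x - y)) \<le> M * inv_mass TYPE('a) + (LINT y|lborel. \<bar>f y\<bar>)"
    if "norm x \<le> R" for x
    using that M by (intro inverse_dist_integrable(2)[OF dim f]) blast
  then show "\<exists>M. \<forall>x. norm x \<le> R \<longrightarrow> (LINT y|lborel. \<bar>f y\<bar> / norm (x - y)) \<le> M" by blast
qed

text \<open>The inequality \<open>ln s \<le> s - 1\<close> is applied to the ratio and to its
  reciprocal, and the difference of the norms is at most \<open>norm x\<close>. At
  \<open>y = 0\<close> and \<open>y = x\<close> the left side is 0 by the conventions for
  \<open>ln 0\<close> and division by 0.\<close>

lemma abs_ln_ratio_le:
  fixes x y :: "'a::real_normed_vector"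
  shows "\<bar>ln (norm y / norm (x - y))\<bar> \<le> norm x * (1 / norm y + 1 / norm (x - y))"
proof (cases "y = 0 \<or> x = y")
  case False
  then have p: "norm y > 0" "norm (x - y) > 0" by auto
  have a: "ln (norm y / norm (x - y)) \<le> norm x / norm (x - y)"
  proof -
    have "ln (norm y / norm (x - y)) \<le> norm y / norm (x - y) - 1"
      using p by (intro ln_le_minus_one) auto
    also have "\<dots> = (norm y - norm (x - y)) / norm (x - y)" using p by (simp add: field_simps)
    also have "\<dots> \<le> norm x / norm (x - y)"
      using p norm_triangle_ineq4[of x "x - y"] by (intro divide_right_mono) auto
    finally show ?thesis .
  qed
  have b: "- ln (norm y / norm (x - y)) \<le> norm x / norm y"
  proof -
    have "- ln (norm y / norm (x - y)) = ln (norm (x - y) / norm y)" using p by (simp add: ln_div)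
    also have "\<dots> \<le> norm (x - y) / norm y - 1"
      using p by (intro ln_le_minus_one) auto
    also have "\<dots> = (norm (x - y) - norm y) / norm y" using p by (simp add: field_simps)
    also have "\<dots> \<le> norm x / norm y"
      using p norm_triangle_ineq4[of x y] by (intro divide_right_mono) auto
    finally show ?thesis .
  qed
  have "norm x / norm (x - y) \<ge> 0" "norm x / norm y \<ge> 0" by auto
  moreover have "norm x * (1 / norm y + 1 / norm (x - y)) = norm x / norm y + norm x / norm (x - y)"
    by (simp add: ring_distribs)
  ultimately show ?thesis using a b by linarith
qed auto

lemma log_potential_integrable:
  fixes f :: "'a::euclidean_space \<Rightarrow> real"
  assumes dim: "DIM('a) \<ge> 2" and f: "integrable lborel f" and c: "continuous_on UNIV f"
  shows "integrable lborel (\<lambda>y. ln (norm y / norm (x - y)) * f y)"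
proof -
  have [measurable]: "f \<in> borel_measurable borel" using f by simp
  have i: "integrable lborel (\<lambda>y. norm x * (\<bar>f y / norm (0 - y)\<bar> + \<bar>f y / norm (x - y)\<bar>))"
    using inverse_dist_bounded(1)[OF dim f c, of 0] inverse_dist_bounded(1)[OF dim f c, of x]
    by (intro integrable_mult_right Bochner_Integration.integrable_add integrable_abs)
  show ?thesis
  proof (rule Bochner_Integration.integrable_bound[OF i], measurable, intro AE_I2)
    fix y
    have "\<bar>ln (norm y / norm (x - y))\<bar> * \<bar>f y\<bar> \<le> norm x * (1 / norm y + 1 / norm (x - y)) * \<bar>f y\<bar>"
      by (intro mult_right_mono abs_ln_ratio_le) auto
    then show "norm (ln (norm y / norm (x - y)) * f y) \<le> norm (norm x * (\<bar>f y / norm (0 - y)\<bar> + \<bar>f y / norm (x - y)\<bar>))"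
      by (simp add: abs_mult algebra_simps add_divide_distrib)
  qed
qed

section \<open>The gradient of the logarithmic potential\<close>

text \<open>Here \<open>f\<close> is any continuous integrable density with logarithmic potential
  \<open>u\<close>; the relation \<open>f = Q e^{nu}\<close> enters only in
  \<open>pohozaev_identity\<close>.\<close>

locale log_potential =
  fixes f u :: "'a::euclidean_space \<Rightarrow> real" and c C :: real
  assumes dim: "DIM('a) \<ge> 2"
    and f_int: "integrable lborel f"
    and f_cont: "continuous_on UNIV f"
    and u_eq: "\<And>x. u x = c * (LINT y|lborel. ln (norm y / norm (x - y)) * f y) + C"
begin

lemma f_measurable [measurable]: "f \<in> borel_measurable borel"
  using f_int by simp

lemma inverse_dist_int: "integrable lborel (\<lambda>y. \<bar>f y\<bar> / norm (x - y))"
  using inverse_dist_bounded(1)[OF dim f_int f_cont, of x, THEN integrable_abs] by simp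

lemma inverse_dist_bound: obtains M where "\<And>x. norm x \<le> R \<Longrightarrow> (LINT y|lborel. \<bar>f y\<bar> / norm (x - y)) \<le> M"
  using inverse_dist_bounded(2)[OF dim f_int f_cont, of R] by blast

text \<open>The derivative of \<open>ln (norm z)\<close> in the direction \<open>e\<close>, with the
  value 0 at \<open>z = 0\<close>.\<close>

definition grad_kernel :: "'a \<Rightarrow> 'a \<Rightarrow> real" where
  "grad_kernel e z = (z \<bullet> e) / (norm z)\<^sup>2"

lemma grad_kernel_measurable [measurable]: "grad_kernel e \<in> borel_measurable borel"
  unfolding grad_kernel_def by measurable

lemma abs_grad_kernel_le: "\<bar>grad_kernel e z\<bar> \<le> norm e / norm z"
proof (cases "z = 0")
  case False
  have "\<bar>z \<bullet> e\<bar> / (norm z)\<^sup>2 \<le> (norm z * norm e) / (norm z)\<^sup>2"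
    by (intro divide_right_mono Cauchy_Schwarz_ineq2) auto
  then show ?thesis using False by (simp add: grad_kernel_def power2_eq_square)
qed (simp add: grad_kernel_def)

lemma grad_kernel_int: "integrable lborel (\<lambda>y. grad_kernel e (x - y) * f y)"
proof (rule Bochner_Integration.integrable_bound[OF integrable_mult_right[OF inverse_dist_int[of x], of "norm e"]])
  show "AE y in lborel. norm (grad_kernel e (x - y) * f y) \<le> norm (norm e * (\<bar>f y\<bar> / norm (x - y)))"
  proof (rule AE_I2)
    fix y
    have "\<bar>grad_kernel e (x - y)\<bar> * \<bar>f y\<bar> \<le> (norm e / norm (x - y)) * \<bar>f y\<bar>"
      by (intro mult_right_mono abs_grad_kernel_le) auto
    then show "norm (grad_kernel e (x - y) * f y) \<le> norm (norm e * (\<bar>f y\<bar> / norm (x - y)))"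
      by (simp add: abs_mult)
  qed
qed measurable

definition grad_potential :: "'a \<Rightarrow> 'a \<Rightarrow> real" where
  "grad_potential e x = (LINT y|lborel. grad_kernel e (x - y) * f y)"

lemma grad_potential_measurable [measurable]: "grad_potential e \<in> borel_measurable borel"
  unfolding grad_potential_def by measurable

text \<open>The kernel is split into a bounded continuous part and a part supported in the unit ball. In the
  second one the convolution is shifted onto the continuous function \<open>f\<close>.\<close>

lemma grad_potential_continuous: "continuous_on UNIV (grad_potential e)"
  unfolding continuous_on_sequentially comp_def
proof (intro allI impI ballI, elim conjE)
  fix X :: "nat \<Rightarrow> 'a" and x assume X: "X \<longlonglongrightarrow> x"
  \<comment> \<open>The denominator is kept at least 1, so that \<open>k2\<close> is continuous, is
    bounded by \<open>norm e\<close>, and agrees with the kernel outside the unit ball;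
    \<open>k1\<close> carries the singularity.\<close>
  define k2 where "k2 z = (z \<bullet> e) / max 1 ((norm z)\<^sup>2)" for z :: 'a
  define k1 where "k1 z = grad_kernel e z - k2 z" for z :: 'a
  have [measurable]: "k2 \<in> borel_measurable borel" "k1 \<in> borel_measurable borel"
    unfolding k1_def k2_def by measurable
  have k2c: "continuous_on UNIV k2" unfolding k2_def by (intro continuous_intros) auto
  have k2b: "\<bar>k2 z\<bar> \<le> norm e" for z
  proof -
    have "norm z \<le> max 1 ((norm z)\<^sup>2)"
      using power_increasing[of 1 2 "norm z"] by (cases "norm z \<le> 1") auto
    then have "norm z * norm e \<le> max 1 ((norm z)\<^sup>2) * norm e" by (intro mult_right_mono) auto
    then have "\<bar>z \<bullet> e\<bar> \<le> max 1 ((norm z)\<^sup>2) * norm e" using Cauchy_Schwarz_ineq2[of z e] by linarith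
    then show ?thesis unfolding k2_def by (simp add: abs_divide pos_divide_le_eq mult.commute)
  qed
  have k1b: "\<bar>k1 z\<bar> \<le> norm e * (indicator (ball 0 1) z / norm z)" for z
  proof (cases "norm z < 1")
    case True
    then have "(norm z)\<^sup>2 \<le> 1" by (simp add: power_le_one)
    then have "k1 z = (1 - (norm z)\<^sup>2) * grad_kernel e z"
      unfolding k1_def k2_def grad_kernel_def by (cases "z = 0") (auto simp: max_def field_simps)
    then have "\<bar>k1 z\<bar> \<le> 1 * \<bar>grad_kernel e z\<bar>"
      using \<open>(norm z)\<^sup>2 \<le> 1\<close> by (simp only: abs_mult) (intro mult_right_mono, auto)
    then show ?thesis using abs_grad_kernel_le[of e z] True by simp
  next
    case False
    then have "(norm z)\<^sup>2 \<ge> 1" by simp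
    then have "k1 z = 0" unfolding k1_def k2_def grad_kernel_def by (simp add: max_def)
    then show ?thesis by simp
  qed
  have k2i: "integrable lborel (\<lambda>y. k2 (x - y) * f y)" for x
  proof (rule Bochner_Integration.integrable_bound[OF integrable_mult_right[OF f_int, of "norm e"]])
    show "AE y in lborel. norm (k2 (x - y) * f y) \<le> norm (norm e * f y)"
      by (intro AE_I2) (auto simp: abs_mult intro!: mult_right_mono k2b)
  qed measurable
  have k1i: "integrable lborel (\<lambda>y. k1 (x - y) * f y)" for x
    using Bochner_Integration.integrable_diff[OF grad_kernel_int[of e x] k2i[of x]]
    by (simp add: k1_def algebra_simps)
  have split: "grad_potential e x = (LINT z|lborel. k1 z * f (x - z)) + (LINT y|lborel. k2 (x - y) * f y)" for x
  proof -
    have "grad_potential e x = (LINT y|lborel. k1 (x - y) * f y + k2 (x - y) * f y)"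
      unfolding grad_potential_def by (simp add: k1_def algebra_simps)
    also have "\<dots> = (LINT y|lborel. k1 (x - y) * f y) + (LINT y|lborel. k2 (x - y) * f y)"
      by (rule Bochner_Integration.integral_add[OF k1i k2i])
    also have "(LINT y|lborel. k1 (x - y) * f y) = (LINT z|lborel. k1 z * f (x - z))"
      using lborel_reflect_integral[of "\<lambda>z. k1 z * f (x - z)" x] by simp
    finally show ?thesis .
  qed
  have "Bseq X" using X convergent_imp_Bseq convergentI by blast
  then obtain R where R: "\<And>n. norm (X n) \<le> R" unfolding Bseq_def by auto
  obtain M where M: "\<And>y. norm y \<le> R + 1 \<Longrightarrow> \<bar>f y\<bar> \<le> M"
    using continuous_bounded_on_cball[OF f_cont] by blast
  have fX: "(\<lambda>n. f (X n - z)) \<longlonglongrightarrow> f (x - z)" for z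
    using f_cont X by (intro continuous_on_tendsto_compose[OF f_cont]) (auto intro!: tendsto_intros)
  have kX: "(\<lambda>n. k2 (X n - y)) \<longlonglongrightarrow> k2 (x - y)" for y
    using X by (intro continuous_on_tendsto_compose[OF k2c]) (auto intro!: tendsto_intros)
  have l1: "(\<lambda>n. LINT z|lborel. k1 z * f (X n - z)) \<longlonglongrightarrow> (LINT z|lborel. k1 z * f (x - z))"
  proof (rule integral_dominated_convergence)
    show "integrable lborel (\<lambda>z::'a. M * norm e * (indicator (ball 0 1) z / norm z))"
      by (intro integrable_mult_right integrable_inverse_norm_unit_ball dim)
    show "AE z in lborel. (\<lambda>n. k1 z * f (X n - z)) \<longlonglongrightarrow> k1 z * f (x - z)"
      by (intro AE_I2 tendsto_intros fX)
    show "AE z in lborel. norm (k1 z * f (X n - z)) \<le> M * norm e * (indicator (ball 0 1) z / norm z)" for n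
    proof (rule AE_I2)
      fix z :: 'a
      show "norm (k1 z * f (X n - z)) \<le> M * norm e * (indicator (ball 0 1) z / norm z)"
      proof (cases "norm z < 1")
        case True
        then have "norm (X n - z) \<le> R + 1" using norm_triangle_ineq4[of "X n" z] R[of n] by simp
        then have "\<bar>k1 z\<bar> * \<bar>f (X n - z)\<bar> \<le> (norm e * (indicator (ball 0 1) z / norm z)) * M"
          using k1b[of z] M by (intro mult_mono) auto
        then show ?thesis by (simp add: abs_mult algebra_simps)
      next
        case False
        then show ?thesis using k1b[of z] by simp
      qed
    qed
  qed measurable
  have l2: "(\<lambda>n. LINT y|lborel. k2 (X n - y) * f y) \<longlonglongrightarrow> (LINT y|lborel. k2 (x - y) * f y)"
  proof (rule integral_dominated_convergence)
    show "integrable lborel (\<lambda>y. norm e * \<bar>f y\<bar>)"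
      using f_int by (intro integrable_mult_right integrable_abs)
    show "AE y in lborel. (\<lambda>n. k2 (X n - y) * f y) \<longlonglongrightarrow> k2 (x - y) * f y"
      by (intro AE_I2 tendsto_intros kX)
    show "AE y in lborel. norm (k2 (X n - y) * f y) \<le> norm e * \<bar>f y\<bar>" for n
      by (intro AE_I2) (auto simp: abs_mult intro!: mult_right_mono k2b)
  qed measurable
  show "(\<lambda>n. grad_potential e (X n)) \<longlonglongrightarrow> grad_potential e x"
    unfolding split by (intro tendsto_add l1 l2)
qed

text \<open>Since the dimension is at least 2, some \<open>a \<noteq> 0\<close> is orthogonal to
  \<open>e\<close>; the line lies in a hyperplane normal to \<open>a\<close>, which is a null
  set.\<close>

lemma AE_not_on_line:
  assumes "e \<noteq> 0"
  shows "AE y in lborel. \<forall>s. x + s *\<^sub>R e - y \<noteq> (0::'a)"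
proof -
  have "dim {e} < DIM('a)" using dim_le_card'[of "{e}"] dim by simp
  then obtain a :: 'a where a: "a \<noteq> 0" "\<And>y. y \<in> span {e} \<Longrightarrow> orthogonal a y"
    using orthogonal_to_subspace_exists by blast
  have ae: "a \<bullet> e = 0" using a(2)[of e] by (auto simp: orthogonal_def span_base)
  have "{y. a \<bullet> y = a \<bullet> x} \<in> null_sets (completion lborel)"
    using negligible_hyperplane[of a "a \<bullet> x"] a(1) by (simp add: negligible_iff_null_sets)
  moreover have "{y. a \<bullet> y = a \<bullet> x} \<in> sets lborel"
    using closed_hyperplane[of a "a \<bullet> x"] by simp
  ultimately have "{y. a \<bullet> y = a \<bullet> x} \<in> null_sets lborel"
    using null_sets_completion_iff by blast
  then show ?thesis
  proof (rule AE_I')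
    show "{y \<in> space lborel. \<not> (\<forall>s. x + s *\<^sub>R e - y \<noteq> 0)} \<subseteq> {y. a \<bullet> y = a \<bullet> x}"
    proof
      fix y assume "y \<in> {y \<in> space lborel. \<not> (\<forall>s. x + s *\<^sub>R e - y \<noteq> 0)}"
      then obtain s where "x + s *\<^sub>R e - y = 0" by auto
      then have "y = x + s *\<^sub>R e" by simp
      then show "y \<in> {y. a \<bullet> y = a \<bullet> x}" using ae by (auto simp: inner_add_right)
    qed
  qed
qed

lemma ln_norm_line:
  assumes nz: "\<And>s. x + s *\<^sub>R e - y \<noteq> (0::'a)" and t: "t \<ge> 0"
  shows "(LINT s|lborel. grad_kernel e (x + s *\<^sub>R e - y) * indicator {0..t} s)
    = ln (norm (x + t *\<^sub>R e - y)) - ln (norm (x - y))"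
proof -
  have d: "((\<lambda>s. ln (norm (x + s *\<^sub>R e - y))) has_real_derivative grad_kernel e (x + s *\<^sub>R e - y)) (at s)" for s
  proof -
    have p: "(x + s *\<^sub>R e - y) \<bullet> (x + s *\<^sub>R e - y) > 0" using nz[of s] by simp
    \<comment> \<open>Half the logarithm of the inner product is the logarithm of the norm, and it
      can be differentiated without differentiating the norm.\<close>
    have "((\<lambda>s. ln ((x + s *\<^sub>R e - y) \<bullet> (x + s *\<^sub>R e - y)) / 2) has_real_derivative grad_kernel e (x + s *\<^sub>R e - y)) (at s)"
      unfolding has_field_derivative_def grad_kernel_def
      by (rule derivative_eq_intros refl p | simp)+
         (use p in \<open>auto simp: fun_eq_iff inner_commute dot_square_norm field_simps\<close>)
    moreover have "ln ((x + s *\<^sub>R e - y) \<bullet> (x + s *\<^sub>R e - y)) / 2 = ln (norm (x + s *\<^sub>R e - y))" for s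
      using nz[of s] by (simp add: dot_square_norm ln_realpow)
    ultimately show ?thesis by simp
  qed
  have c: "isCont (\<lambda>s. grad_kernel e (x + s *\<^sub>R e - y)) s" for s
    unfolding grad_kernel_def using nz[of s] by (intro continuous_intros) auto
  show ?thesis using integral_FTC_Icc_real[OF t d c] by simp
qed

text \<open>Differentiation under the integral sign is avoided: integrating the gradient kernel
  along the segment gives the difference of two logarithms, and Fubini's theorem moves the line
  integral outside.\<close>

lemma potential_difference:
  assumes e: "e \<noteq> 0" and t: "t \<ge> 0"
  shows "u (x + t *\<^sub>R e) = u x - c * integral {0..t} (\<lambda>s. grad_potential e (x + s *\<^sub>R e))"
proof -
  let ?I = "indicator {0..t} :: real \<Rightarrow> real"
  let ?F = "\<lambda>(s, y). grad_kernel e (x + s *\<^sub>R e - y) * f y * ?I s"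
  have Fm: "?F \<in> borel_measurable (lborel \<Otimes>\<^sub>M lborel)"
    unfolding grad_kernel_def by measurable
  obtain M where M: "\<And>z. norm z \<le> norm x + t * norm e \<Longrightarrow> (LINT y|lborel. \<bar>f y\<bar> / norm (z - y)) \<le> M"
    using inverse_dist_bound by blast
  have Fi: "integrable (lborel \<Otimes>\<^sub>M lborel) ?F"
  proof (rule lborel_pair.Fubini_integrable[OF Fm])
    show "AE s in lborel. integrable lborel (\<lambda>y. ?F (s, y))"
      using grad_kernel_int by (intro AE_I2) auto
    show "integrable lborel (\<lambda>s. LINT y|lborel. norm (?F (s, y)))"
    proof (rule Bochner_Integration.integrable_bound)
      show "integrable lborel (\<lambda>s. norm e * M * ?I s)"
        by (intro integrable_mult_right integrable_real_indicator) (auto simp: emeasure_lborel_Icc_eq)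
      show "(\<lambda>s. LINT y|lborel. norm (?F (s, y))) \<in> borel_measurable lborel"
        using Fm by measurable
      show "AE s in lborel. norm (LINT y|lborel. norm (?F (s, y))) \<le> norm (norm e * M * ?I s)"
      proof (rule AE_I2)
        fix s :: real
        show "norm (LINT y|lborel. norm (?F (s, y))) \<le> norm (norm e * M * ?I s)"
        proof (cases "s \<in> {0..t}")
          case True
          have "norm (x + s *\<^sub>R e) \<le> norm x + t * norm e"
            using True by (intro order_trans[OF norm_triangle_ineq]) (auto intro: mult_right_mono)
          note M = M[OF this]
          have "(LINT y|lborel. \<bar>grad_kernel e (x + s *\<^sub>R e - y) * f y\<bar>)
            \<le> (LINT y|lborel. norm e * (\<bar>f y\<bar> / norm (x + s *\<^sub>R e - y)))"
          proof (rule integral_mono)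
            show "\<bar>grad_kernel e (x + s *\<^sub>R e - y) * f y\<bar> \<le> norm e * (\<bar>f y\<bar> / norm (x + s *\<^sub>R e - y))" for y
              using mult_right_mono[OF abs_grad_kernel_le[of e "x + s *\<^sub>R e - y"], of "\<bar>f y\<bar>"]
              by (simp add: abs_mult)
          qed (use grad_kernel_int inverse_dist_int in \<open>auto intro!: integrable_abs integrable_mult_right simp del: times_divide_eq_right\<close>)
          also have "\<dots> = norm e * (LINT y|lborel. \<bar>f y\<bar> / norm (x + s *\<^sub>R e - y))"
            by (simp only: integral_mult_right_zero)
          also have "\<dots> \<le> norm e * M" using M by (intro mult_left_mono) auto
          finally show ?thesis using True by (simp add: integral_nonneg_AE)
        qed simp
      qed
    qed
  qed
  have "(LINT s|lborel. (LINT y|lborel. ?F (s, y))) = (LINT y|lborel. (LINT s|lborel. ?F (s, y)))"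
    using lborel_pair.Fubini_integral[of "\<lambda>s y. ?F (s, y)"] Fi by simp
  moreover have "(LINT s|lborel. (LINT y|lborel. ?F (s, y))) = integral {0..t} (\<lambda>s. grad_potential e (x + s *\<^sub>R e))"
  proof -
    have cont: "continuous_on {0..t} (\<lambda>s. grad_potential e (x + s *\<^sub>R e))"
      by (intro continuous_on_compose2[OF grad_potential_continuous] continuous_intros) auto
    have "(LINT s|lborel. (LINT y|lborel. ?F (s, y))) = (LINT s:{0..t}|lborel. grad_potential e (x + s *\<^sub>R e))"
      unfolding grad_potential_def set_lebesgue_integral_def by (simp add: mult.commute)
    also have "\<dots> = integral {0..t} (\<lambda>s. grad_potential e (x + s *\<^sub>R e))"
      by (intro set_borel_integral_eq_integral(2) borel_integrable_atLeastAtMost') (rule cont)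
    finally show ?thesis .
  qed
  moreover have "(LINT y|lborel. (LINT s|lborel. ?F (s, y)))
      = (LINT y|lborel. ln (norm y / norm (x - y)) * f y) - (LINT y|lborel. ln (norm y / norm (x + t *\<^sub>R e - y)) * f y)"
  proof -
    have "(LINT y|lborel. (LINT s|lborel. ?F (s, y)))
      = (LINT y|lborel. ln (norm y / norm (x - y)) * f y - ln (norm y / norm (x + t *\<^sub>R e - y)) * f y)"
    proof (rule integral_cong_AE)
      show "(\<lambda>y. LINT s|lborel. ?F (s, y)) \<in> borel_measurable lborel"
        using Fm by measurable
      show "AE y in lborel. (LINT s|lborel. ?F (s, y))
        = ln (norm y / norm (x - y)) * f y - ln (norm y / norm (x + t *\<^sub>R e - y)) * f y"
        \<comment> \<open>Off the line and off the origin all the norms are positive, so the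
          logarithm of each quotient is a difference of logarithms.\<close>
        using AE_not_on_line[OF e, of x] AE_lborel_neq[of 0]
      proof eventually_elim
        case (elim y)
        have "(LINT s|lborel. ?F (s, y)) = (LINT s|lborel. f y * (grad_kernel e (x + s *\<^sub>R e - y) * ?I s))"
          by (simp add: algebra_simps)
        also have "\<dots> = f y * (ln (norm (x + t *\<^sub>R e - y)) - ln (norm (x - y)))"
          using ln_norm_line[OF elim(1)[rule_format] t] by (simp only: integral_mult_right_zero)
        finally show ?case using elim(2) elim(1)[rule_format, of 0] elim(1)[rule_format, of t]
          by (simp add: ln_div algebra_simps)
      qed
    qed measurable
    also have "\<dots> = (LINT y|lborel. ln (norm y / norm (x - y)) * f y) - (LINT y|lborel. ln (norm y / norm (x + t *\<^sub>R e - y)) * f y)"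
      by (intro Bochner_Integration.integral_diff log_potential_integrable dim f_int f_cont)
    finally show ?thesis .
  qed
  ultimately have "integral {0..t} (\<lambda>s. grad_potential e (x + s *\<^sub>R e))
    = (LINT y|lborel. ln (norm y / norm (x - y)) * f y) - (LINT y|lborel. ln (norm y / norm (x + t *\<^sub>R e - y)) * f y)"
    by simp
  then show ?thesis unfolding u_eq by (simp only:) (simp add: algebra_simps)
qed

text \<open>Along a ray, \<open>u\<close> is a constant minus \<open>c\<close> times the integral of
  a continuous function, so its one-sided derivative at the starting point is read off from the
  integrand; uniqueness of that derivative identifies it with \<open>D e\<close>.\<close>

lemma derivative_eq_grad_potential:
  assumes D: "(u has_derivative D) (at x)"
  shows "D e = - c * grad_potential e x"
proof (cases "e = 0")
  case True
  interpret linear D using D by (rule has_derivative_linear)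
  show ?thesis using True zero by (simp add: grad_potential_def grad_kernel_def)
next
  case False
  have line: "((\<lambda>t. x + t *\<^sub>R e) has_derivative (\<lambda>t. t *\<^sub>R e)) (at 0 within {0..1})"
    by (auto intro!: derivative_eq_intros)
  have "((\<lambda>t. u (x + t *\<^sub>R e)) has_derivative (\<lambda>t. D (t *\<^sub>R e))) (at 0 within {0..1})"
    using has_derivative_compose[OF line, of u D] D by simp
  moreover have "D (t *\<^sub>R e) = t *\<^sub>R D e" for t
    using has_derivative_linear[OF D] by (rule linear_scale)
  ultimately have 1: "((\<lambda>t. u (x + t *\<^sub>R e)) has_vector_derivative D e) (at 0 within {0..1})"
    by (simp add: has_vector_derivative_def)
  have cont: "continuous_on {0..1} (\<lambda>s. grad_potential e (x + s *\<^sub>R e))"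
    by (intro continuous_on_compose2[OF grad_potential_continuous] continuous_intros) auto
  have "((\<lambda>t. integral {0..t} (\<lambda>s. grad_potential e (x + s *\<^sub>R e))) has_real_derivative
    grad_potential e (x + 0 *\<^sub>R e)) (at 0 within {0..1})"
    by (rule integral_has_real_derivative[OF cont]) simp
  then have "((\<lambda>t. u x - c * integral {0..t} (\<lambda>s. grad_potential e (x + s *\<^sub>R e))) has_real_derivative
    - c * grad_potential e x) (at 0 within {0..1})"
    by (auto intro!: derivative_eq_intros)
  then have 2: "((\<lambda>t. u (x + t *\<^sub>R e)) has_vector_derivative - c * grad_potential e x) (at 0 within {0..1})"
    unfolding has_real_derivative_iff_has_vector_derivative
    by (rule has_vector_derivative_transform[rotated 2]) (auto simp: potential_difference[OF False])
  show ?thesis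
    using vector_derivative_unique_within_closed_interval[of 0 1 0 "\<lambda>t. u (x + t *\<^sub>R e)"
        "D e" "- c * grad_potential e x"] 1 2 by simp
qed

end

section \<open>The Pohozaev identity\<close>

lemma C1_Lipschitz_on_cball:
  fixes h :: "'a::euclidean_space \<Rightarrow> real"
  assumes D: "\<And>x. (h has_derivative h' x) (at x)" and cont: "\<And>v. continuous_on UNIV (\<lambda>x. h' x v)"
  obtains L where "L \<ge> 0" "\<And>x y. norm x \<le> R \<Longrightarrow> norm y \<le> R \<Longrightarrow> \<bar>h x - h y\<bar> \<le> L * norm (x - y)"
proof -
  have "continuous_on UNIV (\<lambda>x. \<Sum>b\<in>Basis. norm (h' x b))"
    by (intro continuous_intros cont)
  then obtain L where L: "L \<ge> 0" "\<And>x. norm x \<le> R \<Longrightarrow> \<bar>\<Sum>b\<in>Basis. norm (h' x b)\<bar> \<le> L"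
    using continuous_bounded_on_cball by blast
  have "norm (h x - h y) \<le> L * norm (x - y)" if "norm x \<le> R" "norm y \<le> R" for x y
  proof (rule differentiable_bound[where S="cball 0 R" and f'=h'])
    show "(h has_derivative h' z) (at z within cball 0 R)" for z
      using D by (rule has_derivative_at_withinI)
    show "onorm (h' z) \<le> L" if "z \<in> cball 0 R" for z
    proof -
      have "onorm (h' z) \<le> (\<Sum>b\<in>Basis. norm (h' z b))"
        using D[of z] by (intro onorm_componentwise has_derivative_bounded_linear)
      then show ?thesis using L(2)[of z] that by (simp add: mem_cball_0)
    qed
  qed (use that in \<open>auto simp: mem_cball_0\<close>)
  then show ?thesis using L(1) by (intro that) auto
qed

text \<open>The derivative of \<open>t \<mapsto> \<integral> h(t x) dx = t\<^sup>-\<^sup>n \<integral> h\<close> at \<open>t = 1\<close>.\<close>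

lemma dilation_identity:
  fixes h :: "'a::euclidean_space \<Rightarrow> real"
  assumes D: "\<And>x. (h has_derivative h' x) (at x)" and cont: "\<And>v. continuous_on UNIV (\<lambda>x. h' x v)"
    and supp: "\<And>x. norm x > R \<Longrightarrow> h x = 0"
  shows "integrable lborel h" "integrable lborel (\<lambda>x. h' x x)"
    and "(LINT x|lborel. h' x x) = - real DIM('a) * (LINT x|lborel. h x)"
proof -
  have hc: "continuous_on UNIV h"
    using D has_derivative_continuous continuous_at_imp_continuous_on by blast
  then have [measurable]: "h \<in> borel_measurable borel" by (rule borel_measurable_continuous_onI)
  obtain L where L: "L \<ge> 0" "\<And>x y. norm x \<le> 2 * R \<Longrightarrow> norm y \<le> 2 * R \<Longrightarrow> \<bar>h x - h y\<bar> \<le> L * norm (x - y)"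
    using C1_Lipschitz_on_cball[OF D cont] by blast
  obtain M where M: "M \<ge> 0" "\<And>y. norm y \<le> R \<Longrightarrow> \<bar>h y\<bar> \<le> M"
    using continuous_bounded_on_cball[OF hc] by blast
  have ind: "integrable lborel (indicator (cball 0 R) :: 'a \<Rightarrow> real)"
    using emeasure_bounded_finite[OF bounded_cball] by (intro integrable_real_indicator) simp_all
  show hi: "integrable lborel h"
  proof (rule Bochner_Integration.integrable_bound[OF integrable_mult_right[OF ind, of M]])
    show "AE x in lborel. norm (h x) \<le> norm (M * indicator (cball 0 R) x)"
      using M supp by (intro AE_I2) (auto simp: indicator_def mem_cball_0)
  qed measurable
  \<comment> \<open>The factors lie between 1 and 2: being above 1 keeps the quotients
    \<open>q k\<close> supported in the ball of radius \<open>R\<close>, being at most 2 keeps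
    \<open>t k *\<^sub>R x\<close> in the ball where \<open>L\<close> is a Lipschitz
    constant.\<close>
  define t where "t k = 1 + 1 / real (Suc k)" for k
  have t1: "t k > 1" "t k \<le> 2" for k by (auto simp: t_def)
  have tl: "t \<longlonglongrightarrow> 1"
    unfolding t_def using LIMSEQ_inverse_real_of_nat_add[of 1] by (simp add: inverse_eq_divide)
  define q where "q k x = (h (t k *\<^sub>R x) - h x) / (t k - 1)" for k x
  have qb: "\<bar>q k x\<bar> \<le> L * R * indicator (cball 0 R) x" for k x
  proof (cases "norm x \<le> R")
    case True
    have "norm x \<le> 2 * R" "R \<ge> 0" using True norm_ge_zero[of x] by linarith+
    moreover have "norm (t k *\<^sub>R x) \<le> 2 * R"
      using t1[of k] True \<open>R \<ge> 0\<close> by (auto intro!: mult_mono)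
    ultimately have "\<bar>h (t k *\<^sub>R x) - h x\<bar> \<le> L * norm (t k *\<^sub>R x - x)" using L(2) by blast
    also have "t k *\<^sub>R x - x = (t k - 1) *\<^sub>R x" by (simp add: scaleR_left_diff_distrib)
    finally have "\<bar>q k x\<bar> \<le> L * norm x"
      using t1[of k] by (simp add: q_def abs_divide pos_divide_le_eq mult_ac)
    also have "\<dots> \<le> L * R" using True L(1) by (intro mult_left_mono) auto
    finally show ?thesis using True by simp
  next
    case False
    then have "norm x \<le> t k * norm x" using t1[of k] mult_right_mono[of 1 "t k" "norm x"] by simp
    then have "norm (t k *\<^sub>R x) > R" using False t1[of k] by simp
    then show ?thesis using False supp by (simp add: q_def)
  qed
  have ql: "(\<lambda>k. q k x) \<longlonglongrightarrow> h' x x" for x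
  proof -
    have "((\<lambda>s. s *\<^sub>R x) has_derivative (\<lambda>s. s *\<^sub>R x)) (at 1)"
      by (auto intro!: derivative_eq_intros)
    then have "((\<lambda>s. h (s *\<^sub>R x)) has_derivative (\<lambda>s. h' x (s *\<^sub>R x))) (at 1)"
      using has_derivative_compose[of "\<lambda>s. s *\<^sub>R x" _ 1 UNIV h "h' x"] D[of x] by simp
    moreover have "h' x (s *\<^sub>R x) = h' x x * s" for s
      using linear_scale[OF has_derivative_linear[OF D[of x]], of s x] by simp
    ultimately have "((\<lambda>s. h (s *\<^sub>R x)) has_real_derivative h' x x) (at 1)"
      by (simp add: has_field_derivative_def)
    then have "((\<lambda>s. (h (s *\<^sub>R x) - h (1 *\<^sub>R x)) / (s - 1)) \<longlongrightarrow> h' x x) (at 1)"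
      by (simp add: has_field_derivative_iff)
    moreover have "filterlim t (at 1) sequentially"
      using tl t1(1) by (intro filterlim_atI) (auto intro!: always_eventually less_imp_neq[symmetric])
    ultimately show ?thesis unfolding q_def by (auto dest: filterlim_compose)
  qed
  have [measurable]: "q k \<in> borel_measurable borel" for k unfolding q_def by measurable
  have m': "(\<lambda>x. h' x x) \<in> borel_measurable lborel"
    by (rule borel_measurable_LIMSEQ_real[OF ql]) measurable
  have dom: "integrable lborel (\<lambda>x::'a. L * R * indicator (cball 0 R) x)"
    by (intro integrable_mult_right ind)
  have "AE x in lborel. (\<lambda>k. q k x) \<longlonglongrightarrow> h' x x" using ql by simp
  note dct = m' _ dom this
  show "integrable lborel (\<lambda>x. h' x x)"
    by (rule integrable_dominated_convergence[OF dct]) (use qb in auto)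
  have lim1: "(\<lambda>k. LINT x|lborel. q k x) \<longlonglongrightarrow> (LINT x|lborel. h' x x)"
    by (rule integral_dominated_convergence[OF dct]) (use qb in auto)
  let ?I = "LINT x|lborel. h x"
  \<comment> \<open>Scaling turns the integral of \<open>q k\<close> into \<open>?I\<close> times
    the difference quotient of \<open>s \<mapsto> 1 / s^n\<close> at 1, whose limit is
    \<open>- n\<close>.\<close>
  have "(LINT x|lborel. q k x) = ?I * ((1 / t k ^ DIM('a) - 1) / (t k - 1))" for k
  proof -
    have "t k \<noteq> 0" using t1[of k] by simp
    have "?I = t k ^ DIM('a) * (LINT x|lborel. h (t k *\<^sub>R x))"
      using lborel_scale_integral[of h "t k" 0] t1[of k] by simp
    then have 1: "(LINT x|lborel. h (t k *\<^sub>R x)) = ?I / t k ^ DIM('a)" using \<open>t k \<noteq> 0\<close> by simp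
    have "integrable lborel (\<lambda>x. h (t k *\<^sub>R x))"
      using lborel_scale_integrable[OF hi \<open>t k \<noteq> 0\<close>, of 0] by simp
    then show ?thesis unfolding q_def using hi 1 by (simp add: diff_divide_distrib algebra_simps)
  qed
  moreover have "(\<lambda>k. (1 / t k ^ DIM('a) - 1) / (t k - 1)) \<longlonglongrightarrow> - real DIM('a)"
  proof -
    have "((\<lambda>s::real. 1 / s ^ DIM('a)) has_real_derivative - real DIM('a)) (at 1)"
      by (auto intro!: derivative_eq_intros)
    then have "((\<lambda>s::real. (1 / s ^ DIM('a) - 1 / 1 ^ DIM('a)) / (s - 1)) \<longlongrightarrow> - real DIM('a)) (at 1)"
      by (simp only: has_field_derivative_iff)
    moreover have "filterlim t (at 1) sequentially"
      using tl t1(1) by (intro filterlim_atI) (auto intro!: always_eventually less_imp_neq[symmetric])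
    ultimately show ?thesis by (auto dest: filterlim_compose)
  qed
  ultimately have "(\<lambda>k. LINT x|lborel. q k x) \<longlonglongrightarrow> ?I * (- real DIM('a))"
    by (simp only:) (rule tendsto_mult_left)
  then show "(LINT x|lborel. h' x x) = - real DIM('a) * (LINT x|lborel. h x)"
    using LIMSEQ_unique[OF lim1] by simp
qed

section \<open>Logarithmic cutoffs\<close>

lemma DERIV_max_0_power2:
  "((\<lambda>s::real. (max 0 s)\<^sup>2) has_real_derivative 2 * max 0 s) (at s)"
proof -
  consider "s > 0" | "s < 0" | "s = 0" by linarith
  then show ?thesis
  proof cases
    case 1
    have "((\<lambda>s::real. s\<^sup>2) has_real_derivative 2 * max 0 s) (at s)"
      using 1 by (auto intro!: derivative_eq_intros)
    then show ?thesis
      by (rule DERIV_cong_ev[THEN iffD1, rotated -1])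
         (use 1 in \<open>auto intro!: eventually_mono[OF eventually_nhds_in_open[of "{0<..}" s]]\<close>)
  next
    case 2
    have "((\<lambda>s::real. 0) has_real_derivative 2 * max 0 s) (at s)"
      using 2 by (auto intro!: derivative_eq_intros)
    then show ?thesis
      by (rule DERIV_cong_ev[THEN iffD1, rotated -1])
         (use 2 in \<open>auto intro!: eventually_mono[OF eventually_nhds_in_open[of "{..<0}" s]]\<close>)
  next
    case 3
    have "((\<lambda>h::real. (max 0 h)\<^sup>2 / h) \<longlongrightarrow> 0) (at 0)"
    proof (rule tendsto_rabs_zero_cancel, rule tendsto_sandwich[of "\<lambda>_. 0" _ _ "\<lambda>h. \<bar>h\<bar>"])
      show "\<forall>\<^sub>F h in at 0. \<bar>(max 0 h)\<^sup>2 / h\<bar> \<le> \<bar>h::real\<bar>"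
        by (intro always_eventually) (auto simp: max_def power2_eq_square)
    qed (auto intro!: tendsto_eq_intros)
    then show ?thesis using 3 by (simp add: DERIV_def)
  qed
qed

text \<open>The logarithm makes the radial derivative \<open>x \<bullet> \<nabla>\<eta>\<close> of
  order \<open>1/k\<close> uniformly in \<open>x\<close>, and squaring the positive part makes the
  function continuously differentiable.\<close>

definition cutoff :: "real \<Rightarrow> 'a::euclidean_space \<Rightarrow> real" where
  "cutoff k x = (max 0 (1 - ln (1 + x \<bullet> x) / k))\<^sup>2"

definition cutoff_deriv :: "real \<Rightarrow> 'a::euclidean_space \<Rightarrow> 'a \<Rightarrow> real" where
  "cutoff_deriv k x v = - (2 * max 0 (1 - ln (1 + x \<bullet> x) / k)) * (2 * (x \<bullet> v) / (1 + x \<bullet> x)) / k"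

lemma one_plus_inner_pos: "1 + x \<bullet> x > (0::real)"
  using inner_ge_zero[of x] by linarith

lemma one_plus_inner_neq_0: "1 + x \<bullet> x \<noteq> (0::real)"
  using one_plus_inner_pos[of x] by linarith

lemma cutoff_has_derivative:
  assumes "k > 0"
  shows "(cutoff k has_derivative cutoff_deriv k x) (at x)"
proof -
  have l: "((\<lambda>x. ln (1 + x \<bullet> x)) has_derivative (\<lambda>v. 2 * (x \<bullet> v) / (1 + x \<bullet> x))) (at x)"
    using one_plus_inner_pos[of x]
    by (auto intro!: derivative_eq_intros simp: fun_eq_iff inner_commute divide_inverse)
  have "((\<lambda>x. 1 - ln (1 + x \<bullet> x) / k) has_derivative (\<lambda>v. - (2 * (x \<bullet> v) / (1 + x \<bullet> x)) / k)) (at x)"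
  proof -
    have "((\<lambda>x. 1 - ln (1 + x \<bullet> x) * inverse k) has_derivative (\<lambda>v. 0 - 2 * (x \<bullet> v) / (1 + x \<bullet> x) * inverse k)) (at x)"
      by (intro has_derivative_diff has_derivative_const has_derivative_mult_left l)
    then show ?thesis by (simp add: divide_inverse)
  qed
  then have "((\<lambda>x. (max 0 (1 - ln (1 + x \<bullet> x) / k))\<^sup>2) has_derivative
    (\<lambda>v. 2 * max 0 (1 - ln (1 + x \<bullet> x) / k) * (- (2 * (x \<bullet> v) / (1 + x \<bullet> x)) / k))) (at x)"
    by (rule has_derivative_compose)
       (use DERIV_max_0_power2[of "1 - ln (1 + x \<bullet> x) / k"] in \<open>simp add: has_field_derivative_def\<close>)
  then show ?thesis unfolding cutoff_def[abs_def] cutoff_deriv_def[abs_def] by simp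
qed

lemma cutoff_deriv_continuous: "k > 0 \<Longrightarrow> continuous_on UNIV (\<lambda>x. cutoff_deriv k x v)"
  unfolding cutoff_deriv_def by (intro continuous_intros) (auto simp: one_plus_inner_neq_0)

lemma cutoff_continuous: "k > 0 \<Longrightarrow> continuous_on UNIV (cutoff k)"
  unfolding cutoff_def[abs_def] by (intro continuous_intros) (auto simp: one_plus_inner_neq_0)

lemma cutoff_measurable [measurable]: "cutoff k \<in> borel_measurable borel"
  unfolding cutoff_def[abs_def] by measurable

lemma cutoff_bounds:
  assumes "k > 0"
  shows "0 \<le> cutoff k x" "cutoff k x \<le> 1"
proof -
  have "ln (1 + x \<bullet> x) \<ge> 0" using inner_ge_zero[of x] by (intro ln_ge_zero) simp
  then have "max 0 (1 - ln (1 + x \<bullet> x) / k) \<le> 1" using assms by simp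
  then show "cutoff k x \<le> 1" unfolding cutoff_def by (intro power_le_one) auto
qed (simp add: cutoff_def)

lemma abs_cutoff_le: "k > 0 \<Longrightarrow> \<bar>cutoff k x\<bar> \<le> 1"
  using cutoff_bounds[of k x] by simp

text \<open>The inequality \<open>|x|^2 \<le> 1 + |x|^2\<close> cancels the denominator, and the
  divisor \<open>k\<close> is the gain from the logarithm. The product with \<open>norm x\<close>
  controls both \<open>x \<bullet> \<nabla>\<eta>\<close> and the derivative of the field
  \<open>\<eta> x\<close>.\<close>

lemma cutoff_deriv_bound:
  assumes "k > 0"
  shows "\<bar>cutoff_deriv k x v\<bar> * norm x \<le> 4 / k * norm v"
proof -
  define m where "m = max 0 (1 - ln (1 + x \<bullet> x) / k)"
  have "ln (1 + x \<bullet> x) \<ge> 0" using inner_ge_zero[of x] by (intro ln_ge_zero) simp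
  then have m: "0 \<le> m" "m \<le> 1" using assms by (auto simp: m_def)
  have "\<bar>x \<bullet> v\<bar> * norm x \<le> (norm x * norm v) * norm x"
    by (intro mult_right_mono Cauchy_Schwarz_ineq2) auto
  also have "\<dots> = (x \<bullet> x) * norm v" by (simp add: dot_square_norm power2_eq_square)
  also have "\<dots> \<le> (1 + x \<bullet> x) * norm v" by (intro mult_right_mono) auto
  finally have 1: "\<bar>x \<bullet> v\<bar> * norm x / (1 + x \<bullet> x) \<le> norm v"
    using one_plus_inner_pos[of x] by (simp add: pos_divide_le_eq mult.commute)
  have "\<bar>cutoff_deriv k x v\<bar> * norm x = 4 / k * (m * (\<bar>x \<bullet> v\<bar> * norm x / (1 + x \<bullet> x)))"
    using assms one_plus_inner_pos[of x] m
    by (simp add: cutoff_deriv_def m_def[symmetric] abs_mult abs_divide mult_ac)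
  also have "m * (\<bar>x \<bullet> v\<bar> * norm x / (1 + x \<bullet> x)) \<le> 1 * norm v"
    using m 1 by (intro mult_mono) auto
  finally show ?thesis using assms by (simp add: mult_left_mono divide_right_mono)
qed

lemma cutoff_eq_0:
  assumes "k > 0" "norm x \<ge> exp k"
  shows "cutoff k x = 0"
proof -
  have "exp k \<ge> 1" using assms by simp
  then have "norm x \<ge> 1" using assms by linarith
  then have "exp k * 1 \<le> norm x * norm x" using assms by (intro mult_mono) auto
  then have "exp k \<le> 1 + x \<bullet> x" by (simp add: dot_square_norm power2_eq_square)
  then have "k \<le> ln (1 + x \<bullet> x)" using one_plus_inner_pos[of x] by (simp add: ln_ge_iff)
  then show ?thesis using assms by (simp add: cutoff_def max_def)
qed

text \<open>The parameter is \<open>Suc k\<close>, hence at least 1, as the uniform Lipschitz bound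
  below requires.\<close>

lemma cutoff_tendsto: "(\<lambda>k. cutoff (real (Suc k)) x) \<longlonglongrightarrow> 1"
proof -
  have "(\<lambda>k. ln (1 + x \<bullet> x) * inverse (real (Suc k))) \<longlonglongrightarrow> ln (1 + x \<bullet> x) * 0"
    by (intro tendsto_intros LIMSEQ_inverse_real_of_nat)
  then have "(\<lambda>k. (max 0 (1 - ln (1 + x \<bullet> x) / real (Suc k)))\<^sup>2) \<longlonglongrightarrow> (max 0 (1 - 0))\<^sup>2"
    by (intro tendsto_intros) (simp add: divide_inverse)
  then show ?thesis by (simp add: cutoff_def)
qed

text \<open>The derivative of \<open>\<eta> x\<close> in direction \<open>v\<close> is
  \<open>\<eta> v + (\<nabla>\<eta> \<bullet> v) x\<close>, whose two terms contribute 1 and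
  \<open>4 / k \<le> 4\<close> to the constant. Its independence of \<open>k\<close> is what the
  limit needs.\<close>

lemma cutoff_field_Lipschitz:
  fixes x y :: "'a::euclidean_space"
  assumes k: "k \<ge> 1"
  shows "norm (cutoff k x *\<^sub>R x - cutoff k y *\<^sub>R y) \<le> 5 * norm (x - y)"
proof (rule differentiable_bound[of UNIV])
  show "((\<lambda>x. cutoff k x *\<^sub>R x) has_derivative (\<lambda>v. cutoff k x *\<^sub>R v + cutoff_deriv k x v *\<^sub>R x)) (at x within UNIV)"
    for x :: 'a
    using k by (intro has_derivative_scaleR cutoff_has_derivative has_derivative_ident has_derivative_at_withinI) auto
  show "onorm (\<lambda>v. cutoff k x *\<^sub>R v + cutoff_deriv k x v *\<^sub>R x) \<le> 5" for x :: 'a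
  proof (rule onorm_le)
    fix v
    have "norm (cutoff k x *\<^sub>R v + cutoff_deriv k x v *\<^sub>R x) \<le> cutoff k x * norm v + \<bar>cutoff_deriv k x v\<bar> * norm x"
      using cutoff_bounds[of k x] k by (intro order_trans[OF norm_triangle_ineq]) auto
    also have "\<dots> \<le> 1 * norm v + 4 / k * norm v"
      using cutoff_bounds[of k x] k by (intro add_mono mult_right_mono cutoff_deriv_bound) auto
    also have "\<dots> \<le> 1 * norm v + 4 * norm v"
      using k by (intro add_mono mult_right_mono) (auto simp: pos_divide_le_eq)
    finally show "norm (cutoff k x *\<^sub>R v + cutoff_deriv k x v *\<^sub>R x) \<le> 5 * norm v" by simp
  qed
qed auto

lemma cutoff_integral_tendsto:
  fixes g :: "'a::euclidean_space \<Rightarrow> real"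
  assumes g: "integrable lborel g"
  shows "\<And>k. integrable lborel (\<lambda>x. cutoff (real (Suc k)) (x - b) * g x)"
    and "(\<lambda>k. LINT x|lborel. cutoff (real (Suc k)) (x - b) * g x) \<longlonglongrightarrow> (LINT x|lborel. g x)"
proof -
  have [measurable]: "g \<in> borel_measurable borel" using g by simp
  have b: "norm (cutoff (real (Suc k)) (x - b) * g x) \<le> \<bar>g x\<bar>" for k x
    using abs_cutoff_le[of "real (Suc k)" "x - b"] by (simp add: abs_mult mult_left_le_one_le)
  have m: "(\<lambda>x. cutoff (real (Suc k)) (x - b) * g x) \<in> borel_measurable lborel" for k by measurable
  show "integrable lborel (\<lambda>x. cutoff (real (Suc k)) (x - b) * g x)" for k
    by (rule Bochner_Integration.integrable_bound[OF g m]) (use b in simp)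
  have "(\<lambda>k. LINT x|lborel. cutoff (real (Suc k)) (x - b) * g x) \<longlonglongrightarrow> (LINT x|lborel. 1 * g x)"
  proof (rule integral_dominated_convergence)
    show "integrable lborel (\<lambda>x. \<bar>g x\<bar>)" using g by (rule integrable_abs)
    show "AE x in lborel. (\<lambda>k. cutoff (real (Suc k)) (x - b) * g x) \<longlonglongrightarrow> 1 * g x"
      by (intro AE_I2 tendsto_intros cutoff_tendsto)
    show "AE x in lborel. norm (cutoff (real (Suc k)) (x - b) * g x) \<le> \<bar>g x\<bar>" for k
      by (intro AE_I2 b)
  qed (use m in simp_all)
  then show "(\<lambda>k. LINT x|lborel. cutoff (real (Suc k)) (x - b) * g x) \<longlonglongrightarrow> (LINT x|lborel. g x)" by simp
qed

section \<open>Symmetrization with the cut-off dilation field\<close>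

context log_potential
begin

abbreviation "mass \<equiv> LINT y|lborel. f y"

definition cut_field :: "'a \<Rightarrow> real \<Rightarrow> 'a \<Rightarrow> 'a" where
  "cut_field b k x = cutoff k (x - b) *\<^sub>R (x - b)"

lemma cut_field_measurable [measurable]: "cut_field b k \<in> borel_measurable borel"
  unfolding cut_field_def[abs_def] by measurable

lemma cut_field_bounded: "k > 0 \<Longrightarrow> norm (cut_field b k x) \<le> exp k"
  using cutoff_bounds[of k "x - b"] cutoff_eq_0[of k "x - b"] mult_mono[of "cutoff k (x - b)" 1 "norm (x - b)" "exp k"]
  by (cases "norm (x - b) < exp k") (auto simp: cut_field_def)

lemma cut_field_eq_0: "k > 0 \<Longrightarrow> norm (x - b) \<ge> exp k \<Longrightarrow> cut_field b k x = 0"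
  by (simp add: cut_field_def cutoff_eq_0)

text \<open>The Lipschitz bound for the field cancels the singularity of the kernel on the diagonal,
  uniformly in \<open>k\<close>; this gives the dominating function for the limit.\<close>

lemma abs_grad_kernel_cut_field_diff:
  assumes "k \<ge> 1"
  shows "\<bar>grad_kernel (cut_field b k x - cut_field b k y) (x - y)\<bar> \<le> 5"
proof (cases "x = y")
  case False
  have "\<bar>grad_kernel (cut_field b k x - cut_field b k y) (x - y)\<bar>
    \<le> norm (cut_field b k x - cut_field b k y) / norm (x - y)"
    by (rule abs_grad_kernel_le)
  also have "\<dots> \<le> 5"
    using False cutoff_field_Lipschitz[OF assms, of "x - b" "y - b"]
    by (simp add: cut_field_def pos_divide_le_eq)
  finally show ?thesis .
qed (simp add: grad_kernel_def)

text \<open>In the limit the field is \<open>x - b\<close>, so the difference is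
  \<open>x - y\<close> itself and the kernel is \<open>|x - y|^2 / |x - y|^2\<close>.\<close>

lemma grad_kernel_cut_field_tendsto:
  assumes "x \<noteq> y"
  shows "(\<lambda>k. grad_kernel (cut_field b (real (Suc k)) x - cut_field b (real (Suc k)) y) (x - y)) \<longlonglongrightarrow> 1"
proof -
  have "(\<lambda>k. grad_kernel (cut_field b (real (Suc k)) x - cut_field b (real (Suc k)) y) (x - y))
    \<longlonglongrightarrow> ((x - y) \<bullet> (1 *\<^sub>R (x - b) - 1 *\<^sub>R (y - b))) / (norm (x - y))\<^sup>2"
    unfolding grad_kernel_def cut_field_def using assms
    by (intro tendsto_intros cutoff_tendsto) auto
  then show ?thesis using assms by (simp add: dot_square_norm)
qed

text \<open>For fixed \<open>k\<close> the field is bounded by \<open>exp k\<close> and vanishes off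
  a ball, over which the inverse distance integrals have a common bound. This justifies exchanging
  the integrals before the singularity has cancelled.\<close>

lemma cut_field_kernel_integrable:
  assumes k: "k > 0"
  shows "integrable (lborel \<Otimes>\<^sub>M lborel) (\<lambda>(x, y). f x * f y * grad_kernel (cut_field b k x) (x - y))"
    (is "integrable _ ?H")
proof (rule lborel_pair.Fubini_integrable)
  show Hm: "?H \<in> borel_measurable (lborel \<Otimes>\<^sub>M lborel)"
    unfolding grad_kernel_def by measurable
  have i: "integrable lborel (\<lambda>y. ?H (x, y))" for x
    using integrable_mult_right[OF grad_kernel_int[of "cut_field b k x" x], of "f x"]
    by (simp add: mult_ac)
  then show "AE x in lborel. integrable lborel (\<lambda>y. ?H (x, y))" by simp
  obtain M where M: "\<And>x. norm x \<le> norm b + exp k \<Longrightarrow> (LINT y|lborel. \<bar>f y\<bar> / norm (x - y)) \<le> M"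
    using inverse_dist_bound by blast
  have "0 \<le> (LINT y|lborel. \<bar>f y\<bar> / norm (b - y))" by (intro integral_nonneg_AE) auto
  also have "\<dots> \<le> M" using M[of b] by simp
  finally have M0: "M \<ge> 0" .
  show "integrable lborel (\<lambda>x. LINT y|lborel. norm (?H (x, y)))"
  proof (rule Bochner_Integration.integrable_bound)
    show "integrable lborel (\<lambda>x. exp k * M * \<bar>f x\<bar>)"
      using f_int by (intro integrable_mult_right integrable_abs)
    show "(\<lambda>x. LINT y|lborel. norm (?H (x, y))) \<in> borel_measurable lborel"
      using Hm by measurable
    show "AE x in lborel. norm (LINT y|lborel. norm (?H (x, y))) \<le> norm (exp k * M * \<bar>f x\<bar>)"
    proof (rule AE_I2)
      fix x
      show "norm (LINT y|lborel. norm (?H (x, y))) \<le> norm (exp k * M * \<bar>f x\<bar>)"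
      proof (cases "norm (x - b) \<ge> exp k")
        case True
        then show ?thesis using cut_field_eq_0[OF k] by (simp add: grad_kernel_def)
      next
        case False
        have "norm x \<le> norm b + exp k" using norm_triangle_sub[of x b] False by simp
        note M = M[OF this]
        have "(LINT y|lborel. norm (?H (x, y))) \<le> (LINT y|lborel. (\<bar>f x\<bar> * exp k) * (\<bar>f y\<bar> / norm (x - y)))"
        proof (rule integral_mono)
          fix y
          have "\<bar>grad_kernel (cut_field b k x) (x - y)\<bar> \<le> norm (cut_field b k x) / norm (x - y)"
            by (rule abs_grad_kernel_le)
          also have "\<dots> \<le> exp k / norm (x - y)"
            by (intro divide_right_mono cut_field_bounded k) auto
          finally have "\<bar>f x\<bar> * \<bar>f y\<bar> * \<bar>grad_kernel (cut_field b k x) (x - y)\<bar>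
            \<le> \<bar>f x\<bar> * \<bar>f y\<bar> * (exp k / norm (x - y))"
            by (intro mult_left_mono) auto
          then show "norm (?H (x, y)) \<le> (\<bar>f x\<bar> * exp k) * (\<bar>f y\<bar> / norm (x - y))"
            by (simp add: abs_mult mult_ac)
        next
          show "integrable lborel (\<lambda>y. norm (?H (x, y)))" using i by (rule integrable_norm)
          show "integrable lborel (\<lambda>y. (\<bar>f x\<bar> * exp k) * (\<bar>f y\<bar> / norm (x - y)))"
            by (intro integrable_mult_right inverse_dist_int)
        qed
        also have "\<dots> = (\<bar>f x\<bar> * exp k) * (LINT y|lborel. \<bar>f y\<bar> / norm (x - y))"
          by (simp only: integral_mult_right_zero)
        also have "\<dots> \<le> (\<bar>f x\<bar> * exp k) * M" using M by (intro mult_left_mono) auto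
        finally have "(LINT y|lborel. norm (?H (x, y))) \<le> exp k * M * \<bar>f x\<bar>" by (simp add: mult_ac)
        moreover have "0 \<le> (LINT y|lborel. norm (?H (x, y)))" by (intro integral_nonneg_AE) auto
        ultimately show ?thesis using M0 by (simp add: abs_mult)
      qed
    qed
  qed
qed

text \<open>Symmetrizing in \<open>x\<close> and \<open>y\<close> replaces the singular kernel by a bounded one.\<close>

lemma cut_field_symmetrized:
  assumes k: "k > 0"
  shows "2 * (LINT x|lborel. f x * grad_potential (cut_field b k x) x)
    = (LINT x|lborel. LINT y|lborel. f x * f y * grad_kernel (cut_field b k x - cut_field b k y) (x - y))"
proof -
  let ?H = "\<lambda>(x, y). f x * f y * grad_kernel (cut_field b k x) (x - y)"
  let ?S = "\<lambda>(x, y). ?H (y, x)"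
  have Hi: "integrable (lborel \<Otimes>\<^sub>M lborel) ?H" by (rule cut_field_kernel_integrable[OF k])
  have Si: "integrable (lborel \<Otimes>\<^sub>M lborel) ?S"
    using lborel_pair.integrable_product_swap[OF Hi] by simp
  have 1: "(LINT x|lborel. f x * grad_potential (cut_field b k x) x) = integral\<^sup>L (lborel \<Otimes>\<^sub>M lborel) ?H"
  proof -
    have "integral\<^sup>L (lborel \<Otimes>\<^sub>M lborel) ?H = (LINT x|lborel. LINT y|lborel. ?H (x, y))"
      using lborel_pair.integral_fst'[OF Hi] by simp
    also have "\<dots> = (LINT x|lborel. f x * grad_potential (cut_field b k x) x)"
      unfolding grad_potential_def by (simp add: mult_ac flip: integral_mult_right_zero)
    finally show ?thesis by simp
  qed
  have 2: "integral\<^sup>L (lborel \<Otimes>\<^sub>M lborel) ?S = integral\<^sup>L (lborel \<Otimes>\<^sub>M lborel) ?H"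
    using lborel_pair.integral_product_swap[OF borel_measurable_integrable[OF Hi]] by simp
  \<comment> \<open>The kernel is odd in \<open>x - y\<close> and linear in the direction, so adding
    the swapped term produces the difference of the two field values.\<close>
  have HS: "?H p + ?S p = (\<lambda>(x, y). f x * f y * grad_kernel (cut_field b k x - cut_field b k y) (x - y)) p" for p
  proof -
    obtain x y where p: "p = (x, y)" by (cases p)
    have e1: "grad_kernel (cut_field b k y) (y - x) = - grad_kernel (cut_field b k y) (x - y)"
      by (simp add: grad_kernel_def norm_minus_commute inner_diff_left diff_divide_distrib)
    have e2: "grad_kernel (cut_field b k x - cut_field b k y) (x - y)
      = grad_kernel (cut_field b k x) (x - y) - grad_kernel (cut_field b k y) (x - y)"
      by (simp add: grad_kernel_def inner_diff_right diff_divide_distrib)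
    show ?thesis unfolding p prod.case e1 e2 by (simp add: algebra_simps)
  qed
  have "2 * (LINT x|lborel. f x * grad_potential (cut_field b k x) x)
    = integral\<^sup>L (lborel \<Otimes>\<^sub>M lborel) (\<lambda>p. ?H p + ?S p)"
    using Bochner_Integration.integral_add[OF Hi Si] 1 2 by simp
  also have "\<dots> = (LINT x|lborel. LINT y|lborel. ?H (x, y) + ?S (x, y))"
    using lborel_pair.integral_fst'[OF Bochner_Integration.integrable_add[OF Hi Si]] by simp
  finally show ?thesis unfolding HS by simp
qed

text \<open>Dominated convergence, first in \<open>y\<close> and then in \<open>x\<close>, sends the
  symmetrized double integral to \<open>mass * mass\<close>, since the kernel tends to 1;
  symmetrization accounts for the factor \<open>1/2\<close>.\<close>

lemma cut_field_limit:
  "(\<lambda>k. LINT x|lborel. f x * grad_potential (cut_field b (real (Suc k)) x) x) \<longlonglongrightarrow> mass\<^sup>2 / 2"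
proof -
  let ?K = "\<lambda>k x y. grad_kernel (cut_field b (real (Suc k)) x - cut_field b (real (Suc k)) y) (x - y)"
  have [measurable]: "(\<lambda>(x, y). ?K k x y) \<in> borel_measurable (lborel \<Otimes>\<^sub>M lborel)" for k
    unfolding grad_kernel_def by measurable
  have bound: "norm (f x * f y * ?K k x y) \<le> 5 * \<bar>f x\<bar> * \<bar>f y\<bar>" for x y k
    using mult_left_mono[OF abs_grad_kernel_cut_field_diff[of "real (Suc k)" b x y], of "\<bar>f x\<bar> * \<bar>f y\<bar>"]
    by (simp add: abs_mult mult_ac)
  have mK [measurable]: "(\<lambda>y. ?K k x y) \<in> borel_measurable lborel" for k x
    unfolding grad_kernel_def by measurable
  have dom: "integrable lborel (\<lambda>y. 5 * \<bar>f x\<bar> * \<bar>f y\<bar>)" for x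
    using f_int by (intro integrable_mult_right integrable_abs)
  have iK: "integrable lborel (\<lambda>y. f x * f y * ?K k x y)" for x k
  proof (rule Bochner_Integration.integrable_bound[OF dom[of x]])
    show "(\<lambda>y. f x * f y * ?K k x y) \<in> borel_measurable lborel"
      by (intro borel_measurable_times mK) auto
    show "AE y in lborel. norm (f x * f y * ?K k x y) \<le> norm (5 * \<bar>f x\<bar> * \<bar>f y\<bar>)"
      using bound by (intro AE_I2 order_trans[OF bound]) auto
  qed
  have inner: "(\<lambda>k. LINT y|lborel. f x * f y * ?K k x y) \<longlonglongrightarrow> f x * mass" for x
  proof -
    have "(\<lambda>k. LINT y|lborel. f x * f y * ?K k x y) \<longlonglongrightarrow> (LINT y|lborel. f x * f y * 1)"
    proof (rule integral_dominated_convergence[OF _ _ dom[of x]])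
      show "AE y in lborel. (\<lambda>k. f x * f y * ?K k x y) \<longlonglongrightarrow> f x * f y * 1"
        using AE_lborel_neq[of x] by eventually_elim (intro tendsto_intros grad_kernel_cut_field_tendsto, auto)
      show "(\<lambda>y. f x * f y * ?K k x y) \<in> borel_measurable lborel" for k
        by (intro borel_measurable_times mK) auto
      show "AE y in lborel. norm (f x * f y * ?K k x y) \<le> 5 * \<bar>f x\<bar> * \<bar>f y\<bar>" for k
        by (intro AE_I2 bound)
    qed simp
    then show ?thesis by simp
  qed
  have "(\<lambda>k. LINT x|lborel. LINT y|lborel. f x * f y * ?K k x y) \<longlonglongrightarrow> (LINT x|lborel. f x * mass)"
  proof (rule integral_dominated_convergence)
    show "integrable lborel (\<lambda>x. 5 * (LINT y|lborel. \<bar>f y\<bar>) * \<bar>f x\<bar>)"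
      using f_int by (intro integrable_mult_right integrable_abs)
    show "AE x in lborel. (\<lambda>k. LINT y|lborel. f x * f y * ?K k x y) \<longlonglongrightarrow> f x * mass"
      using inner by simp
    show "AE x in lborel. norm (LINT y|lborel. f x * f y * ?K k x y) \<le> 5 * (LINT y|lborel. \<bar>f y\<bar>) * \<bar>f x\<bar>" for k
    proof (rule AE_I2)
      fix x
      have "norm (LINT y|lborel. f x * f y * ?K k x y) \<le> (LINT y|lborel. norm (f x * f y * ?K k x y))"
        by (rule integral_norm_bound)
      also have "\<dots> \<le> (LINT y|lborel. 5 * \<bar>f x\<bar> * \<bar>f y\<bar>)"
        using bound dom iK by (intro integral_mono integrable_norm)
      finally show "norm (LINT y|lborel. f x * f y * ?K k x y) \<le> 5 * (LINT y|lborel. \<bar>f y\<bar>) * \<bar>f x\<bar>"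
        by (simp add: mult_ac)
    qed
    show "(\<lambda>x. LINT y|lborel. f x * f y * ?K k x y) \<in> borel_measurable lborel" for k
      by measurable
  qed measurable
  then have "(\<lambda>k. 2 * (LINT x|lborel. f x * grad_potential (cut_field b (real (Suc k)) x) x)) \<longlonglongrightarrow> mass * mass"
    by (simp add: cut_field_symmetrized)
  from tendsto_mult_left[OF this, of "1 / 2"] show ?thesis by (simp add: power2_eq_square)
qed

lemma grad_potential_scale: "grad_potential (r *\<^sub>R e) x = r * grad_potential e x"
  unfolding grad_potential_def grad_kernel_def
  by (simp add: mult_ac flip: integral_mult_right_zero)

text \<open>The cutoff is moved into the direction of the derivative, which is then
  \<open>cut_field b k x\<close>, and the gradient formula for \<open>u\<close> reduces the integral
  to the one just computed.\<close>

lemma pohozaev_derivative: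
  assumes D: "\<And>x. (u has_derivative u' x) (at x)"
  shows "k > 0 \<Longrightarrow> integrable lborel (\<lambda>x. cutoff k (x - b) * f x * u' x (x - b))"
    and "(\<lambda>k. LINT x|lborel. cutoff (real (Suc k)) (x - b) * f x * u' x (x - b)) \<longlonglongrightarrow> - c * mass\<^sup>2 / 2"
proof -
  have E: "cutoff k (x - b) * f x * u' x (x - b) = - c * (f x * grad_potential (cut_field b k x) x)" for k x
    by (simp add: derivative_eq_grad_potential[OF D] cut_field_def grad_potential_scale)
  show "integrable lborel (\<lambda>x. cutoff k (x - b) * f x * u' x (x - b))" if "k > 0"
  proof -
    have "(LINT y|lborel. f x * f y * grad_kernel (cut_field b k x) (x - y)) = f x * grad_potential (cut_field b k x) x" for x
      unfolding grad_potential_def by (simp add: mult_ac flip: integral_mult_right_zero)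
    then have "integrable lborel (\<lambda>x. f x * grad_potential (cut_field b k x) x)"
      using lborel_pair.integrable_fst'[OF cut_field_kernel_integrable[OF that, of b]] by simp
    then show ?thesis unfolding E by (rule integrable_mult_right)
  qed
  from E have "(LINT x|lborel. cutoff k (x - b) * f x * u' x (x - b))
    = - c * (LINT x|lborel. f x * grad_potential (cut_field b k x) x)" for k
    by (simp only: integral_mult_right_zero)
  then show "(\<lambda>k. LINT x|lborel. cutoff (real (Suc k)) (x - b) * f x * u' x (x - b)) \<longlonglongrightarrow> - c * mass\<^sup>2 / 2"
    using tendsto_mult_left[OF cut_field_limit[of b], of "- c"] by simp
qed

text \<open>The dilation identity is applied to the product of \<open>f\<close> with the cutoff. The
  extra term contains the radial derivative of the cutoff and is at most \<open>4 / Suc k\<close>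
  times \<open>|f|\<close>, so it disappears in the limit.\<close>

lemma pohozaev_density:
  assumes D: "\<And>x. (f has_derivative f' x) (at x)" and cont: "\<And>v. continuous_on UNIV (\<lambda>x. f' x v)"
  shows "(\<lambda>k. LINT x|lborel. cutoff (real (Suc k)) (x - b) * f' x (x - b)) \<longlonglongrightarrow> - real DIM('a) * mass"
    and "\<And>k. integrable lborel (\<lambda>x. cutoff (real (Suc k)) (x - b) * f' x (x - b))"
proof -
  let ?\<eta> = "\<lambda>k x. cutoff (real (Suc k)) x"
  let ?d = "\<lambda>k x. cutoff_deriv (real (Suc k)) (x - b) (x - b)"
  have db: "\<bar>?d k x\<bar> \<le> 4 / real (Suc k)" for k x
  proof (cases "x = b")
    case False
    then show ?thesis
      by (intro mult_right_le_imp_le[OF cutoff_deriv_bound]) auto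
  qed (simp add: cutoff_deriv_def)
  have [measurable]: "(\<lambda>x. ?d k x) \<in> borel_measurable borel" for k
    unfolding cutoff_deriv_def by measurable
  have fd: "integrable lborel (\<lambda>x. f x * ?d k x)" for k
  proof (rule Bochner_Integration.integrable_bound)
    show "integrable lborel (\<lambda>x. f x * (4 / real (Suc k)))" using f_int by (rule integrable_mult_left)
    show "AE x in lborel. norm (f x * ?d k x) \<le> norm (f x * (4 / real (Suc k)))"
    proof (rule AE_I2)
      fix x
      have "\<bar>f x\<bar> * \<bar>?d k x\<bar> \<le> \<bar>f x\<bar> * (4 / real (Suc k))" by (intro mult_left_mono db) auto
      then show "norm (f x * ?d k x) \<le> norm (f x * (4 / real (Suc k)))"
        by (simp add: abs_mult)
    qed
  qed measurable
  \<comment> \<open>Translating by \<open>b\<close> moves the center to the origin, about which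
    \<open>dilation_identity\<close> dilates.\<close>
  let ?h = "\<lambda>k x. ?\<eta> k x * f (x + b)"
  let ?h' = "\<lambda>k x v. ?\<eta> k x * f' (x + b) v + cutoff_deriv (real (Suc k)) x v * f (x + b)"
  have hD: "(?h k has_derivative ?h' k x) (at x)" for k x
  proof -
    have "((\<lambda>x. x + b) has_derivative (\<lambda>v. v)) (at x)"
      by (auto intro!: derivative_eq_intros)
    from has_derivative_compose[OF this D]
    have "((\<lambda>x. f (x + b)) has_derivative f' (x + b)) (at x)" .
    then show ?thesis
      by (intro has_derivative_mult cutoff_has_derivative) auto
  qed
  have f'c: "continuous_on UNIV (\<lambda>x. f' (x + b) v)" for v
    by (intro continuous_on_compose2[OF cont] continuous_intros) auto
  have fc: "continuous_on UNIV (\<lambda>x. f (x + b))"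
    by (intro continuous_on_compose2[OF f_cont] continuous_intros) auto
  have hc: "continuous_on UNIV (\<lambda>x. ?h' k x v)" for k v
    by (intro continuous_intros cutoff_continuous cutoff_deriv_continuous f'c fc) auto
  have hs: "?h k x = 0" if "norm x > exp (real (Suc k))" for k x
    using cutoff_eq_0[of "real (Suc k)" x] that by simp
  have dil: "integrable lborel (?h k)" "integrable lborel (\<lambda>x. ?h' k x x)"
    "(LINT x|lborel. ?h' k x x) = - real DIM('a) * (LINT x|lborel. ?h k x)" for k
    by (rule dilation_identity[OF hD hc hs]; assumption)+
  have shift: "(LINT x|lborel. g (x - b)) = (LINT x|lborel. g x)" if "g \<in> borel_measurable borel" for g :: "'a \<Rightarrow> real"
    using lborel_scale_integral[OF that, of 1 "- b"] by simp
  have m1: "(\<lambda>x. ?h' k x x) \<in> borel_measurable borel" for k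
    using borel_measurable_integrable[OF dil(2)[of k]] by simp
  have m2: "?h k \<in> borel_measurable borel" for k
    using borel_measurable_integrable[OF dil(1)[of k]] by simp
  have I: "integrable lborel (\<lambda>x. ?\<eta> k (x - b) * f' x (x - b) + ?d k x * f x)" for k
    using lborel_scale_integrable[OF dil(2)[of k], of 1 "- b"] by simp
  show i: "integrable lborel (\<lambda>x. ?\<eta> k (x - b) * f' x (x - b))" for k
    using Bochner_Integration.integrable_diff[OF I[of k] fd[of k]] by (simp add: mult.commute)
  have E: "(LINT x|lborel. ?\<eta> k (x - b) * f' x (x - b))
    = - real DIM('a) * (LINT x|lborel. ?\<eta> k (x - b) * f x) - (LINT x|lborel. f x * ?d k x)" for k
  proof -
    have "(LINT x|lborel. ?\<eta> k (x - b) * f' x (x - b)) + (LINT x|lborel. f x * ?d k x)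
      = (LINT x|lborel. ?\<eta> k (x - b) * f' x (x - b) + f x * ?d k x)"
      by (rule Bochner_Integration.integral_add[OF i fd, symmetric])
    also have "\<dots> = (LINT x|lborel. ?h' k x x)"
      using shift[OF m1[of k]] by (simp add: mult.commute)
    also have "\<dots> = - real DIM('a) * (LINT x|lborel. ?h k x)" by (rule dil(3))
    also have "(LINT x|lborel. ?h k x) = (LINT x|lborel. ?\<eta> k (x - b) * f x)"
      using shift[OF m2[of k]] by simp
    finally show ?thesis by simp
  qed
  have l1: "(\<lambda>k. LINT x|lborel. ?\<eta> k (x - b) * f x) \<longlonglongrightarrow> mass"
    by (rule cutoff_integral_tendsto(2)[OF f_int])
  have l2: "(\<lambda>k. LINT x|lborel. f x * ?d k x) \<longlonglongrightarrow> (LINT x|lborel. f x * 0)"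
  proof (rule integral_dominated_convergence[where w="\<lambda>x. \<bar>f x\<bar> * 4"])
    have "(\<lambda>k. ?d k x) \<longlonglongrightarrow> 0" for x
    proof (rule Lim_null_comparison)
      show "\<forall>\<^sub>F k in sequentially. norm (?d k x) \<le> 4 * inverse (real (Suc k))"
        using db by (intro always_eventually) (auto simp: divide_inverse)
      show "(\<lambda>k. 4 * inverse (real (Suc k))) \<longlonglongrightarrow> 0"
        using tendsto_mult_left[OF LIMSEQ_inverse_real_of_nat, of 4] by simp
    qed
    then show "AE x in lborel. (\<lambda>k. f x * ?d k x) \<longlonglongrightarrow> f x * 0"
      by (intro AE_I2 tendsto_intros)
    have "\<bar>?d k x\<bar> \<le> 4" for k x
    proof -
      have "4 / real (Suc k) \<le> 4" by (simp add: pos_divide_le_eq)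
      then show ?thesis using db[of k x] by linarith
    qed
    then show "AE x in lborel. norm (f x * ?d k x) \<le> \<bar>f x\<bar> * 4" for k
      by (intro AE_I2) (auto simp: abs_mult intro!: mult_left_mono)
    show "(\<lambda>x. f x * ?d k x) \<in> borel_measurable lborel" for k by measurable
  qed (use f_int in auto)
  show "(\<lambda>k. LINT x|lborel. ?\<eta> k (x - b) * f' x (x - b)) \<longlonglongrightarrow> - real DIM('a) * mass"
    unfolding E using tendsto_diff[OF tendsto_mult_left[OF l1, of "- real DIM('a)"] l2] by simp
qed

text \<open>The derivative of \<open>f = Q e^{nu}\<close> along \<open>x - b\<close> is
  \<open>Q' e^{nu} + n f u'\<close>, and the two preceding lemmas give the limits for the whole and
  for the second summand. The limit is taken along the cutoffs; integrability of
  \<open>Q' x (x - b) e^{nu}\<close> itself is not asserted.\<close>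

theorem pohozaev_identity:
  fixes Q :: "'a \<Rightarrow> real"
  assumes f: "\<And>x. f x = Q x * exp (real DIM('a) * u x)"
    and Q: "\<And>x. (Q has_derivative Q' x) (at x)" "\<And>v. continuous_on UNIV (\<lambda>x. Q' x v)"
    and u: "\<And>x. (u has_derivative u' x) (at x)" "\<And>v. continuous_on UNIV (\<lambda>x. u' x v)"
  shows "\<And>k. integrable lborel (\<lambda>x. cutoff (real (Suc k)) (x - b) * (Q' x (x - b) * exp (real DIM('a) * u x)))"
    and "(\<lambda>k. LINT x|lborel. cutoff (real (Suc k)) (x - b) * (Q' x (x - b) * exp (real DIM('a) * u x)))
      \<longlonglongrightarrow> real DIM('a) * (c * mass\<^sup>2 / 2 - mass)"
proof -
  let ?n = "real DIM('a)"
  let ?\<eta> = "\<lambda>k x. cutoff (real (Suc k)) (x - b)"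
  define f' where "f' x v = Q x * (exp (?n * u x) * (?n * u' x v)) + Q' x v * exp (?n * u x)" for x v
  have Qc: "continuous_on UNIV Q"
    using has_derivative_continuous[OF Q(1)] by (auto intro: continuous_at_imp_continuous_on)
  have uc: "continuous_on UNIV u"
    using has_derivative_continuous[OF u(1)] by (auto intro: continuous_at_imp_continuous_on)
  have "((\<lambda>x. exp (?n * u x)) has_derivative (\<lambda>v. exp (?n * u x) * (?n * u' x v))) (at x)" for x
    using has_derivative_exp[OF has_derivative_mult_right[OF u(1), of ?n]] by (simp add: mult.commute)
  then have D: "(f has_derivative f' x) (at x)" for x
    unfolding f[abs_def] f'_def[abs_def] by (rule has_derivative_mult[OF Q(1)])
  have c: "continuous_on UNIV (\<lambda>x. f' x v)" for v
    unfolding f'_def by (intro continuous_intros Q u Qc uc)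
  have E: "?\<eta> k x * (Q' x (x - b) * exp (?n * u x)) = ?\<eta> k x * f' x (x - b) - ?n * (?\<eta> k x * f x * u' x (x - b))" for k x
    by (simp add: f'_def f algebra_simps)
  have i1: "integrable lborel (\<lambda>x. ?\<eta> k x * f' x (x - b))" for k by (rule pohozaev_density(2)[OF D c])
  have i2: "integrable lborel (\<lambda>x. ?n * (?\<eta> k x * f x * u' x (x - b)))" for k
    by (intro integrable_mult_right pohozaev_derivative(1) u(1)) simp
  show "integrable lborel (\<lambda>x. ?\<eta> k x * (Q' x (x - b) * exp (?n * u x)))" for k
    unfolding E by (rule Bochner_Integration.integrable_diff[OF i1 i2])
  have "(\<lambda>k. (LINT x|lborel. ?\<eta> k x * f' x (x - b)) - ?n * (LINT x|lborel. ?\<eta> k x * f x * u' x (x - b)))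
    \<longlonglongrightarrow> - ?n * mass - ?n * (- c * mass\<^sup>2 / 2)"
    by (intro tendsto_diff tendsto_mult_left pohozaev_density(1) pohozaev_derivative(2) D c u(1))
  moreover have "(LINT x|lborel. ?\<eta> k x * f' x (x - b)) - ?n * (LINT x|lborel. ?\<eta> k x * f x * u' x (x - b))
    = (LINT x|lborel. ?\<eta> k x * (Q' x (x - b) * exp (?n * u x)))" for k
    unfolding E using Bochner_Integration.integral_diff[OF i1[of k] i2[of k]] by (simp only: integral_mult_right_zero)
  ultimately show "(\<lambda>k. LINT x|lborel. ?\<eta> k x * (Q' x (x - b) * exp (?n * u x)))
      \<longlonglongrightarrow> ?n * (c * mass\<^sup>2 / 2 - mass)"
    by (simp add: algebra_simps)
qed

end

section \<open>Decay on average\<close>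

lemma abs_ln_le:
  fixes s :: real
  assumes "s \<ge> 0"
  shows "\<bar>ln s\<bar> \<le> s + 1 / s"
proof (cases "s = 0")
  case False
  then have s: "s > 0" using assms by simp
  have "ln s \<le> s - 1" using s by (rule ln_le_minus_one)
  moreover have "ln (1 / s) \<le> 1 / s - 1" using s by (intro ln_le_minus_one) simp
  moreover have "1 / s > 0" using s by simp
  moreover have "ln (1 / s) = - ln s" using s by (simp add: ln_div)
  ultimately show ?thesis using s by linarith
qed simp

text \<open>Jensen's inequality, from \<open>e\<^sup>s \<ge> e\<^sup>m (1 + s - m)\<close>.\<close>

lemma exp_average_le:
  fixes w :: "'a::euclidean_space \<Rightarrow> real"
  assumes B: "B \<in> sets borel" "emeasure lborel B < \<infinity>" and V: "measure lborel B > 0"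
    and i: "integrable lborel (\<lambda>x. indicator B x * w x)"
    and ie: "integrable lborel (\<lambda>x. indicator B x * exp (w x))"
  shows "measure lborel B * exp ((LINT x|lborel. indicator B x * w x) / measure lborel B)
    \<le> (LINT x|lborel. indicator B x * exp (w x))"
proof -
  define m where "m = (LINT x|lborel. indicator B x * w x) / measure lborel B"
  have ind: "integrable lborel (indicator B :: 'a \<Rightarrow> real)"
    using B by (intro integrable_real_indicator) auto
  have "measure lborel B * exp m = (LINT x|lborel. exp m * ((1 - m) * indicator B x + indicator B x * w x))"
  proof -
    have "(LINT x|lborel. exp m * ((1 - m) * indicator B x + indicator B x * w x))
      = exp m * ((1 - m) * measure lborel B + (LINT x|lborel. indicator B x * w x))"
      using ind i B by simp
    also have "(LINT x|lborel. indicator B x * w x) = m * measure lborel B" using V by (simp add: m_def)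
    finally show ?thesis by (simp add: algebra_simps)
  qed
  also have "\<dots> \<le> (LINT x|lborel. indicator B x * exp (w x))"
  proof (rule integral_mono[OF _ ie])
    show "integrable lborel (\<lambda>x. exp m * ((1 - m) * indicator B x + indicator B x * w x))"
      by (intro integrable_mult_right Bochner_Integration.integrable_add ind i)
    fix x
    have "exp m * (1 + (w x - m)) \<le> exp m * exp (w x - m)"
      by (intro mult_left_mono exp_ge_add_one_self) auto
    also have "\<dots> = exp (w x)" by (simp flip: exp_add)
    finally show "exp m * ((1 - m) * indicator B x + indicator B x * w x) \<le> indicator B x * exp (w x)"
      by (simp add: indicator_def algebra_simps)
  qed
  finally show ?thesis unfolding m_def .
qed

lemma abs_ln_le_ln2:
  fixes a b :: real
  assumes "b \<le> 2 * a" "a / 2 \<le> b" "0 < b"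
  shows "\<bar>ln (a / b)\<bar> \<le> ln 2"
proof -
  define s where "s = a / b"
  have s: "1 / 2 \<le> s" "s \<le> 2" using assms by (simp_all add: s_def field_simps)
  have "ln s \<le> ln 2" using s by simp
  moreover have "ln (1 / 2) \<le> ln s" using s by (subst ln_le_cancel_iff) auto
  ultimately show ?thesis unfolding s_def[symmetric] by (simp add: ln_div)
qed

context log_potential
begin

text \<open>Fubini's theorem turns the integral of \<open>u\<close> over the scaled ball into a
  \<open>y\<close>-integral of averaged kernels \<open>av j y\<close>. Divided by
  \<open>Suc j\<close>, the logarithm of the scale, these tend to \<open>- V\<close> for every
  \<open>y \<noteq> 0\<close>, and they are dominated by a constant plus
  \<open>V / norm y\<close>.\<close>

lemma u_ball_average_limit:
  fixes \<omega> :: 'a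
  assumes \<delta>: "\<delta> > 0"
  defines "V \<equiv> measure lborel (ball \<omega> \<delta>)"
  shows "(\<lambda>j. (LINT \<xi>|lborel. indicator (ball \<omega> \<delta>) \<xi> * u (exp (real (Suc j)) *\<^sub>R \<xi>)) / real (Suc j))
    \<longlonglongrightarrow> - (c * mass * V)"
proof -
  let ?B = "ball \<omega> \<delta>"
  let ?I = "indicator ?B :: 'a \<Rightarrow> real"
  let ?t = "\<lambda>j. exp (real (Suc j))"
  define R where "R = norm \<omega> + \<delta>"
  have R: "R > 0" using \<delta> by (simp add: R_def add_nonneg_pos)
  have BR: "norm \<xi> \<le> R" if "\<xi> \<in> ?B" for \<xi>
    using that norm_triangle_sub[of \<xi> \<omega>] by (simp add: R_def dist_norm norm_minus_commute)
  have V: "V \<ge> 0" by (simp add: V_def)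
  have emB: "emeasure lborel ?B < \<infinity>" by (rule emeasure_bounded_finite) simp
  have ind: "integrable lborel ?I" using emB by (intro integrable_real_indicator) simp_all
  have indV: "(LINT \<xi>|lborel. ?I \<xi>) = V" by (simp add: V_def)
  define C1 where "C1 = 3 * R * V + (inv_mass TYPE('a) + V)"
  \<comment> \<open>\<open>L\<close> is the logarithmic integral over the fixed ball that remains
    once the scale is factored out of the kernel; it is bounded by \<open>C1\<close> as long as
    \<open>norm z \<le> 2 R\<close>.\<close>
  define L where "L z = (LINT \<xi>|lborel. ?I \<xi> * ln (norm (\<xi> - z)))" for z
  have Lint: "integrable lborel (\<lambda>\<xi>. ?I \<xi> * ln (norm (\<xi> - z)))"
    and Lb: "norm z \<le> 2 * R \<Longrightarrow> \<bar>L z\<bar> \<le> C1" for z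
  proof -
    have inv: "integrable lborel (\<lambda>\<xi>. ?I \<xi> / norm (z - \<xi>))"
      "(LINT \<xi>|lborel. \<bar>?I \<xi>\<bar> / norm (z - \<xi>)) \<le> 1 * inv_mass TYPE('a) + (LINT \<xi>|lborel. \<bar>?I \<xi>\<bar>)"
      by (rule inverse_dist_integrable[OF dim ind, of z 1], simp add: indicator_def)+
    have b: "norm (?I \<xi> * ln (norm (\<xi> - z))) \<le> (R + norm z) * ?I \<xi> + ?I \<xi> / norm (z - \<xi>)" for \<xi>
    proof (cases "\<xi> \<in> ?B")
      case True
      have "\<bar>ln (norm (\<xi> - z))\<bar> \<le> norm (\<xi> - z) + 1 / norm (\<xi> - z)" by (rule abs_ln_le) simp
      moreover have "norm (\<xi> - z) \<le> R + norm z" using BR[OF True] norm_triangle_ineq4[of \<xi> z] by simp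
      ultimately show ?thesis using True by (simp add: norm_minus_commute)
    qed simp
    have bi: "integrable lborel (\<lambda>\<xi>. (R + norm z) * ?I \<xi> + ?I \<xi> / norm (z - \<xi>))"
      by (intro Bochner_Integration.integrable_add integrable_mult_right ind inv(1))
    show i: "integrable lborel (\<lambda>\<xi>. ?I \<xi> * ln (norm (\<xi> - z)))"
    proof (rule Bochner_Integration.integrable_bound[OF bi])
      show "AE \<xi> in lborel. norm (?I \<xi> * ln (norm (\<xi> - z))) \<le> norm ((R + norm z) * ?I \<xi> + ?I \<xi> / norm (z - \<xi>))"
        by (intro AE_I2 order_trans[OF b]) simp
    qed measurable
    assume z: "norm z \<le> 2 * R"
    have "\<bar>L z\<bar> \<le> (LINT \<xi>|lborel. norm (?I \<xi> * ln (norm (\<xi> - z))))"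
      unfolding L_def real_norm_def[symmetric] by (rule integral_norm_bound)
    also have "\<dots> \<le> (LINT \<xi>|lborel. (R + norm z) * ?I \<xi> + ?I \<xi> / norm (z - \<xi>))"
      by (rule integral_mono[OF integrable_norm[OF i] bi b])
    also have "\<dots> = (R + norm z) * V + (LINT \<xi>|lborel. ?I \<xi> / norm (z - \<xi>))"
      using Bochner_Integration.integral_add[OF integrable_mult_right[OF ind, of "R + norm z"] inv(1)] indV
      by (simp only: integral_mult_right_zero)
    also have "\<dots> \<le> 3 * R * V + (inv_mass TYPE('a) + V)"
      using inv(2) indV z V by (intro add_mono mult_right_mono) (auto simp: abs_indicator)
    finally show "\<bar>L z\<bar> \<le> C1" unfolding C1_def .
  qed
  have C1: "C1 \<ge> 0" using Lb[of 0] R by force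
  define av where "av j y = (LINT \<xi>|lborel. ?I \<xi> * ln (norm y / norm (?t j *\<^sub>R \<xi> - y)))" for j y
  have [measurable]: "av j \<in> borel_measurable borel" for j unfolding av_def by measurable
  have scale: "av j y = V * (ln (norm y) - real (Suc j)) - L (y /\<^sub>R ?t j)" if y: "y \<noteq> 0" for j y
  proof -
    have "av j y = (LINT \<xi>|lborel. (ln (norm y) - real (Suc j)) * ?I \<xi> - ?I \<xi> * ln (norm (\<xi> - y /\<^sub>R ?t j)))"
      unfolding av_def
    proof (rule integral_cong_AE)
      show "AE \<xi> in lborel. ?I \<xi> * ln (norm y / norm (?t j *\<^sub>R \<xi> - y))
        = (ln (norm y) - real (Suc j)) * ?I \<xi> - ?I \<xi> * ln (norm (\<xi> - y /\<^sub>R ?t j))"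
        using AE_lborel_neq[of "y /\<^sub>R ?t j"]
      proof eventually_elim
        case (elim \<xi>)
        have "?t j *\<^sub>R \<xi> - y = ?t j *\<^sub>R (\<xi> - y /\<^sub>R ?t j)" by (simp add: scaleR_diff_right)
        then have "norm (?t j *\<^sub>R \<xi> - y) = ?t j * norm (\<xi> - y /\<^sub>R ?t j)" by simp
        then have "ln (norm y / norm (?t j *\<^sub>R \<xi> - y)) = ln (norm y) - (real (Suc j) + ln (norm (\<xi> - y /\<^sub>R ?t j)))"
          using elim y by (simp add: ln_div ln_mult del: of_nat_Suc)
        then show ?case by (simp only:) (simp add: algebra_simps)
      qed
    qed measurable
    also have "\<dots> = (ln (norm y) - real (Suc j)) * V - L (y /\<^sub>R ?t j)"
      using Bochner_Integration.integral_diff[OF integrable_mult_right[OF ind] Lint] indV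
      unfolding L_def by (simp only: integral_mult_right_zero)
    finally show ?thesis by (simp add: mult.commute)
  qed
  define D where "D = V * (\<bar>ln (2 * R)\<bar> + 3) + C1"
  have av_bound: "\<bar>av j y / real (Suc j)\<bar> \<le> D + V / norm y" if y: "y \<noteq> 0" for j y
  proof -
    have "\<bar>av j y\<bar> \<le> real (Suc j) * (D + V / norm y)"
    \<comment> \<open>If \<open>y\<close> is far from the scaled ball, the ratio in the kernel lies
      between \<open>1/2\<close> and 2. Otherwise \<open>y\<close> scaled back is in the range where
      \<open>L\<close> is bounded, and the scaling formula applies; the term
      \<open>1 / norm y\<close> takes care of the logarithm of a small
      \<open>norm y\<close>.\<close>
    proof (cases "norm y \<ge> 2 * R * ?t j")
      case True
      have "\<bar>av j y\<bar> \<le> (LINT \<xi>|lborel. ln 2 * ?I \<xi>)"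
        unfolding av_def real_norm_def[symmetric]
      proof (rule Bochner_Integration.integral_norm_bound_integral)
        have "norm (?I \<xi> * ln (norm y / norm (?t j *\<^sub>R \<xi> - y))) \<le> ln 2 * ?I \<xi>" for \<xi>
        proof (cases "\<xi> \<in> ?B")
          case B: True
          have "norm (?t j *\<^sub>R \<xi>) \<le> ?t j * R" using BR[OF B] by (simp add: mult_left_mono)
          moreover have "2 * (?t j * R) \<le> norm y" using True by (simp only: mult_ac)
          ultimately have s: "norm (?t j *\<^sub>R \<xi>) \<le> norm y / 2" by linarith
          have "norm (?t j *\<^sub>R \<xi> - y) \<le> 2 * norm y"
            using norm_triangle_ineq4[of "?t j *\<^sub>R \<xi>" y] s norm_ge_zero[of y] by linarith
          moreover have "norm y / 2 \<le> norm (?t j *\<^sub>R \<xi> - y)"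
            using norm_triangle_ineq2[of y "?t j *\<^sub>R \<xi>"] s norm_minus_commute[of y "?t j *\<^sub>R \<xi>"] by linarith
          moreover have "norm (?t j *\<^sub>R \<xi> - y) > 0" using calculation y zero_less_norm_iff[of y] by linarith
          ultimately have "\<bar>ln (norm y / norm (?t j *\<^sub>R \<xi> - y))\<bar> \<le> ln 2"
            by (intro abs_ln_le_ln2)
          then show ?thesis using B by simp
        qed simp
        note bd = this
        show "integrable lborel (\<lambda>\<xi>. ln 2 * ?I \<xi>)" by (intro integrable_mult_right ind)
        then show "integrable lborel (\<lambda>\<xi>. ?I \<xi> * ln (norm y / norm (?t j *\<^sub>R \<xi> - y)))"
        proof (rule Bochner_Integration.integrable_bound)
          show "AE \<xi> in lborel. norm (?I \<xi> * ln (norm y / norm (?t j *\<^sub>R \<xi> - y))) \<le> norm (ln 2 * ?I \<xi>)"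
            by (intro AE_I2 order_trans[OF bd]) simp
        qed measurable
        show "norm (?I \<xi> * ln (norm y / norm (?t j *\<^sub>R \<xi> - y))) \<le> ln 2 * ?I \<xi>" for \<xi> by (rule bd)
      qed
      also have "\<dots> = ln 2 * V" using indV by simp
      also have "\<dots> \<le> 1 * V" using V ln_le_minus_one[of "2::real"] by (intro mult_right_mono) auto
      also have "\<dots> \<le> 1 * (D + V / norm y)"
      proof -
        have a: "V * 1 \<le> V * (\<bar>ln (2 * R)\<bar> + 3)" using V by (intro mult_left_mono) auto
        have b: "V / norm y \<ge> 0" using V by simp
        show ?thesis
          using add_mono[OF add_mono[OF a C1] b] unfolding D_def by (simp only: mult_1 mult_1_right add_0_right)
      qed
      also have "\<dots> \<le> real (Suc j) * (D + V / norm y)"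
        using V C1 by (intro mult_right_mono) (auto simp: D_def intro!: add_nonneg_nonneg mult_nonneg_nonneg)
      finally show ?thesis .
    next
      case False
      have "norm (y /\<^sub>R ?t j) \<le> 2 * R" using False by (simp add: pos_divide_le_eq divide_inverse_commute[symmetric])
      note Lb = Lb[OF this]
      have J: "real (Suc j) \<ge> 1" by simp
      have lny: "\<bar>ln (norm y)\<bar> \<le> real (Suc j) * (\<bar>ln (2 * R)\<bar> + 1 + 1 / norm y)"
      proof (cases "norm y \<ge> 1")
        case True
        have "ln (norm y) \<le> ln (2 * R * ?t j)" using False y R by (subst ln_le_cancel_iff) auto
        also have "\<dots> = ln (2 * R) + real (Suc j)" using R by (simp add: ln_mult)
        also have "\<dots> \<le> \<bar>ln (2 * R)\<bar> * real (Suc j) + real (Suc j)"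
          using J mult_left_mono[OF J, of "\<bar>ln (2 * R)\<bar>"] by linarith
        also have "\<dots> \<le> \<bar>ln (2 * R)\<bar> * real (Suc j) + real (Suc j) + real (Suc j) * (1 / norm y)" by simp
        finally show ?thesis using True by (simp add: algebra_simps)
      next
        case less: False
        have "- ln (norm y) = ln (1 / norm y)" using y by (simp add: ln_div)
        also have "\<dots> \<le> 1 / norm y - 1" using y by (intro ln_le_minus_one) auto
        also have "\<dots> \<le> 1 * (\<bar>ln (2 * R)\<bar> + 1 + 1 / norm y)" by simp
        also have "\<dots> \<le> real (Suc j) * (\<bar>ln (2 * R)\<bar> + 1 + 1 / norm y)"
          using J by (intro mult_right_mono) (auto intro!: add_nonneg_nonneg)
        finally show ?thesis using less y by simp
      qed
      have "\<bar>av j y\<bar> \<le> V * (\<bar>ln (norm y)\<bar> + real (Suc j)) + C1"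
      proof -
        have "\<bar>V * (ln (norm y) - real (Suc j))\<bar> \<le> V * (\<bar>ln (norm y)\<bar> + real (Suc j))"
          using V by (simp only: abs_mult) (intro mult_mono, auto)
        then show ?thesis unfolding scale[OF y] using Lb by linarith
      qed
      also have "\<dots> \<le> V * (real (Suc j) * (\<bar>ln (2 * R)\<bar> + 1 + 1 / norm y) + real (Suc j)) + real (Suc j) * C1"
        using lny V C1 mult_right_mono[OF J C1] by (intro add_mono mult_left_mono) auto
      also have "\<dots> = real (Suc j) * (V * (\<bar>ln (2 * R)\<bar> + 2) + C1 + V / norm y)" by (simp add: algebra_simps)
      also have "\<dots> \<le> real (Suc j) * (D + V / norm y)"
        using V by (intro mult_left_mono) (auto simp: D_def intro!: mult_left_mono)
      finally show ?thesis .
    qed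
    then show ?thesis by (simp add: abs_divide pos_divide_le_eq mult.commute)
  qed
  have av_lim: "(\<lambda>j. av j y / real (Suc j)) \<longlonglongrightarrow> - V" if y: "y \<noteq> 0" for y
  proof -
    have inv: "(\<lambda>j. inverse (real (Suc j))) \<longlonglongrightarrow> 0" by (rule LIMSEQ_inverse_real_of_nat)
    have "(\<lambda>j. V * (ln (norm y) * inverse (real (Suc j)) - 1) - L (y /\<^sub>R ?t j) * inverse (real (Suc j)))
      \<longlonglongrightarrow> V * (ln (norm y) * 0 - 1) - 0"
    proof (intro tendsto_intros inv)
      show "(\<lambda>j. L (y /\<^sub>R ?t j) * inverse (real (Suc j))) \<longlonglongrightarrow> 0"
      proof (rule Lim_null_comparison)
        have "(\<lambda>j. norm y * inverse (real (Suc j))) \<longlonglongrightarrow> norm y * 0" by (intro tendsto_intros inv)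
        then have "\<forall>\<^sub>F j in sequentially. norm y * inverse (real (Suc j)) < 2 * R"
          using R by (intro order_tendstoD(2)) auto
        then show "\<forall>\<^sub>F j in sequentially. norm (L (y /\<^sub>R ?t j) * inverse (real (Suc j))) \<le> C1 * inverse (real (Suc j))"
        proof eventually_elim
          case (elim j)
          have "inverse (?t j) \<le> inverse (real (Suc j))"
            using exp_ge_add_one_self[of "real (Suc j)"] by (intro le_imp_inverse_le) auto
          then have "norm y * inverse (?t j) \<le> norm y * inverse (real (Suc j))" by (intro mult_left_mono) auto
          then have "norm (y /\<^sub>R ?t j) \<le> 2 * R" using elim by (simp add: mult.commute)
          then show ?case using Lb by (auto simp: abs_mult intro!: mult_right_mono)
        qed
        show "(\<lambda>j. C1 * inverse (real (Suc j))) \<longlonglongrightarrow> 0"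
          using tendsto_mult_left[OF inv, of C1] by simp
      qed
    qed
    moreover have "V * (ln (norm y) * inverse (real (Suc j)) - 1) - L (y /\<^sub>R ?t j) * inverse (real (Suc j)) = av j y / real (Suc j)" for j
      unfolding scale[OF y] by (simp add: field_simps del: of_nat_Suc)
    ultimately show ?thesis by simp
  qed
  have dct: "(\<lambda>j. LINT y|lborel. f y * (av j y / real (Suc j))) \<longlonglongrightarrow> (LINT y|lborel. f y * (- V))"
  proof (rule integral_dominated_convergence)
    show "integrable lborel (\<lambda>y. D * \<bar>f y\<bar> + V * (\<bar>f y\<bar> / norm (0 - y)))"
      by (intro Bochner_Integration.integrable_add integrable_mult_right integrable_abs f_int inverse_dist_int)
    show "AE y in lborel. (\<lambda>j. f y * (av j y / real (Suc j))) \<longlonglongrightarrow> f y * (- V)"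
      using AE_lborel_neq[of 0] by eventually_elim (intro tendsto_intros av_lim)
    show "AE y in lborel. norm (f y * (av j y / real (Suc j))) \<le> D * \<bar>f y\<bar> + V * (\<bar>f y\<bar> / norm (0 - y))" for j
      using AE_lborel_neq[of 0]
    proof eventually_elim
      case (elim y)
      have "\<bar>f y\<bar> * \<bar>av j y / real (Suc j)\<bar> \<le> \<bar>f y\<bar> * (D + V / norm y)"
        by (intro mult_left_mono av_bound elim) auto
      then show ?case by (simp add: abs_mult algebra_simps)
    qed
  qed measurable
  \<comment> \<open>On the ball the kernel is bounded by \<open>t R\<close> times a sum of two
    inverse distances, by \<open>abs_ln_ratio_le\<close>, so the double integral converges
    absolutely and the order may be exchanged.\<close>
  have avg: "(LINT \<xi>|lborel. ?I \<xi> * u (?t j *\<^sub>R \<xi>)) = c * (LINT y|lborel. f y * av j y) + C * V" for j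
  proof -
    let ?F = "\<lambda>(\<xi>, y). ?I \<xi> * (ln (norm y / norm (?t j *\<^sub>R \<xi> - y)) * f y)"
    have Fm: "?F \<in> borel_measurable (lborel \<Otimes>\<^sub>M lborel)" by measurable
    obtain M where M: "\<And>z. norm z \<le> ?t j * R \<Longrightarrow> (LINT y|lborel. \<bar>f y\<bar> / norm (z - y)) \<le> M"
      using inverse_dist_bound by blast
    have N0: "(LINT y|lborel. \<bar>f y\<bar> / norm (0 - y)) \<le> M" using M[of 0] R by simp
    have "0 \<le> (LINT y|lborel. \<bar>f y\<bar> / norm (0 - y))" by (intro integral_nonneg_AE) auto
    then have M0: "M \<ge> 0" using N0 by linarith
    have Fi: "integrable (lborel \<Otimes>\<^sub>M lborel) ?F"
    proof (rule lborel_pair.Fubini_integrable[OF Fm])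
      have i: "integrable lborel (\<lambda>y. ?F (\<xi>, y))" for \<xi>
        using integrable_mult_right[OF log_potential_integrable[OF dim f_int f_cont, of "?t j *\<^sub>R \<xi>"], of "?I \<xi>"]
        by simp
      then show "AE \<xi> in lborel. integrable lborel (\<lambda>y. ?F (\<xi>, y))" by simp
      show "integrable lborel (\<lambda>\<xi>. LINT y|lborel. norm (?F (\<xi>, y)))"
      proof (rule Bochner_Integration.integrable_bound)
        show "integrable lborel (\<lambda>\<xi>. ?t j * R * (2 * M) * ?I \<xi>)" by (intro integrable_mult_right ind)
        show "(\<lambda>\<xi>. LINT y|lborel. norm (?F (\<xi>, y))) \<in> borel_measurable lborel" using Fm by measurable
        show "AE \<xi> in lborel. norm (LINT y|lborel. norm (?F (\<xi>, y))) \<le> norm (?t j * R * (2 * M) * ?I \<xi>)"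
        proof (rule AE_I2)
          fix \<xi>
          show "norm (LINT y|lborel. norm (?F (\<xi>, y))) \<le> norm (?t j * R * (2 * M) * ?I \<xi>)"
          proof (cases "\<xi> \<in> ?B")
            case True
            let ?x = "?t j *\<^sub>R \<xi>"
            have x: "norm ?x \<le> ?t j * R" using BR[OF True] by (simp add: mult_left_mono)
            have "(LINT y|lborel. norm (?F (\<xi>, y))) \<le> (LINT y|lborel. (?t j * R) * (\<bar>f y\<bar> / norm (0 - y) + \<bar>f y\<bar> / norm (?x - y)))"
            proof (rule integral_mono)
              show "integrable lborel (\<lambda>y. norm (?F (\<xi>, y)))" using i by (rule integrable_norm)
              show "integrable lborel (\<lambda>y. (?t j * R) * (\<bar>f y\<bar> / norm (0 - y) + \<bar>f y\<bar> / norm (?x - y)))"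
                by (intro integrable_mult_right Bochner_Integration.integrable_add inverse_dist_int)
              fix y
              have "\<bar>ln (norm y / norm (?x - y))\<bar> * \<bar>f y\<bar> \<le> (norm ?x * (1 / norm y + 1 / norm (?x - y))) * \<bar>f y\<bar>"
                by (intro mult_right_mono abs_ln_ratio_le) auto
              also have "\<dots> \<le> (?t j * R * (1 / norm y + 1 / norm (?x - y))) * \<bar>f y\<bar>"
                using x by (intro mult_right_mono) auto
              also have "\<dots> = (?t j * R) * (\<bar>f y\<bar> / norm (0 - y) + \<bar>f y\<bar> / norm (?x - y))"
                by (simp add: algebra_simps)
              finally show "norm (?F (\<xi>, y)) \<le> (?t j * R) * (\<bar>f y\<bar> / norm (0 - y) + \<bar>f y\<bar> / norm (?x - y))"
                using True by (simp add: abs_mult)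
            qed
            also have "\<dots> = (?t j * R) * ((LINT y|lborel. \<bar>f y\<bar> / norm (0 - y)) + (LINT y|lborel. \<bar>f y\<bar> / norm (?x - y)))"
              by (subst integral_mult_right_zero, subst Bochner_Integration.integral_add[OF inverse_dist_int inverse_dist_int]) simp
            also have "\<dots> \<le> (?t j * R) * (2 * M)"
              using M[OF x] N0 R by (intro mult_left_mono) auto
            finally have "(LINT y|lborel. norm (?F (\<xi>, y))) \<le> (?t j * R) * (2 * M)" .
            moreover have "0 \<le> (LINT y|lborel. norm (?F (\<xi>, y)))" by (intro integral_nonneg_AE) auto
            ultimately show ?thesis using True M0 R by (simp add: abs_mult)
          qed simp
        qed
      qed
    qed
    have Fs: "integrable lborel (\<lambda>\<xi>. LINT y|lborel. ?F (\<xi>, y))"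
      using lborel_pair.integrable_fst'[OF Fi] by simp
    have ex: "?I \<xi> * u (?t j *\<^sub>R \<xi>) = c * (LINT y|lborel. ?F (\<xi>, y)) + C * ?I \<xi>" for \<xi>
      unfolding u_eq prod.case integral_mult_right_zero by (simp only: algebra_simps)
    have "(LINT \<xi>|lborel. ?I \<xi> * u (?t j *\<^sub>R \<xi>)) = c * (LINT \<xi>|lborel. LINT y|lborel. ?F (\<xi>, y)) + C * V"
      unfolding ex using Bochner_Integration.integral_add[OF integrable_mult_right[OF Fs, of c] integrable_mult_right[OF ind, of C]] indV
      by (simp only: integral_mult_right_zero)
    also have "(LINT \<xi>|lborel. LINT y|lborel. ?F (\<xi>, y)) = (LINT y|lborel. LINT \<xi>|lborel. ?F (\<xi>, y))"
      using lborel_pair.Fubini_integral[of "\<lambda>\<xi> y. ?F (\<xi>, y)"] Fi by simp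
    also have "\<dots> = (LINT y|lborel. f y * av j y)"
      unfolding av_def by (simp add: mult_ac flip: integral_mult_right_zero)
    finally show ?thesis .
  qed
  have inv: "(\<lambda>j. inverse (real (Suc j))) \<longlonglongrightarrow> 0" by (rule LIMSEQ_inverse_real_of_nat)
  have "(\<lambda>j. c * (LINT y|lborel. f y * (av j y / real (Suc j))) + C * V * inverse (real (Suc j)))
    \<longlonglongrightarrow> c * (LINT y|lborel. f y * (- V)) + C * V * 0"
    by (intro tendsto_intros dct inv)
  moreover have "c * (LINT y|lborel. f y * (av j y / real (Suc j))) + C * V * inverse (real (Suc j))
    = (LINT \<xi>|lborel. ?I \<xi> * u (?t j *\<^sub>R \<xi>)) / real (Suc j)" for j
  proof -
    have "(LINT y|lborel. f y * (av j y / real (Suc j))) = (LINT y|lborel. f y * av j y) / real (Suc j)"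
      by (simp flip: integral_divide_zero)
    then show ?thesis unfolding avg by (simp add: add_divide_distrib divide_inverse algebra_simps)
  qed
  ultimately show ?thesis by (simp add: mult_ac)
qed

text \<open>Jensen's inequality bounds the integral of \<open>|P| e^{nu}\<close> over the scaled
  ball below by a constant times \<open>t^(n + d)\<close> times \<open>exp\<close> of
  \<open>n\<close> times the average of \<open>u\<close>, that is
  \<open>t^(n + d - n c mass + o(1))\<close>. Finiteness of the integral forces a nonpositive
  exponent. \<open>P\<close> is left free so that both the polynomial and the constant 1 can be
  inserted.\<close>

theorem mass_lower_bound:
  fixes P :: "'a \<Rightarrow> real" and \<omega> :: 'a
  assumes uc: "continuous_on UNIV u" and Pc: "continuous_on UNIV P"
    and Pi: "integrable lborel (\<lambda>x. P x * exp (real DIM('a) * u x))"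
    and \<delta>: "\<delta> > 0" and \<kappa>: "\<kappa> > 0"
    and growth: "\<And>\<xi> t. \<xi> \<in> ball \<omega> \<delta> \<Longrightarrow> t \<ge> t0 \<Longrightarrow> \<kappa> * t ^ d \<le> \<bar>P (t *\<^sub>R \<xi>)\<bar>"
  shows "real DIM('a) + real d \<le> real DIM('a) * (c * mass)"
proof -
  let ?n = "real DIM('a)"
  let ?B = "ball \<omega> \<delta>"
  let ?I = "indicator ?B :: 'a \<Rightarrow> real"
  let ?t = "\<lambda>j. exp (real (Suc j))"
  define V where "V = measure lborel ?B"
  have V: "V > 0" using \<delta> unfolding V_def by (simp add: content_ball)
  have emB: "emeasure lborel ?B < \<infinity>" by (rule emeasure_bounded_finite) simp
  have [measurable]: "u \<in> borel_measurable borel" "P \<in> borel_measurable borel"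
    using uc Pc by (auto intro: borel_measurable_continuous_onI)
  define A where "A j = (LINT \<xi>|lborel. ?I \<xi> * u (?t j *\<^sub>R \<xi>))" for j
  define M where "M = (LINT x|lborel. \<bar>P x * exp (?n * u x)\<bar>)"
  have lim: "(\<lambda>j. A j / real (Suc j)) \<longlonglongrightarrow> - (c * mass * V)"
    unfolding A_def V_def by (rule u_ball_average_limit[OF \<delta>])
  have ci: "integrable lborel (\<lambda>\<xi>. ?I \<xi> * g \<xi>)" if gc: "continuous_on UNIV g" for g :: "'a \<Rightarrow> real"
  proof -
    have [measurable]: "g \<in> borel_measurable borel" using gc by (rule borel_measurable_continuous_onI)
    obtain K where K: "\<And>y. norm y \<le> norm \<omega> + \<delta> \<Longrightarrow> \<bar>g y\<bar> \<le> K"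
      using continuous_bounded_on_cball[OF gc] by blast
    have ind: "integrable lborel ?I" using emB by (intro integrable_real_indicator) simp_all
    show ?thesis
    proof (rule Bochner_Integration.integrable_bound[OF integrable_mult_right[OF ind, of K]])
      have "norm (?I \<xi> * g \<xi>) \<le> norm (K * ?I \<xi>)" for \<xi>
      proof (cases "\<xi> \<in> ?B")
        case True
        then have "norm \<xi> \<le> norm \<omega> + \<delta>"
          using norm_triangle_sub[of \<xi> \<omega>] by (simp add: dist_norm norm_minus_commute)
        then show ?thesis using K[of \<xi>] True by simp
      qed simp
      then show "AE \<xi> in lborel. norm (?I \<xi> * g \<xi>) \<le> norm (K * ?I \<xi>)" by simp
    qed measurable
  qed
  have uct: "continuous_on UNIV (\<lambda>\<xi>. u (s *\<^sub>R \<xi>))" for s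
    by (intro continuous_on_compose2[OF uc] continuous_intros) auto
  have main: "\<kappa> * ?t j ^ d * (V * exp (?n * A j / V)) \<le> M / ?t j ^ DIM('a)" if j: "?t j \<ge> t0" for j
  proof -
    have i1: "integrable lborel (\<lambda>\<xi>. ?I \<xi> * (?n * u (?t j *\<^sub>R \<xi>)))"
      by (intro ci continuous_intros uct)
    have i2: "integrable lborel (\<lambda>\<xi>. ?I \<xi> * exp (?n * u (?t j *\<^sub>R \<xi>)))"
      by (intro ci continuous_intros uct)
    have "(LINT \<xi>|lborel. ?I \<xi> * (?n * u (?t j *\<^sub>R \<xi>))) = ?n * A j"
      unfolding A_def by (simp add: mult_ac flip: integral_mult_right_zero)
    then have J: "V * exp (?n * A j / V) \<le> (LINT \<xi>|lborel. ?I \<xi> * exp (?n * u (?t j *\<^sub>R \<xi>)))"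
      using exp_average_le[OF _ emB _ i1 i2] V unfolding V_def by simp
    have Ps: "integrable lborel (\<lambda>\<xi>. \<bar>P (?t j *\<^sub>R \<xi>) * exp (?n * u (?t j *\<^sub>R \<xi>))\<bar>)"
      using lborel_scale_integrable[OF integrable_abs[OF Pi], of "?t j" 0] by simp
    have "\<kappa> * ?t j ^ d * (V * exp (?n * A j / V)) \<le> \<kappa> * ?t j ^ d * (LINT \<xi>|lborel. ?I \<xi> * exp (?n * u (?t j *\<^sub>R \<xi>)))"
      using J \<kappa> by (intro mult_left_mono) auto
    also have "\<dots> = (LINT \<xi>|lborel. \<kappa> * ?t j ^ d * (?I \<xi> * exp (?n * u (?t j *\<^sub>R \<xi>))))"
      by (simp only: integral_mult_right_zero)
    also have "\<dots> \<le> (LINT \<xi>|lborel. \<bar>P (?t j *\<^sub>R \<xi>) * exp (?n * u (?t j *\<^sub>R \<xi>))\<bar>)"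
    proof (rule integral_mono[OF integrable_mult_right[OF i2] Ps])
      fix \<xi>
      show "\<kappa> * ?t j ^ d * (?I \<xi> * exp (?n * u (?t j *\<^sub>R \<xi>))) \<le> \<bar>P (?t j *\<^sub>R \<xi>) * exp (?n * u (?t j *\<^sub>R \<xi>))\<bar>"
      proof (cases "\<xi> \<in> ?B")
        case True
        then show ?thesis using mult_right_mono[OF growth[OF True j], of "exp (?n * u (?t j *\<^sub>R \<xi>))"]
          by (simp add: abs_mult)
      qed simp
    qed
    also have "\<dots> = M / ?t j ^ DIM('a)"
      using lborel_scale_integral[of "\<lambda>x. \<bar>P x * exp (?n * u x)\<bar>" "?t j" 0] unfolding M_def by simp
    finally show ?thesis .
  qed
  have t0: "\<forall>\<^sub>F j in sequentially. ?t j \<ge> t0"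
  proof -
    obtain N where N: "real N \<ge> t0" using real_arch_simple by blast
    have "?t j \<ge> t0" if "j \<ge> N" for j
      using exp_ge_add_one_self[of "real (Suc j)"] N that by linarith
    then show ?thesis by (auto simp: eventually_sequentially)
  qed
  \<comment> \<open>Logarithms are taken in \<open>main\<close> and divided by
    \<open>ln t = Suc j\<close>. Using \<open>M + 1\<close> for \<open>M\<close> keeps the
    denominator positive even when \<open>M = 0\<close>.\<close>
  have ev: "\<forall>\<^sub>F j in sequentially. ?n + real d + ln (\<kappa> * V / (M + 1)) * inverse (real (Suc j)) + ?n / V * (A j / real (Suc j)) \<le> 0"
    using t0
  proof eventually_elim
    case (elim j)
    let ?x = "real (Suc j)"
    have M: "M \<ge> 0" unfolding M_def by (intro integral_nonneg_AE) auto
    have "\<kappa> * ?t j ^ d * (V * exp (?n * A j / V)) * ?t j ^ DIM('a) \<le> M"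
      using main[OF elim] by (simp add: pos_le_divide_eq)
    also have "\<dots> \<le> M + 1" by simp
    finally have "\<kappa> * V / (M + 1) * exp (real d * ?x + ?n * A j / V + ?n * ?x) \<le> 1"
      using M by (simp add: exp_add exp_of_nat_mult pos_divide_le_eq mult_ac del: of_nat_Suc)
    then have l0: "ln (\<kappa> * V / (M + 1) * exp (real d * ?x + ?n * A j / V + ?n * ?x)) \<le> 0"
      using M \<kappa> V by (subst ln_le_zero_iff) auto
    have "ln (\<kappa> * V / (M + 1)) + (real d * ?x + ?n * A j / V + ?n * ?x) \<le> 0"
    proof -
      have "ln (K * exp E) = ln K + E" if "K > 0" for K E :: real using that by (simp add: ln_mult)
      moreover have "\<kappa> * V / (M + 1) > 0" using M \<kappa> V by simp
      ultimately show ?thesis using l0 by metis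
    qed
    then have "(ln (\<kappa> * V / (M + 1)) + (real d * ?x + ?n * A j / V + ?n * ?x)) * inverse ?x \<le> 0"
      by (intro mult_nonpos_nonneg) auto
    moreover have "(ln (\<kappa> * V / (M + 1)) + (real d * ?x + ?n * A j / V + ?n * ?x)) * inverse ?x
      = ?n + real d + ln (\<kappa> * V / (M + 1)) * inverse ?x + ?n / V * (A j / ?x)"
      using V by (simp add: field_simps del: of_nat_Suc)
    ultimately show ?case by simp
  qed
  have "(\<lambda>j. ?n + real d + ln (\<kappa> * V / (M + 1)) * inverse (real (Suc j)) + ?n / V * (A j / real (Suc j)))
    \<longlonglongrightarrow> ?n + real d + ln (\<kappa> * V / (M + 1)) * 0 + ?n / V * (- (c * mass * V))"
    by (intro tendsto_intros lim LIMSEQ_inverse_real_of_nat)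
  then have "?n + real d + ln (\<kappa> * V / (M + 1)) * 0 + ?n / V * (- (c * mass * V)) \<le> 0"
    using ev by (intro tendsto_upperbound) auto
  then show ?thesis using V by simp
qed

end

section \<open>Polynomials\<close>

definition monomial :: "('n::finite \<Rightarrow>\<^sub>0 nat) \<Rightarrow> real ^ 'n \<Rightarrow> real" where
  "monomial m x = (\<Prod>i\<in>UNIV. (x $ i) ^ Poly_Mapping.lookup m i)"

definition total_degree :: "('n::finite \<Rightarrow>\<^sub>0 nat) \<Rightarrow> nat" where
  "total_degree m = (\<Sum>i\<in>UNIV. Poly_Mapping.lookup m i)"

lemma mpoly_fun_eq: "mpoly_fun p x = (\<Sum>m\<in>Poly_Mapping.keys p. Poly_Mapping.lookup p m * monomial m x)"
  by (simp add: mpoly_fun_def monomial_def)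

lemma total_degree_le: "m \<in> Poly_Mapping.keys p \<Longrightarrow> total_degree m \<le> mpoly_degree p"
  unfolding mpoly_degree_def total_degree_def by (intro Max_ge) auto

lemma monomial_scale: "monomial m (t *\<^sub>R x) = t ^ total_degree m * monomial m x"
  by (simp add: monomial_def total_degree_def power_mult_distrib prod.distrib power_sum)

lemma monomial_continuous: "continuous_on UNIV (monomial m)"
  unfolding monomial_def[abs_def] by (intro continuous_intros)

text \<open>Continuity of the derivative is stated direction by direction, the form in which
  \<open>dilation_identity\<close> and \<open>pohozaev_identity\<close> take it.\<close>

definition C1 :: "(real ^ 'n::finite \<Rightarrow> real) \<Rightarrow> bool" where
  "C1 h \<longleftrightarrow> (\<exists>h'. (\<forall>x. (h has_derivative h' x) (at x)) \<and> (\<forall>v. continuous_on UNIV (\<lambda>x. h' x v)))"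

lemma C1_continuous: "C1 h \<Longrightarrow> continuous_on UNIV h"
  unfolding C1_def by (auto intro!: continuous_at_imp_continuous_on dest: has_derivative_continuous)

lemma C1_const: "C1 (\<lambda>x. k)"
  unfolding C1_def by (intro exI[of _ "\<lambda>x v. 0"]) auto

lemma C1_component: "C1 (\<lambda>x. x $ i)"
  unfolding C1_def
  by (intro exI[of _ "\<lambda>x v. v $ i"])
     (auto intro!: bounded_linear_imp_has_derivative bounded_linear_vec_nth)

lemma C1_add:
  assumes "C1 g" "C1 h" shows "C1 (\<lambda>x. g x + h x)"
proof -
  obtain g' h' where g: "\<And>x. (g has_derivative g' x) (at x)" "\<And>v. continuous_on UNIV (\<lambda>x. g' x v)"
    and h: "\<And>x. (h has_derivative h' x) (at x)" "\<And>v. continuous_on UNIV (\<lambda>x. h' x v)"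
    using assms unfolding C1_def by blast
  have "((\<lambda>x. g x + h x) has_derivative (\<lambda>v. g' x v + h' x v)) (at x)" for x
    by (rule has_derivative_add[OF g(1) h(1)])
  moreover have "continuous_on UNIV (\<lambda>x. g' x v + h' x v)" for v
    by (intro continuous_intros g h)
  ultimately show ?thesis unfolding C1_def
    by (intro exI[of _ "\<lambda>x v. g' x v + h' x v"] conjI allI) simp_all
qed

lemma C1_mult:
  assumes "C1 g" "C1 h" shows "C1 (\<lambda>x. g x * h x)"
proof -
  obtain g' h' where g: "\<And>x. (g has_derivative g' x) (at x)" "\<And>v. continuous_on UNIV (\<lambda>x. g' x v)"
    and h: "\<And>x. (h has_derivative h' x) (at x)" "\<And>v. continuous_on UNIV (\<lambda>x. h' x v)"
    using assms unfolding C1_def by blast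
  have "((\<lambda>x. g x * h x) has_derivative (\<lambda>v. g x * h' x v + g' x v * h x)) (at x)" for x
    by (rule has_derivative_mult[OF g(1) h(1)])
  moreover have "continuous_on UNIV (\<lambda>x. g x * h' x v + g' x v * h x)" for v
    by (intro continuous_intros g h C1_continuous assms)
  ultimately show ?thesis unfolding C1_def
    by (intro exI[of _ "\<lambda>x v. g x * h' x v + g' x v * h x"] conjI allI) simp_all
qed

lemma C1_power: "C1 h \<Longrightarrow> C1 (\<lambda>x. h x ^ k)"
proof (induction k)
  case 0 show ?case unfolding power_0 by (rule C1_const)
next
  case (Suc k) then show ?case unfolding power_Suc by (intro C1_mult[of h])
qed

lemma C1_prod: "finite I \<Longrightarrow> (\<And>i. i \<in> I \<Longrightarrow> C1 (h i)) \<Longrightarrow> C1 (\<lambda>x. \<Prod>i\<in>I. h i x)"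
proof (induction I rule: finite_induct)
  case empty show ?case unfolding prod.empty by (rule C1_const)
next
  case (insert i I)
  then have "C1 (\<lambda>x. h i x * (\<Prod> i\<in>I. h i x))" by (intro C1_mult) simp_all
  then show ?case using insert.hyps by simp
qed

lemma C1_sum: "finite I \<Longrightarrow> (\<And>i. i \<in> I \<Longrightarrow> C1 (h i)) \<Longrightarrow> C1 (\<lambda>x. \<Sum>i\<in>I. h i x)"
proof (induction I rule: finite_induct)
  case empty show ?case unfolding sum.empty by (rule C1_const)
next
  case (insert i I)
  then have "C1 (\<lambda>x. h i x + (\<Sum> i\<in>I. h i x))" by (intro C1_add) simp_all
  then show ?case using insert.hyps by simp
qed

lemma C1_mpoly_fun: "C1 (mpoly_fun p)"
  unfolding mpoly_fun_def[abs_def]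
  by (rule C1_sum[OF finite_keys], rule C1_mult[OF C1_const], rule C1_prod[OF finite_class.finite_UNIV],
      rule C1_power[OF C1_component])

text \<open>Links the gradient built from \<open>frechet_derivative\<close> to any \<open>D\<close>
  given by \<open>has_derivative\<close>: linearity of \<open>D\<close> lets \<open>v\<close> be
  expanded in the coordinate vectors.\<close>

lemma gradient_inner:
  fixes h :: "real ^ 'n::finite \<Rightarrow> real"
  assumes "(h has_derivative D) (at x)"
  shows "v \<bullet> gradient h x = D v"
proof -
  interpret linear D using assms by (rule has_derivative_linear)
  have D: "frechet_derivative h (at x) = D" using assms by (rule frechet_derivative_at[symmetric])
  have "D v = D (\<Sum>i\<in>UNIV. v $ i *\<^sub>R axis i 1)"
    using basis_expansion[of v] by (simp add: scalar_mult_eq_scaleR)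
  also have "\<dots> = (\<Sum>i\<in>UNIV. v $ i * D (axis i 1))" by (simp add: sum scale)
  finally show ?thesis by (simp add: inner_vec_def gradient_def partial_deriv_def D)
qed

lemma C_infinity_C1:
  fixes h :: "real ^ 'n::finite \<Rightarrow> real"
  assumes "C_infinity h" shows "C1 h"
proof -
  have "C_k (Suc 0) h" using assms unfolding C_infinity_def by blast
  then have d: "\<And>x. h differentiable (at x)" and c: "\<And>i. continuous_on UNIV (partial_deriv h i)" by auto
  have D: "(h has_derivative (\<lambda>v. v \<bullet> gradient h x)) (at x)" for x
  proof -
    obtain D where D: "(h has_derivative D) (at x)" using d[of x] unfolding differentiable_def by blast
    then have "D = (\<lambda>v. v \<bullet> gradient h x)" using gradient_inner[OF D] by auto
    then show ?thesis using D by simp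
  qed
  moreover have "continuous_on UNIV (\<lambda>x. v \<bullet> gradient h x)" for v
    unfolding gradient_def inner_vec_def by (auto intro!: continuous_intros c)
  ultimately show ?thesis unfolding C1_def by (intro exI[of _ "\<lambda>x v. v \<bullet> gradient h x"]) auto
qed

text \<open>A substitution \<open>x\<^sub>i = t ^ (s ^ e i)\<close> with \<open>e\<close> injective and \<open>s\<close> generic separates the monomials,
  and so reduces the claim to polynomials in one variable.\<close>

lemma separating_weights:
  fixes K :: "('n::finite \<Rightarrow>\<^sub>0 nat) set"
  assumes "finite K"
  obtains w :: "'n \<Rightarrow> nat" where "inj_on (\<lambda>m. \<Sum>i\<in>UNIV. Poly_Mapping.lookup m i * w i) K"
proof -
  obtain e :: "'n \<Rightarrow> nat" where e: "inj e" using finite_imp_inj_to_nat_seg[of "UNIV :: 'n set"] by auto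
  \<comment> \<open>The exponent vector is stored in the coefficients of \<open>q m\<close> at the
    distinct degrees \<open>e i\<close>, so different exponent vectors give different polynomials;
    integer coefficients allow differences.\<close>
  define q :: "('n \<Rightarrow>\<^sub>0 nat) \<Rightarrow> int poly" where
    "q m = (\<Sum>i\<in>UNIV. monom (int (Poly_Mapping.lookup m i)) (e i))" for m
  have qc: "coeff (q m) (e i) = int (Poly_Mapping.lookup m i)" for m i
  proof -
    have "coeff (q m) (e i) = (\<Sum>j\<in>UNIV. if j = i then int (Poly_Mapping.lookup m j) else 0)"
      unfolding q_def coeff_sum by (intro sum.cong) (auto simp: inj_eq[OF e])
    then show ?thesis by simp
  qed
  have neq: "q m \<noteq> q m'" if "m \<noteq> m'" for m m'
  proof
    assume "q m = q m'"
    then have "Poly_Mapping.lookup m i = Poly_Mapping.lookup m' i" for i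
      using qc[of m i] qc[of m' i] by simp
    then show False using that by (auto intro: poly_mapping_eqI)
  qed
  define Z where "Z = (\<lambda>(m, m'). {s. poly (q m - q m') s = 0})"
  define D where "D = {(m, m') \<in> K \<times> K. m \<noteq> m'}"
  have "finite D" unfolding D_def by (rule finite_subset[of _ "K \<times> K"]) (use assms in auto)
  moreover have "finite (Z p)" if pD: "p \<in> D" for p
  proof -
    obtain m m' where p: "p = (m, m')" "m \<noteq> m'" using pD by (auto simp: D_def)
    have "finite {s. poly (q m - q m') s = 0}" by (rule poly_roots_finite) (use neq p in simp)
    then show ?thesis by (simp add: Z_def p)
  qed
  ultimately have "finite (\<Union>p\<in>D. Z p)" by (rule finite_UN_I)
  \<comment> \<open>A natural number \<open>s\<close> outside the finitely many roots of the
    differences \<open>q m - q m'\<close> separates the values, and the numbers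
    \<open>s ^ e i\<close> are the required weights.\<close>
  then have "finite (int -` (\<Union>p\<in>D. Z p))"
    by (intro finite_vimageI) auto
  then obtain s where "s \<notin> int -` (\<Union>p\<in>D. Z p)"
    using ex_new_if_finite[OF infinite_UNIV_nat] by blast
  then have s: "poly (q m) (int s) \<noteq> poly (q m') (int s)" if "m \<in> K" "m' \<in> K" "m \<noteq> m'" for m m'
    using that by (auto simp: D_def Z_def)
  have qs: "poly (q m) (int s) = int (\<Sum>i\<in>UNIV. Poly_Mapping.lookup m i * s ^ e i)" for m
    unfolding q_def by (simp add: poly_sum poly_monom)
  then have "inj_on (\<lambda>m. \<Sum>i\<in>UNIV. Poly_Mapping.lookup m i * s ^ e i) K"
    using s unfolding qs by (intro inj_onI) (metis (no_types, lifting))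
  then show ?thesis by (rule that)
qed

text \<open>On the curve with coordinates \<open>t ^ w i\<close> the monomials of \<open>K\<close>
  become distinct powers of \<open>t\<close>, so \<open>a m0\<close> is itself a coefficient of the
  resulting polynomial in \<open>t\<close>, which therefore is not zero.\<close>

lemma monomials_independent:
  fixes K :: "('n::finite \<Rightarrow>\<^sub>0 nat) set" and a :: "('n \<Rightarrow>\<^sub>0 nat) \<Rightarrow> real"
  assumes K: "finite K" "m0 \<in> K" "a m0 \<noteq> 0"
  obtains x where "(\<Sum>m\<in>K. a m * monomial m x) \<noteq> 0"
proof -
  obtain w where w: "inj_on (\<lambda>m. \<Sum>i\<in>UNIV. Poly_Mapping.lookup m i * w i) K"
    using separating_weights[OF K(1)] by blast
  define N where "N m = (\<Sum>i\<in>UNIV. Poly_Mapping.lookup m i * w i)" for m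
  have N: "inj_on N K" using w unfolding N_def .
  define r where "r = (\<Sum>m\<in>K. monom (a m) (N m))"
  have "coeff r (N m0) = (\<Sum>m\<in>K. if m = m0 then a m else 0)"
    unfolding r_def coeff_sum using inj_on_eq_iff[OF N _ K(2)] by (intro sum.cong) auto
  then have "r \<noteq> 0" using K by auto
  then obtain t where t: "poly r t \<noteq> 0"
    using poly_all_0_iff_0 by blast
  define x :: "real ^ 'n" where "x = (\<chi> i. t ^ w i)"
  have "monomial m x = t ^ N m" for m
    by (simp add: monomial_def x_def N_def power_sum power_mult[symmetric] mult.commute)
  then have "(\<Sum>m\<in>K. a m * monomial m x) = poly r t"
    unfolding r_def by (simp add: poly_sum poly_monom)
  then show ?thesis using t that by metis
qed

section \<open>Leading forms and growth along rays\<close>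

definition top_form :: "'n::finite real_mpoly \<Rightarrow> real ^ 'n \<Rightarrow> real" where
  "top_form p x = (\<Sum>m | m \<in> Poly_Mapping.keys p \<and> total_degree m = mpoly_degree p. Poly_Mapping.lookup p m * monomial m x)"

lemma top_form_scale: "top_form p (t *\<^sub>R x) = t ^ mpoly_degree p * top_form p x"
  unfolding top_form_def by (simp add: monomial_scale sum_distrib_left mult_ac)

text \<open>A positive degree is attained at an actual monomial and not at the 0 inserted in
  \<open>mpoly_degree\<close>, so the leading form has a nonzero coefficient.\<close>

lemma top_form_nonzero:
  assumes "mpoly_degree p > 0"
  obtains x where "top_form p x \<noteq> 0"
proof -
  have "mpoly_degree p \<in> insert 0 (total_degree ` Poly_Mapping.keys p)"
    unfolding mpoly_degree_def total_degree_def[abs_def] by (intro Max_in) auto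
  then obtain m where m: "m \<in> Poly_Mapping.keys p" "total_degree m = mpoly_degree p" using assms by auto
  then show ?thesis
    using monomials_independent[of "{m \<in> Poly_Mapping.keys p. total_degree m = mpoly_degree p}" m "Poly_Mapping.lookup p"]
      that unfolding top_form_def by (auto simp: in_keys_iff)
qed

text \<open>For \<open>t \<ge> 1\<close> every monomial outside the leading form scales by at most
  \<open>t ^ (d - 1)\<close>, and monomials are bounded for
  \<open>norm \<xi> \<le> R\<close>.\<close>

lemma mpoly_minus_top_form_bound:
  fixes p :: "'n::finite real_mpoly"
  assumes "mpoly_degree p > 0"
  obtains M where "\<And>t \<xi>. t \<ge> 1 \<Longrightarrow> norm \<xi> \<le> R \<Longrightarrow>
    \<bar>mpoly_fun p (t *\<^sub>R \<xi>) - t ^ mpoly_degree p * top_form p \<xi>\<bar> \<le> M * t ^ (mpoly_degree p - 1)"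
proof -
  let ?d = "mpoly_degree p"
  define K where "K = {m \<in> Poly_Mapping.keys p. total_degree m \<noteq> ?d}"
  have "\<forall>m :: 'n \<Rightarrow>\<^sub>0 nat. \<exists>B\<ge>0. \<forall>\<xi>. norm \<xi> \<le> R \<longrightarrow> \<bar>monomial m \<xi>\<bar> \<le> B"
    using continuous_bounded_on_cball[OF monomial_continuous] by metis
  from choice[OF this] obtain B :: "('n \<Rightarrow>\<^sub>0 nat) \<Rightarrow> real" where
    B: "\<And>m. B m \<ge> 0" "\<And>m \<xi>. norm \<xi> \<le> R \<Longrightarrow> \<bar>monomial m \<xi>\<bar> \<le> B m" by blast
  have "\<bar>mpoly_fun p (t *\<^sub>R \<xi>) - t ^ ?d * top_form p \<xi>\<bar> \<le> (\<Sum>m\<in>K. \<bar>Poly_Mapping.lookup p m\<bar> * B m) * t ^ (?d - 1)"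
    if t: "t \<ge> 1" and \<xi>: "norm \<xi> \<le> R" for t \<xi>
  proof -
    have "mpoly_fun p (t *\<^sub>R \<xi>) = top_form p (t *\<^sub>R \<xi>) + (\<Sum>m\<in>K. Poly_Mapping.lookup p m * monomial m (t *\<^sub>R \<xi>))"
      unfolding mpoly_fun_eq top_form_def K_def
      by (subst sum.union_disjoint[symmetric]) (auto intro!: sum.cong)
    then have "\<bar>mpoly_fun p (t *\<^sub>R \<xi>) - t ^ ?d * top_form p \<xi>\<bar> = \<bar>\<Sum>m\<in>K. Poly_Mapping.lookup p m * monomial m (t *\<^sub>R \<xi>)\<bar>"
      by (simp add: top_form_scale)
    also have "\<dots> \<le> (\<Sum>m\<in>K. \<bar>Poly_Mapping.lookup p m * monomial m (t *\<^sub>R \<xi>)\<bar>)" by (rule sum_abs)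
    also have "\<dots> \<le> (\<Sum>m\<in>K. (\<bar>Poly_Mapping.lookup p m\<bar> * B m) * t ^ (?d - 1))"
    proof (rule sum_mono)
      fix m assume "m \<in> K"
      then have "total_degree m \<le> ?d - 1" using total_degree_le[of m p] by (auto simp: K_def)
      then have "t ^ total_degree m \<le> t ^ (?d - 1)" using t by (intro power_increasing) auto
      then have "\<bar>monomial m \<xi>\<bar> * t ^ total_degree m \<le> B m * t ^ (?d - 1)"
        using B \<xi> t by (intro mult_mono) auto
      then have "\<bar>Poly_Mapping.lookup p m\<bar> * (\<bar>monomial m \<xi>\<bar> * t ^ total_degree m) \<le> \<bar>Poly_Mapping.lookup p m\<bar> * (B m * t ^ (?d - 1))"
        by (intro mult_left_mono) auto
      then show "\<bar>Poly_Mapping.lookup p m * monomial m (t *\<^sub>R \<xi>)\<bar> \<le> (\<bar>Poly_Mapping.lookup p m\<bar> * B m) * t ^ (?d - 1)"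
        using t by (simp add: monomial_scale abs_mult mult_ac)
    qed
    also have "\<dots> = (\<Sum>m\<in>K. \<bar>Poly_Mapping.lookup p m\<bar> * B m) * t ^ (?d - 1)" by (simp add: sum_distrib_right)
    finally show ?thesis .
  qed
  then show ?thesis by (rule that)
qed

lemma mpoly_growth:
  fixes p :: "'n::finite real_mpoly"
  assumes d: "mpoly_degree p > 0"
  obtains \<omega> \<delta> \<kappa> t0 where "\<delta> > 0" "\<kappa> > 0"
    "\<And>\<xi> t. \<xi> \<in> ball \<omega> \<delta> \<Longrightarrow> t \<ge> t0 \<Longrightarrow> \<kappa> * t ^ mpoly_degree p \<le> \<bar>mpoly_fun p (t *\<^sub>R \<xi>)\<bar>"
proof -
  let ?d = "mpoly_degree p"
  obtain \<omega> where \<omega>: "top_form p \<omega> \<noteq> 0" using top_form_nonzero[OF d] by blast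
  \<comment> \<open>With a quarter of the value at \<open>\<omega>\<close>, the leading form stays
    at least \<open>2 \<kappa>\<close> in modulus near \<open>\<omega>\<close>, and the lower terms
    cost at most \<open>\<kappa> t^d\<close> once \<open>t \<ge> M / \<kappa>\<close>.\<close>
  define \<kappa> where "\<kappa> = \<bar>top_form p \<omega>\<bar> / 4"
  have \<kappa>: "\<kappa> > 0" using \<omega> by (simp add: \<kappa>_def)
  have "continuous_on UNIV (top_form p)"
    unfolding top_form_def[abs_def] by (intro continuous_intros continuous_on_compose2[OF monomial_continuous]) auto
  then have "isCont (top_form p) \<omega>" by (simp add: continuous_on_eq_continuous_at)
  then obtain \<delta> where \<delta>: "\<delta> > 0" "\<And>\<xi>. dist \<xi> \<omega> < \<delta> \<Longrightarrow> dist (top_form p \<xi>) (top_form p \<omega>) < 2 * \<kappa>"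
    using \<kappa> unfolding continuous_at_eps_delta by (metis mult_pos_pos zero_less_numeral)
  obtain M where M: "\<And>t \<xi>. t \<ge> 1 \<Longrightarrow> norm \<xi> \<le> norm \<omega> + \<delta> \<Longrightarrow>
    \<bar>mpoly_fun p (t *\<^sub>R \<xi>) - t ^ ?d * top_form p \<xi>\<bar> \<le> M * t ^ (?d - 1)"
    using mpoly_minus_top_form_bound[OF d] by blast
  have "\<kappa> * t ^ ?d \<le> \<bar>mpoly_fun p (t *\<^sub>R \<xi>)\<bar>" if \<xi>: "\<xi> \<in> ball \<omega> \<delta>" and t: "t \<ge> max 1 (M / \<kappa>)" for \<xi> t
  proof -
    have "norm \<xi> \<le> norm \<omega> + \<delta>"
      using \<xi> norm_triangle_sub[of \<xi> \<omega>] by (simp add: dist_norm norm_minus_commute)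
    then have b: "\<bar>mpoly_fun p (t *\<^sub>R \<xi>) - t ^ ?d * top_form p \<xi>\<bar> \<le> M * t ^ (?d - 1)" using M t by simp
    have "M \<le> \<kappa> * t" using t \<kappa> by (simp add: pos_divide_le_eq mult.commute)
    then have "M * t ^ (?d - 1) \<le> \<kappa> * t * t ^ (?d - 1)" using t by (intro mult_right_mono) auto
    also have "\<dots> = \<kappa> * t ^ ?d" using d by (simp add: power_eq_if)
    finally have c: "M * t ^ (?d - 1) \<le> \<kappa> * t ^ ?d" .
    have "\<bar>top_form p \<xi> - top_form p \<omega>\<bar> < 2 * \<kappa>"
      using \<delta>(2)[of \<xi>] \<xi> by (simp add: dist_real_def dist_commute)
    moreover have "\<bar>top_form p \<omega>\<bar> = 4 * \<kappa>" by (simp add: \<kappa>_def)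
    ultimately have "2 * \<kappa> \<le> \<bar>top_form p \<xi>\<bar>"
      using abs_triangle_ineq2_sym[of "top_form p \<omega>" "top_form p \<xi>"] by linarith
    then have "2 * \<kappa> * t ^ ?d \<le> \<bar>t ^ ?d * top_form p \<xi>\<bar>"
      using t by (simp add: abs_mult mult.commute mult_left_mono)
    then show ?thesis using b c by linarith
  qed
  then show ?thesis by (rule that[OF \<delta>(1) \<kappa>])
qed

text \<open>A positive value of the leading form at \<open>x\<close> would dominate the lower terms
  far out on the ray through \<open>x\<close> and make the polynomial positive there.\<close>

lemma top_form_nonpos:
  fixes p :: "'n::finite real_mpoly"
  assumes d: "mpoly_degree p > 0" and neg: "\<And>x. mpoly_fun p x \<le> 0"
  shows "top_form p x \<le> 0"
proof (rule ccontr)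
  assume "\<not> ?thesis"
  then have T: "top_form p x > 0" by simp
  let ?d = "mpoly_degree p"
  obtain M where M: "\<And>t \<xi>. t \<ge> 1 \<Longrightarrow> norm \<xi> \<le> norm x \<Longrightarrow>
    \<bar>mpoly_fun p (t *\<^sub>R \<xi>) - t ^ ?d * top_form p \<xi>\<bar> \<le> M * t ^ (?d - 1)"
    using mpoly_minus_top_form_bound[OF d] by blast
  define t where "t = max 1 ((M + 1) / top_form p x)"
  have t: "t \<ge> 1" "M + 1 \<le> t * top_form p x"
    using T by (auto simp: t_def max_def field_simps)
  have "t ^ ?d * top_form p x = t ^ (?d - 1) * (t * top_form p x)" using d by (simp add: power_eq_if)
  also have "\<dots> \<ge> t ^ (?d - 1) * (M + 1)" using t by (intro mult_left_mono) auto
  finally have "t ^ ?d * top_form p x \<ge> M * t ^ (?d - 1) + t ^ (?d - 1)" by (simp add: algebra_simps)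
  moreover have "t ^ (?d - 1) > 0" using t by simp
  ultimately show False using M[OF t(1), of x] neg[of "t *\<^sub>R x"] by simp
qed

text \<open>A leading form of odd degree changes sign under \<open>x \<mapsto> - x\<close>, so it
  cannot be nonpositive everywhere without vanishing.\<close>

lemma mpoly_degree_even:
  fixes p :: "'n::finite real_mpoly"
  assumes neg: "\<And>x. mpoly_fun p x \<le> 0"
  shows "even (mpoly_degree p)"
proof (rule ccontr)
  assume o: "odd (mpoly_degree p)"
  then have d: "mpoly_degree p > 0" by (auto intro: Nat.gr0I)
  obtain x where "top_form p x \<noteq> 0" using top_form_nonzero[OF d] by blast
  moreover have "top_form p ((-1) *\<^sub>R x) = - top_form p x" unfolding top_form_scale using o by simp
  ultimately show False using top_form_nonpos[OF d neg, of x] top_form_nonpos[OF d neg, of "(-1) *\<^sub>R x"] by simp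
qed

lemma mpoly_degree_0_const:
  assumes "mpoly_degree p = 0"
  shows "mpoly_fun p x = mpoly_fun p y"
proof -
  have "monomial m x = monomial m y" if "m \<in> Poly_Mapping.keys p" for m
  proof -
    have "total_degree m = 0" using total_degree_le[OF that] assms by simp
    then show ?thesis by (simp add: monomial_def total_degree_def)
  qed
  then show ?thesis unfolding mpoly_fun_eq by (intro sum.cong) auto
qed

section \<open>Quadratic polynomials\<close>

definition quadratic :: "(real ^ 'n::finite \<Rightarrow> real) \<Rightarrow> bool" where
  "quadratic h \<longleftrightarrow> (\<exists>a g M. \<forall>x. h x = a + g \<bullet> x + x \<bullet> (M *v x))"

lemma quadratic_const: "quadratic (\<lambda>x. k)"
  unfolding quadratic_def by (rule exI[of _ k], rule exI[of _ 0], rule exI[of _ 0]) simp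

lemma quadratic_component: "quadratic (\<lambda>x. x $ i)"
  unfolding quadratic_def by (rule exI[of _ 0], rule exI[of _ "axis i 1"], rule exI[of _ 0]) (simp add: inner_axis' )

text \<open>A single matrix unit represents the product; the matrix in \<open>quadratic\<close> may
  be nonsymmetric, and symmetrization is left to \<open>quadratic_center\<close>.\<close>

lemma quadratic_component_mult: "quadratic (\<lambda>x::real ^ 'n::finite. x $ i * x $ j)"
  unfolding quadratic_def
proof (rule exI[of _ 0], rule exI[of _ 0], rule exI[of _ "\<chi> k l. if k = i \<and> l = j then 1 else 0"], intro allI)
  fix x :: "real ^ 'n"
  have "(\<chi> k l. if k = i \<and> l = j then 1 else 0) *v x = axis i (x $ j)"
    by (auto simp: vec_eq_iff matrix_vector_mult_def axis_def if_distrib[of "\<lambda>z. z * _"] cong: if_cong)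
  then show "x $ i * x $ j = 0 + 0 \<bullet> x + x \<bullet> ((\<chi> k l. if k = i \<and> l = j then 1 else 0) *v x)"
    by (simp add: inner_axis)
qed

lemma quadratic_add:
  assumes "quadratic g" "quadratic h" shows "quadratic (\<lambda>x. g x + h x)"
proof -
  obtain a b M where g: "\<And>x. g x = a + b \<bullet> x + x \<bullet> (M *v x)" using assms(1) unfolding quadratic_def by blast
  obtain a' b' M' where h: "\<And>x. h x = a' + b' \<bullet> x + x \<bullet> (M' *v x)" using assms(2) unfolding quadratic_def by blast
  show ?thesis unfolding quadratic_def
    by (rule exI[of _ "a + a'"], rule exI[of _ "b + b'"], rule exI[of _ "M + M'"])
       (simp add: g h inner_add_left inner_add_right matrix_vector_mult_add_rdistrib)
qed

lemma quadratic_scale: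
  assumes "quadratic h" shows "quadratic (\<lambda>x. k * h x)"
proof -
  obtain a b M where h: "\<And>x. h x = a + b \<bullet> x + x \<bullet> (M *v x)" using assms unfolding quadratic_def by blast
  show ?thesis unfolding quadratic_def
    by (rule exI[of _ "k * a"], rule exI[of _ "k *\<^sub>R b"], rule exI[of _ "k *\<^sub>R M"])
       (simp add: h scaleR_matrix_vector_assoc[symmetric] algebra_simps)
qed

text \<open>Peeling off one variable with a positive exponent lowers the degree by one; doing this
  at most twice leaves the constant monomial.\<close>

lemma monomial_degree_le_2:
  assumes "total_degree m \<le> 2" shows "quadratic (monomial m)"
proof -
  have split: "\<exists>i n. total_degree m = Suc (total_degree n) \<and> (\<forall>x. monomial m x = x $ i * monomial n x)"
    if td: "total_degree m \<noteq> 0" for m :: "'a \<Rightarrow>\<^sub>0 nat"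
  proof -
    obtain i where i: "Poly_Mapping.lookup m i \<noteq> 0" using td by (auto simp: total_degree_def)
    define n where "n = m - Poly_Mapping.single i 1"
    have n: "Poly_Mapping.lookup n j = (if j = i then Poly_Mapping.lookup m i - 1 else Poly_Mapping.lookup m j)" for j
      by (simp add: n_def lookup_minus lookup_single when_def)
    have "total_degree m = Poly_Mapping.lookup m i + (\<Sum>j\<in>UNIV - {i}. Poly_Mapping.lookup m j)"
      unfolding total_degree_def by (simp add: sum.remove[of UNIV i])
    moreover have "total_degree n = (Poly_Mapping.lookup m i - 1) + (\<Sum>j\<in>UNIV - {i}. Poly_Mapping.lookup m j)"
      unfolding total_degree_def by (simp add: sum.remove[of UNIV i] n)
    moreover have "monomial m x = x $ i ^ Poly_Mapping.lookup m i * (\<Prod>j\<in>UNIV - {i}. x $ j ^ Poly_Mapping.lookup m j)" for x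
      unfolding monomial_def by (simp add: prod.remove[of UNIV i])
    moreover have "monomial n x = x $ i ^ (Poly_Mapping.lookup m i - 1) * (\<Prod>j\<in>UNIV - {i}. x $ j ^ Poly_Mapping.lookup m j)" for x
      unfolding monomial_def by (simp add: prod.remove[of UNIV i] n)
    ultimately show ?thesis using i by (intro exI[of _ i] exI[of _ n]) (auto simp: power_eq_if)
  qed
  have deg0: "monomial m = (\<lambda>x. 1)" if "total_degree m = 0" for m :: "'a \<Rightarrow>\<^sub>0 nat"
    using that by (auto simp: monomial_def[abs_def] total_degree_def)
  consider "total_degree m = 0" | "total_degree m = 1" | "total_degree m = 2" using assms by linarith
  then show ?thesis
  proof cases
    case 1
    then show ?thesis using deg0[of m] quadratic_const by simp
  next
    case 2
    then obtain i n where "total_degree n = 0" "\<And>x. monomial m x = x $ i * monomial n x" using split[of m] by auto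
    then have "monomial m = (\<lambda>x. x $ i)" using deg0[of n] by auto
    then show ?thesis using quadratic_component by simp
  next
    case 3
    then obtain i n where "total_degree m = Suc (total_degree n)" and n: "\<forall>x. monomial m x = x $ i * monomial n x"
      using split[of m] by auto
    then have n1: "total_degree n = 1" using 3 by simp
    then obtain j n' where "total_degree n = Suc (total_degree n')" and n': "\<forall>x. monomial n x = x $ j * monomial n' x"
      using split[of n] by auto
    then have "total_degree n' = 0" using n1 by simp
    then have "monomial m = (\<lambda>x. x $ i * x $ j)" using deg0[of n'] n n' by auto
    then show ?thesis using quadratic_component_mult by simp
  qed
qed

lemma quadratic_sum: "finite I \<Longrightarrow> (\<And>i. i \<in> I \<Longrightarrow> quadratic (h i)) \<Longrightarrow> quadratic (\<lambda>x. \<Sum>i\<in>I. h i x)"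
  by (induction I rule: finite_induct) (auto intro: quadratic_const quadratic_add)

lemma mpoly_degree_2_quadratic:
  assumes "mpoly_degree p \<le> 2" shows "quadratic (mpoly_fun p)"
  unfolding mpoly_fun_eq[abs_def]
  by (intro quadratic_sum quadratic_scale monomial_degree_le_2) (use total_degree_le assms in \<open>auto intro: order_trans\<close>)

text \<open>The center is a maximum point of \<open>h\<close>: the linear part \<open>g\<close> lies in the range of the symmetric
  matrix \<open>M + M\<^sup>T\<close>, since otherwise \<open>h\<close> is affine and nonconstant along a line of its kernel.\<close>

lemma quadratic_center:
  fixes h :: "real ^ 'n::finite \<Rightarrow> real"
  assumes q: "quadratic h" and neg: "\<And>x. h x \<le> 0"
    and D: "\<And>x. (h has_derivative h' x) (at x)"
  obtains b where "\<And>z. h' z (z - b) \<ge> 2 * h z"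
proof -
  obtain a g M where h: "\<And>x. h x = a + g \<bullet> x + x \<bullet> (M *v x)" using q unfolding quadratic_def by blast
  \<comment> \<open>The constant Hessian of \<open>h\<close>; its symmetry makes kernel and range
    orthogonal.\<close>
  define H where "H = M + transpose M"
  have T: "x \<bullet> (transpose M *v y) = y \<bullet> (M *v x)" for x y
    unfolding transpose_matrix_vector inner_commute[of x] by (rule dot_lmul_matrix)
  have Hxy: "x \<bullet> (H *v y) = x \<bullet> (M *v y) + y \<bullet> (M *v x)" for x y
    unfolding H_def by (simp only: matrix_vector_mult_add_rdistrib inner_add_right T)
  have sym: "x \<bullet> (H *v y) = y \<bullet> (H *v x)" for x y by (simp add: Hxy)
  have HM: "x \<bullet> (M *v x) = x \<bullet> (H *v x) / 2" for x by (simp add: Hxy)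
  obtain y z where yz: "y \<in> span (range (\<lambda>x. H *v x))" "\<And>w. w \<in> span (range (\<lambda>x. H *v x)) \<Longrightarrow> orthogonal z w" "g = y + z"
    using orthogonal_subspace_decomp_exists[of "range (\<lambda>x. H *v x)" g] by blast
  \<comment> \<open>\<open>z\<close> is orthogonal to the range, in particular to \<open>H\<close>
    applied to \<open>H z\<close>; by symmetry this inner product is \<open>|H z|^2\<close>, so
    \<open>z\<close> lies in the kernel.\<close>
  have "orthogonal z (H *v (H *v z))" by (rule yz(2)) (auto intro: span_base)
  then have "(H *v z) \<bullet> (H *v z) = 0" using sym[of "H *v z" z] by (simp add: orthogonal_def inner_commute)
  then have Hz: "H *v z = 0" by simp
  have "y \<bullet> z = 0" using yz(2)[OF yz(1)] by (simp add: orthogonal_def inner_commute)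
  then have gz: "g \<bullet> z = z \<bullet> z" by (simp add: yz(3) inner_add_left)
  have line: "a + t * (z \<bullet> z) \<le> 0" for t
  proof -
    have "(t *\<^sub>R z) \<bullet> (H *v (t *\<^sub>R z)) = 0" by (simp add: matrix_vector_mult_scaleR Hz)
    then have "h (t *\<^sub>R z) = a + t * (z \<bullet> z)" by (simp add: h gz HM)
    then show ?thesis using neg by metis
  qed
  have "z = 0"
  proof (rule ccontr)
    assume "z \<noteq> 0"
    then have "a + ((1 - a) / (z \<bullet> z)) * (z \<bullet> z) = 1" by simp
    then show False using line[of "(1 - a) / (z \<bullet> z)"] by simp
  qed
  moreover have "subspace (range (\<lambda>x. H *v x))"
    by (intro linear_subspace_image matrix_vector_mul_linear subspace_UNIV)
  ultimately have "g \<in> range (\<lambda>x. H *v x)" using yz by (simp add: span_eq_iff[THEN iffD2])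
  then obtain c where c: "g = H *v c" by blast
  \<comment> \<open>This \<open>b\<close> solves \<open>H b = - g\<close>, hence it is a critical
    point, about which \<open>h\<close> has no linear part.\<close>
  define b where "b = - c"
  have g: "g = - (H *v b)" using linear_neg[OF matrix_vector_mul_linear[of H], of c] by (simp add: c b_def)
  have h': "h' z v = g \<bullet> v + v \<bullet> (H *v z)" for z v
  proof -
    have "(h has_derivative (\<lambda>v. g \<bullet> v + v \<bullet> (H *v z))) (at z)"
    proof -
      have "((\<lambda>x. M *v x) has_derivative (\<lambda>v. M *v v)) (at z)"
        by (rule bounded_linear_imp_has_derivative[OF matrix_vector_mul_bounded_linear])
      then have "((\<lambda>x. a + g \<bullet> x + x \<bullet> (M *v x)) has_derivative (\<lambda>v. 0 + g \<bullet> v + (z \<bullet> (M *v v) + v \<bullet> (M *v z)))) (at z)"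
        by (intro has_derivative_add has_derivative_const has_derivative_inner has_derivative_inner_right
            has_derivative_ident)
      then show ?thesis unfolding h[abs_def] by (simp add: Hxy add_ac)
    qed
    then show ?thesis using has_derivative_unique[OF D[of z]] by metis
  qed
  \<comment> \<open>The exact second order expansion at \<open>b\<close>. With
    \<open>h b \<le> 0\<close> it gives \<open>2 h z \<le> (z - b) \<bullet> H (z - b)\<close>, and
    the right side is the derivative in the direction \<open>z - b\<close>.\<close>
  have hb: "h z = h b + (z - b) \<bullet> (H *v (z - b)) / 2" for z
    using sym[of b z]
    by (simp add: h HM g inner_diff_left inner_diff_right matrix_vector_mult_diff_distrib
        inner_commute[of "H *v b"] field_simps)
  have "h' z (z - b) \<ge> 2 * h z" for z
  proof -
    have "h' z (z - b) = (z - b) \<bullet> (H *v (z - b))"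
      by (simp add: h' g inner_diff_right matrix_vector_mult_diff_distrib inner_commute)
    then show ?thesis using hb[of z] neg[of b] by simp
  qed
  then show ?thesis by (rule that)
qed

section \<open>The volume inequality\<close>

lemma AE_zero_continuous:
  fixes g :: "'a::euclidean_space \<Rightarrow> real"
  assumes c: "continuous_on UNIV g" and ae: "AE x in lborel. g x = 0"
  shows "g x = 0"
proof (rule ccontr)
  assume x: "g x \<noteq> 0"
  have "open (g -` (- {0}))" using c by (intro open_vimage) auto
  moreover have "g -` (- {0}) \<noteq> {}" using x by auto
  ultimately have nn: "\<not> negligible (g -` (- {0}))" by (rule open_not_negligible)
  obtain N where N: "{x \<in> space lborel. \<not> g x = 0} \<subseteq> N" "emeasure lborel N = 0" "N \<in> sets lborel"
    using ae by (rule AE_E)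
  then have "N \<in> null_sets lborel" by (intro null_setsI)
  then have "negligible N" by (simp add: negligible_iff_null_sets null_sets_completionI)
  then have "negligible (g -` (- {0}))" by (rule negligible_subset) (use N(1) in auto)
  then show False using nn by simp
qed

text \<open>If \<open>d \<ge> n\<close>, then \<open>\<alpha> \<ge> 2\<close> at once. With
  \<open>r = d / n < 1\<close>, the case \<open>\<alpha> < 2\<close> has
  \<open>\<alpha> \<ge> 1 + r > 2 r\<close>, which turns
  \<open>\<alpha> (2 - \<alpha>) \<le> 2 r F\<close> into the strict inequality
  \<open>2 - \<alpha> < F\<close>. So equality is possible only for \<open>\<alpha> = 2\<close>,
  where \<open>F = 0\<close>.\<close>

lemma mass_excess_alternative:
  fixes \<alpha> F n d :: real
  assumes n: "n > 0" and d: "d \<ge> 0" and F: "F \<ge> 0" and a: "n + d \<le> n * \<alpha>"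
    and alt: "d \<ge> n \<or> d < n \<and> \<alpha>\<^sup>2 - 2 * \<alpha> \<ge> - (2 * d / n * F)"
  shows "\<alpha> + F \<ge> 2 \<and> (\<alpha> + F = 2 \<longrightarrow> F = 0)"
proof (cases "\<alpha> \<ge> 2")
  case False
  have "n * 2 > n * \<alpha>" using False n by simp
  then have dn: "d < n" using a by linarith
  define r where "r = d / n"
  have r: "0 \<le> r" "r < 1" "1 + r \<le> \<alpha>" using d dn n a by (auto simp: r_def field_simps)
  have "\<alpha> * (2 - \<alpha>) \<le> 2 * r * F" using alt dn by (simp add: r_def power2_eq_square algebra_simps)
  moreover have "2 * r * (2 - \<alpha>) < \<alpha> * (2 - \<alpha>)" using r False by (intro mult_strict_right_mono) auto
  ultimately have "2 * r * (2 - \<alpha>) < 2 * r * F" by linarith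
  \<comment> \<open>The strict inequality between the products rules out \<open>r = 0\<close>, so
    the factor can be cancelled.\<close>
  then have "2 - \<alpha> < F" using r by (simp add: mult_less_cancel_left)
  then show ?thesis by linarith
qed (use F in auto)

lemma unit_sphere_vol_pos: "unit_sphere_vol n > 0"
  unfolding unit_sphere_vol_def by (intro divide_pos_pos Gamma_real_pos) auto

text \<open>The chain rule at \<open>x = A^T (z - b)\<close> gives the derivative of
  \<open>\<phi>\<close> at \<open>z\<close> in the direction \<open>A x = z - b\<close>: the
  rotation drops out and only the center \<open>b\<close> remains.\<close>

lemma euler_inequality_rotated:
  fixes \<phi> :: "real ^ 'n::finite \<Rightarrow> real" and A :: "real ^ 'n ^ 'n"
  assumes D: "\<And>x. (\<phi> has_derivative \<phi>' x) (at x)" and A: "rotation_matrix A"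
    and ineq: "\<And>x. x \<bullet> gradient (\<lambda>x. \<phi> (A *v x + b)) x \<ge> d * \<phi> (A *v x + b)"
  shows "\<phi>' z (z - b) \<ge> d * \<phi> z"
proof -
  have A1: "A ** transpose A = mat 1"
    using A by (simp add: rotation_matrix_def orthogonal_matrix_def)
  define x where "x = transpose A *v (z - b)"
  have "A *v x = z - b" unfolding x_def by (simp only: matrix_vector_mul_assoc A1 matrix_vector_mul_lid)
  then have x: "A *v x + b = z" "A *v x = z - b" by simp_all
  have "((\<lambda>x. A *v x + b) has_derivative (\<lambda>v. A *v v)) (at x)"
    using bounded_linear_imp_has_derivative[OF matrix_vector_mul_bounded_linear[of A], of "at x"]
    by (auto intro!: derivative_eq_intros)
  from has_derivative_compose[OF this D]
  have "((\<lambda>x. \<phi> (A *v x + b)) has_derivative (\<lambda>v. \<phi>' z (A *v v))) (at x)" by (simp add: x)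
  from gradient_inner[OF this, of x] show ?thesis using ineq[of x] by (simp add: x)
qed

text \<open>A nonpositive polynomial has even degree, so only 0 and 2 occur. In degree 0 both sides
  vanish; in degree 2 the center of the quadratic serves.\<close>

lemma euler_center:
  fixes p :: "'n::finite real_mpoly"
  assumes D: "\<And>x. (mpoly_fun p has_derivative \<phi>' x) (at x)"
    and neg: "\<And>x. mpoly_fun p x \<le> 0" and d: "mpoly_degree p < 4"
  shows "\<exists>b. \<forall>z. \<phi>' z (z - b) \<ge> real (mpoly_degree p) * mpoly_fun p z"
proof -
  have "mpoly_degree p = 0 \<or> mpoly_degree p = 2"
    using mpoly_degree_even[OF neg] d by presburger
  then show ?thesis
  proof
    assume d0: "mpoly_degree p = 0"
    have "mpoly_fun p = (\<lambda>x. mpoly_fun p 0)" using mpoly_degree_0_const[OF d0] by auto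
    then have "(mpoly_fun p has_derivative (\<lambda>v. 0)) (at z)" for z by (metis has_derivative_const)
    then have "\<phi>' z = (\<lambda>v. 0)" for z using has_derivative_unique[OF D] by metis
    then show ?thesis using d0 by simp
  next
    assume d2: "mpoly_degree p = 2"
    then have q: "quadratic (mpoly_fun p)" by (intro mpoly_degree_2_quadratic) simp
    obtain b where "\<And>z. \<phi>' z (z - b) \<ge> 2 * mpoly_fun p z"
      using quadratic_center[OF q neg D] by blast
    then show ?thesis using d2 by auto
  qed
qed

theorem theorem5p3:
  fixes p :: "'n::finite real_mpoly"
    and \<phi> Q u :: "real ^ 'n \<Rightarrow> real"
  assumes "CARD('n) \<ge> 6" and "even CARD('n)"
    and "\<phi> = mpoly_fun p"
    and "\<forall>x. \<phi> x \<le> 0"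
    and "Q = (\<lambda>x. fact (CARD('n) - 1) + \<phi> x)"
    and "normal_solution Q u"
    and "4 \<le> mpoly_degree p \<and> mpoly_degree p \<le> CARD('n) - 2 \<Longrightarrow>
           \<exists>(A :: real ^ 'n ^ 'n) (b :: real ^ 'n). rotation_matrix A \<and>
             (let \<psi> = (\<lambda>x. \<phi> (A *v x + b))
              in \<forall>x. x \<bullet> gradient \<psi> x \<ge> real (mpoly_degree p) * \<psi> x)"
  shows "(\<integral>\<^sup>+ x. ennreal (exp (real CARD('n) * u x)) \<partial>lborel) \<ge> ennreal (unit_sphere_vol CARD('n)) \<and>
         ((\<integral>\<^sup>+ x. ennreal (exp (real CARD('n) * u x)) \<partial>lborel) = ennreal (unit_sphere_vol CARD('n)) \<longleftrightarrow>
            (\<forall>x. \<phi> x = 0))"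
proof -
  let ?n = "CARD('n)"
  let ?d = "mpoly_degree p"
  let ?e = "\<lambda>x. exp (real ?n * u x)"
  let ?S = "unit_sphere_vol ?n"
  let ?I = "\<integral>\<^sup>+ x. ennreal (?e x) \<partial>lborel"
  note p = assms(3) and neg = assms(4) and Q = assms(5)
  define c where "c = 2 / (fact (?n - 1) * ?S)"
  define f where "f x = Q x * ?e x" for x
  have S: "?S > 0" by (rule unit_sphere_vol_pos)
  have c: "c > 0" unfolding c_def using S by simp
  have dimn: "DIM(real ^ 'n) = ?n" by simp
  have Cinf: "C_infinity u" and fi: "integrable lborel f"
    and "\<exists>C. \<forall>x. u x = c * (LINT y|lborel. ln (norm y / norm (x - y)) * f y) + C"
    using assms(6) unfolding normal_solution_def c_def f_def mult.assoc by blast+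
  then obtain C where u_eq: "\<And>x. u x = c * (LINT y|lborel. ln (norm y / norm (x - y)) * f y) + C"
    by blast
  obtain u' where u': "\<And>x. (u has_derivative u' x) (at x)" "\<And>v. continuous_on UNIV (\<lambda>x. u' x v)"
    using C_infinity_C1[OF Cinf] unfolding C1_def by blast
  obtain \<phi>' where \<phi>': "\<And>x. (\<phi> has_derivative \<phi>' x) (at x)" "\<And>v. continuous_on UNIV (\<lambda>x. \<phi>' x v)"
    using C1_mpoly_fun[of p] unfolding p C1_def by blast
  have uc: "continuous_on UNIV u" by (rule C1_continuous[OF C_infinity_C1[OF Cinf]])
  have \<phi>c: "continuous_on UNIV \<phi>" unfolding p by (rule C1_continuous[OF C1_mpoly_fun])
  have Q': "(Q has_derivative \<phi>' x) (at x)" for x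
    unfolding Q using has_derivative_add[OF has_derivative_const \<phi>'(1), of "fact (?n - 1)" x] by simp
  have fc: "continuous_on UNIV f" unfolding f_def[abs_def] Q by (intro continuous_intros \<phi>c uc)
  interpret log_potential f u c C
    by unfold_locales (use assms(1) fi fc u_eq in auto)
  have em: "?e \<in> borel_measurable borel"
    by (intro borel_measurable_continuous_onI continuous_intros uc)
  show ?thesis
  proof (cases "integrable lborel ?e")
    case False
    then have I: "?I = \<infinity>"
      using em by (simp add: integrable_iff_bounded not_less top_unique)
    \<comment> \<open>If \<open>\<phi>\<close> vanished, \<open>f\<close> would be a nonzero
      constant multiple of \<open>e^{nu}\<close>, whose integral would then be finite.\<close>
    have "\<not> (\<forall>x. \<phi> x = 0)"
    proof
      assume "\<forall>x. \<phi> x = 0"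
      then have "f = (\<lambda>x. fact (?n - 1) * ?e x)" by (auto simp: f_def Q)
      then have "integrable lborel (\<lambda>x. 1 / fact (?n - 1) * (fact (?n - 1) * ?e x))"
        using fi by (intro integrable_mult_right) simp
      then show False using False by simp
    qed
    then show ?thesis using I by simp
  next
    case True
    define V where "V = (LINT x|lborel. ?e x)"
    have I: "?I = ennreal V" unfolding V_def by (rule nn_integral_eq_integral[OF True]) simp
    have V0: "V \<ge> 0" unfolding V_def by (intro integral_nonneg_AE) auto
    have ff: "f x = fact (?n - 1) * ?e x + \<phi> x * ?e x" for x by (simp add: f_def Q algebra_simps)
    have \<phi>i: "integrable lborel (\<lambda>x. \<phi> x * ?e x)"
      using Bochner_Integration.integrable_diff[OF fi integrable_mult_right[OF True, of "fact (?n - 1)"]]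
      by (simp add: ff)
    define \<Phi> where "\<Phi> = (LINT x|lborel. \<phi> x * ?e x)"
    have mass: "mass = fact (?n - 1) * V + \<Phi>"
      unfolding ff \<Phi>_def V_def using Bochner_Integration.integral_add[OF integrable_mult_right[OF True] \<phi>i]
      by (simp only: integral_mult_right_zero)
    define \<alpha> where "\<alpha> = c * mass"
    define F where "F = - c * \<Phi>"
    have "\<Phi> \<le> 0"
    proof -
      have "0 \<le> (LINT x|lborel. - (\<phi> x * ?e x))"
        using neg by (intro integral_nonneg_AE AE_I2) (simp add: mult_nonpos_nonneg)
      then show ?thesis by (simp add: \<Phi>_def)
    qed
    then have F: "F \<ge> 0" unfolding F_def using c by (simp add: mult_nonneg_nonpos)
    \<comment> \<open>Since \<open>c (n - 1)! = 2 / |S^n|\<close> and the two terms with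
      \<open>\<Phi>\<close> cancel, the claim becomes \<open>\<alpha> + F \<ge> 2\<close>.\<close>
    have v: "\<alpha> + F = 2 * V / ?S"
      unfolding \<alpha>_def F_def mass by (simp add: algebra_simps) (simp add: c_def)
    have F0: "F = 0 \<longleftrightarrow> (\<forall>x. \<phi> x = 0)"
    proof
      assume "F = 0"
      then have z: "(LINT x|lborel. - (\<phi> x * ?e x)) = 0" using c by (simp add: F_def \<Phi>_def)
      have i: "integrable lborel (\<lambda>x. - (\<phi> x * ?e x))" using \<phi>i by simp
      have "AE x in lborel. 0 \<le> - (\<phi> x * ?e x)"
        using neg by (intro AE_I2) (simp add: mult_nonpos_nonneg)
      then have "AE x in lborel. - (\<phi> x * ?e x) = 0"
        using integral_nonneg_eq_0_iff_AE[OF i] z by simp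
      then have "AE x in lborel. \<phi> x = 0" by simp
      then show "\<forall>x. \<phi> x = 0" using AE_zero_continuous[OF \<phi>c] by blast
    qed (simp add: F_def \<Phi>_def)
    have lower: "real ?n + real ?d \<le> real ?n * \<alpha>"
    \<comment> \<open>In degree 0 the polynomial may vanish, so the constant 1 with growth exponent
      0 replaces it; its integrability against \<open>e^{nu}\<close> is the finiteness of the
      volume.\<close>
    proof (cases "?d = 0")
      case True
      have "real DIM(real ^ 'n) + real 0 \<le> real DIM(real ^ 'n) * (c * mass)"
      proof (rule mass_lower_bound[OF uc continuous_on_const[of UNIV 1]])
        show "integrable lborel (\<lambda>x. 1 * exp (real DIM(real ^ 'n) * u x))"
          using \<open>integrable lborel ?e\<close> by simp
        show "(1::real) * t ^ 0 \<le> \<bar>1\<bar>" if "\<xi> \<in> ball 0 1" "t \<ge> 0" for \<xi> :: "real ^ 'n" and t :: real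
          by simp
      qed simp_all
      then show ?thesis using True by (simp add: \<alpha>_def)
    next
      case False
      then have "?d > 0" by simp
      then obtain \<omega> \<delta> \<kappa> t0 where g: "\<delta> > 0" "\<kappa> > 0"
        "\<And>\<xi> t. \<xi> \<in> ball \<omega> \<delta> \<Longrightarrow> t \<ge> t0 \<Longrightarrow> \<kappa> * t ^ ?d \<le> \<bar>mpoly_fun p (t *\<^sub>R \<xi>)\<bar>"
        by (rule mpoly_growth) blast
      show ?thesis
        using mass_lower_bound[OF uc \<phi>c _ g[folded p]] \<phi>i unfolding \<alpha>_def by simp
    qed
    have fQ: "f x = Q x * exp (real DIM(real ^ 'n) * u x)" for x by (simp add: f_def)
    note poh = pohozaev_identity[OF fQ Q' \<phi>'(2) u', unfolded dimn]
    \<comment> \<open>Degree and dimension are both even, so the degree \<open>n - 1\<close> does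
      not occur and the additional assumption covers every degree from 4 to below
      \<open>n\<close>.\<close>
    have "?d \<ge> ?n \<or> ?d \<le> ?n - 2"
    proof -
      have "even ?d" using mpoly_degree_even[of p] neg unfolding p by blast
      then show ?thesis using assms(1,2) by presburger
    qed
    have alt: "real ?d \<ge> real ?n \<or> real ?d < real ?n \<and> \<alpha>\<^sup>2 - 2 * \<alpha> \<ge> - (2 * real ?d / real ?n * F)"
    proof (cases "?d \<ge> ?n")
      case False
      then have dn: "?d \<le> ?n - 2" using \<open>?d \<ge> ?n \<or> ?d \<le> ?n - 2\<close> by simp
      have "\<exists>b. \<forall>z. \<phi>' z (z - b) \<ge> real ?d * \<phi> z"
      proof (cases "?d < 4")
        case True
        then show ?thesis using euler_center[of p \<phi>'] \<phi>'(1) neg unfolding p by blast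
      next
        case False
        then obtain A :: "real ^ 'n ^ 'n" and b where A: "rotation_matrix A"
          "\<And>x. x \<bullet> gradient (\<lambda>x. \<phi> (A *v x + b)) x \<ge> real ?d * \<phi> (A *v x + b)"
          using assms(7) dn by (auto simp: Let_def)
        show ?thesis using euler_inequality_rotated[OF \<phi>'(1) A] by blast
      qed
      then obtain b where b: "\<And>z. \<phi>' z (z - b) \<ge> real ?d * \<phi> z" by blast
      note cut = cutoff_integral_tendsto[OF integrable_mult_right[OF \<phi>i, of "real ?d"], where b=b]
      \<comment> \<open>The pointwise inequality is integrated against the cutoffs. The left sides
        converge because \<open>\<phi> e^{nu}\<close> is integrable, the right sides by the Pohozaev
        identity.\<close>
      have "(LINT x|lborel. real ?d * (\<phi> x * ?e x)) \<le> real ?n * (c * mass\<^sup>2 / 2 - mass)"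
      proof (rule LIMSEQ_le[OF cut(2) poh(2)[of b]], intro exI[of _ 0] allI impI)
        fix k
        show "(LINT x|lborel. cutoff (real (Suc k)) (x - b) * (real ?d * (\<phi> x * ?e x)))
          \<le> (LINT x|lborel. cutoff (real (Suc k)) (x - b) * (\<phi>' x (x - b) * ?e x))"
        proof (rule integral_mono[OF cut(1) poh(1)])
          fix x
          have "real ?d * \<phi> x * ?e x \<le> \<phi>' x (x - b) * ?e x" by (intro mult_right_mono b) auto
          then show "cutoff (real (Suc k)) (x - b) * (real ?d * (\<phi> x * ?e x))
            \<le> cutoff (real (Suc k)) (x - b) * (\<phi>' x (x - b) * ?e x)"
            using cutoff_bounds[of "real (Suc k)" "x - b"] by (intro mult_left_mono) (auto simp: mult.assoc)
        qed
      qed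
      then have "real ?d * \<Phi> \<le> real ?n * (c * mass\<^sup>2 / 2 - mass)" by (simp add: \<Phi>_def)
      \<comment> \<open>The factor \<open>2 c / n\<close> turns the limit into
        \<open>\<alpha>^2 - 2 \<alpha>\<close> and \<open>d \<Phi>\<close> into
        \<open>- (2 d / n) F\<close>.\<close>
      then have "2 * c / real ?n * (real ?d * \<Phi>) \<le> 2 * c / real ?n * (real ?n * (c * mass\<^sup>2 / 2 - mass))"
        using c by (intro mult_left_mono) auto
      also have "\<dots> = \<alpha>\<^sup>2 - 2 * \<alpha>" by (simp add: \<alpha>_def power2_eq_square field_simps)
      finally have "\<alpha>\<^sup>2 - 2 * \<alpha> \<ge> - (2 * real ?d / real ?n * F)" by (simp add: F_def mult_ac)
      then show ?thesis using False by simp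
    qed simp
    have concl: "\<alpha> + F \<ge> 2 \<and> (\<alpha> + F = 2 \<longrightarrow> F = 0)"
      by (rule mass_excess_alternative[OF _ _ F lower alt]) auto
    \<comment> \<open>For \<open>\<phi> = 0\<close> the Pohozaev integrals all vanish, which leaves
      \<open>mass = 0\<close> or \<open>\<alpha> = 2\<close>; the lower bound excludes the
      first.\<close>
    have zero: "\<alpha> + F = 2" if z: "\<forall>x. \<phi> x = 0"
    proof -
      have "\<phi> = (\<lambda>x. 0)" using z by auto
      then have "\<phi>' x = (\<lambda>v. 0)" for x using has_derivative_unique[OF \<phi>'(1)] has_derivative_const by metis
      then have "(\<lambda>k::nat. 0) \<longlonglongrightarrow> real ?n * (c * mass\<^sup>2 / 2 - mass)" using poh(2)[of 0] by simp
      then have "mass * (c * mass / 2 - 1) = 0"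
        using LIMSEQ_unique[OF tendsto_const] by (fastforce simp: power2_eq_square algebra_simps)
      moreover have "\<alpha> \<noteq> 0"
      proof
        assume "\<alpha> = 0"
        then show False using lower assms(1) by simp
      qed
      then have "mass \<noteq> 0" by (auto simp: \<alpha>_def)
      ultimately show ?thesis using F0 z by (simp add: \<alpha>_def)
    qed
    have "?S \<le> V" using concl S unfolding v by (simp add: pos_le_divide_eq)
    moreover have "V = ?S \<longleftrightarrow> \<alpha> + F = 2" unfolding v using S by (simp add: field_simps)
    ultimately show ?thesis unfolding I using concl zero F0 V0 S by (auto simp: ennreal_leI)
  qed
qed

end
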